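(* Let $\lambda,\Omega,\omega>0$ and $\Delta=\Omega-\omega$. For all $\Psi\in\mathbb{C}^2\otimes\mathscr{S}(\mathbb{R})$ and all $0\le t\le\pi/\omega$, $$\|(U_2(t)-U_1(t))\Psi\|\ge\frac{\lambda}{\omega}\sin(t\omega)\,\|(N-1)_+^{1/2}\Psi\|-\frac{\lambda}{\omega^2}(1-\cos(t\omega))\Bigl(|\Delta|\,\|(N+2)^{1/2}\Psi\|+3\lambda\,\bigl\|\bigl((N+2)(N+3)\bigr)^{1/2}\Psi\bigr\|\Bigr),$$ where $(N-1)_+$ denotes the positive part of the operator $N-1$.
   Context: On Schwartz space $\mathscr{S}(\mathbb{R})\subset L^2(\mathbb{R})$ let $a=\frac{1}{\sqrt2}(x+\frac{d}{dx})$ and $a^\dagger=\frac{1}{\sqrt2}(x-\frac{d}{dx})$, so $[a,a^\dagger]=I$. Let $$\sigma_x=\begin{pmatrix}0&1\\1&0\end{pmatrix},\quad \sigma_z=\begin{pmatrix}1&0\\0&-1\end{pmatrix},\quad \sigma_+=\begin{pmatrix}0&1\\0&0\end{pmatrix},\quad \sigma_-=\begin{pmatrix}0&0\\1&0\end{pmatrix}.$$ On $\mathbb{C}^2\otimes\mathscr{S}(\mathbb{R})$ (algebraic tensor product, a subspace of the Hilbert space $\mathbb{C}^2\otimes L^2(\mathbb{R})$) define $$H=\tfrac{\Omega}{2}\sigma_z\otimes I+I\otimes\omega a^\dagger a+\lambda\,\sigma_x\otimes(a+a^\dagger),$$ $$H_{\mathrm{RWA}}=\tfrac{\Omega}{2}\sigma_z\otimes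 I+I\otimes\omega a^\dagger a+\lambda(\sigma_+\otimes a+\sigma_-\otimes a^\dagger),$$ $$H_0=\tfrac{\omega}{2}\sigma_z\otimes I+I\otimes\omega a^\dagger a.$$ The same symbols denote the closures, which are self-adjoint ($\mathbb{C}^2\otimes\mathscr{S}(\mathbb{R})$ is a core). For $t\in\mathbb{R}$ set $U_1(t)=e^{itH_0}e^{-itH}$ and $U_2(t)=e^{itH_0}e^{-itH_{\mathrm{RWA}}}$. Put $N=I\otimes a^\dagger a$; functions of $N$ are defined by functional calculus. *)

theory Defs
  imports "HOL-Analysis.Analysis"
begin

section \<open>The Hilbert space of square integrable spinors\<close>

text \<open>
  The tensor product of \<open>\<complex>\<^sup>2\<close> with \<open>L\<^sup>2(\<real>)\<close> is realised as \<open>L\<^sup>2(\<real>; \<complex>\<^sup>2)\<close>, the elementary tensor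
  of \<open>v\<close> and \<open>f\<close> being the class of \<open>\<lambda>x. \<chi> i. v $ i * f x\<close>.
\<close>

definition sq_integrable :: "(real \<Rightarrow> complex ^ 2) set" where
  "sq_integrable = {f \<in> borel_measurable lborel. integrable lborel (\<lambda>x. (norm (f x))\<^sup>2)}"

definition ae_eq :: "(real \<Rightarrow> complex ^ 2) \<Rightarrow> (real \<Rightarrow> complex ^ 2) \<Rightarrow> bool" where
  "ae_eq f g \<longleftrightarrow> f \<in> sq_integrable \<and> g \<in> sq_integrable \<and> (AE x in lborel. f x = g x)"

definition cdot :: "complex ^ 2 \<Rightarrow> complex ^ 2 \<Rightarrow> complex" where
  "cdot v w = (\<Sum>i\<in>UNIV. cnj (v $ i) * w $ i)"

lemma Re_cdot: "Re (cdot v w) = inner v w"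
  by (simp add: cdot_def inner_vec_def inner_complex_def)

lemma measurable_cdot:
  assumes "f \<in> borel_measurable M" "g \<in> borel_measurable M"
  shows "(\<lambda>x. cdot (f x) (g x)) \<in> borel_measurable M"
proof -
  have "continuous_on UNIV (\<lambda>p. cdot (fst p) (snd p))"
    unfolding cdot_def by (intro continuous_intros)
  then show ?thesis
    using borel_measurable_continuous_Pair[OF assms, of cdot] by simp
qed

lemma norm_smult: "norm (c *s v) = cmod c * norm (v :: complex ^ 2)"
  by (simp add: norm_vec_def L2_set_def norm_mult power_mult_distrib
      flip: sum_distrib_left) (simp add: real_sqrt_mult)

lemma norm_cdot_le: "cmod (cdot v w) \<le> 2 * (norm v)\<^sup>2 + 2 * (norm w)\<^sup>2"
proof -
  have b: "cmod (cnj (v $ i) * w $ i) \<le> (norm v)\<^sup>2 + (norm w)\<^sup>2" for i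
  proof -
    have "cmod (cnj (v $ i) * w $ i) \<le> norm v * norm w"
      by (simp add: norm_mult Finite_Cartesian_Product.norm_nth_le mult_mono)
    also have "\<dots> \<le> (norm v)\<^sup>2 + (norm w)\<^sup>2"
      using sum_squares_bound[of "norm v" "norm w"] mult_nonneg_nonneg[OF norm_ge_zero norm_ge_zero, of v w]
      unfolding mult.assoc by linarith
    finally show ?thesis .
  qed
  have "cmod (cdot v w) \<le> (\<Sum>i\<in>(UNIV::2 set). (norm v)\<^sup>2 + (norm w)\<^sup>2)"
    unfolding cdot_def by (rule order_trans[OF norm_sum sum_mono]) (rule b)
  then show ?thesis by simp
qed

lemma integrable_cdot:
  assumes "f \<in> sq_integrable" "g \<in> sq_integrable"
  shows "integrable lborel (\<lambda>x. cdot (f x) (g x))"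
proof (rule Bochner_Integration.integrable_bound)
  show "integrable lborel (\<lambda>x. 2 * (norm (f x))\<^sup>2 + 2 * (norm (g x))\<^sup>2)"
    using assms by (auto simp: sq_integrable_def)
  show "(\<lambda>x. cdot (f x) (g x)) \<in> borel_measurable lborel"
    using assms by (intro measurable_cdot) (auto simp: sq_integrable_def)
  show "AE x in lborel. norm (cdot (f x) (g x)) \<le> norm (2 * (norm (f x))\<^sup>2 + 2 * (norm (g x))\<^sup>2)"
    using norm_cdot_le by (auto intro!: AE_I2)
qed

lemma sq_integrable_add:
  assumes "f \<in> sq_integrable" "g \<in> sq_integrable"
  shows "(\<lambda>x. f x + g x) \<in> sq_integrable"
proof -
  have [measurable]: "f \<in> borel_measurable borel" "g \<in> borel_measurable borel"
    using assms by (auto simp: sq_integrable_def)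
  have "integrable lborel (\<lambda>x. (norm (f x + g x))\<^sup>2)"
  proof (rule Bochner_Integration.integrable_bound)
    show "integrable lborel (\<lambda>x. 2 * (norm (f x))\<^sup>2 + 2 * (norm (g x))\<^sup>2)"
      using assms by (auto simp: sq_integrable_def)
    have "(norm (f x + g x))\<^sup>2 \<le> 2 * (norm (f x))\<^sup>2 + 2 * (norm (g x))\<^sup>2" for x
    proof -
      have "(norm (f x + g x))\<^sup>2 \<le> (norm (f x) + norm (g x))\<^sup>2"
        by (intro power_mono norm_triangle_ineq) simp
      also have "\<dots> \<le> 2 * (norm (f x))\<^sup>2 + 2 * (norm (g x))\<^sup>2"
        using sum_squares_bound[of "norm (f x)" "norm (g x)"] by (simp add: power2_sum)
      finally show ?thesis .
    qed
    then show "AE x in lborel. norm ((norm (f x + g x))\<^sup>2)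
        \<le> norm (2 * (norm (f x))\<^sup>2 + 2 * (norm (g x))\<^sup>2)"
      by (auto intro!: AE_I2)
  qed measurable
  then show ?thesis
    by (auto simp: sq_integrable_def)
qed

lemma sq_integrable_smult:
  assumes "f \<in> sq_integrable"
  shows "(\<lambda>x. c *s f x) \<in> sq_integrable"
proof -
  have "(\<lambda>v. c *s v) \<in> borel_measurable (borel :: (complex ^ 2) measure)"
    unfolding vector_scalar_mult_def
    by (intro borel_measurable_continuous_onI continuous_intros)
  then have "(\<lambda>x. c *s f x) \<in> borel_measurable lborel"
    using assms by (auto simp: sq_integrable_def intro: measurable_compose)
  then show ?thesis
    using assms by (auto simp: sq_integrable_def norm_smult power_mult_distrib)
qed

lemma sq_integrable_zero: "(\<lambda>x. 0) \<in> sq_integrable"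
  by (simp add: sq_integrable_def)

quotient_type l2 = "real \<Rightarrow> complex ^ 2" / partial: ae_eq
proof (rule part_equivpI)
  show "\<exists>f. ae_eq f f"
    using sq_integrable_zero by (auto simp: ae_eq_def)
  show "symp ae_eq"
    by (auto simp: symp_def ae_eq_def elim!: AE_mp)
  show "transp ae_eq"
    unfolding transp_def ae_eq_def by (auto elim: eventually_elim2)
qed

lift_definition l2_add :: "l2 \<Rightarrow> l2 \<Rightarrow> l2" is "\<lambda>f g x. f x + g x"
  by (auto simp: ae_eq_def sq_integrable_add elim: eventually_elim2)

lift_definition scaleC :: "complex \<Rightarrow> l2 \<Rightarrow> l2" (infixr "*\<^sub>C" 75) is "\<lambda>c f x. c *s f x"
  by (auto simp: ae_eq_def sq_integrable_smult elim!: AE_mp intro!: AE_I2)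

lift_definition l2_zero :: l2 is "\<lambda>x. 0"
  by (simp add: ae_eq_def sq_integrable_zero)

text \<open>The complex inner product is antilinear in its first argument.\<close>

lift_definition cinner :: "l2 \<Rightarrow> l2 \<Rightarrow> complex" is "\<lambda>f g. LINT x|lborel. cdot (f x) (g x)"
proof -
  fix f f' g g' assume "ae_eq f f'" "ae_eq g g'"
  then have *: "f \<in> sq_integrable" "f' \<in> sq_integrable" "g \<in> sq_integrable" "g' \<in> sq_integrable"
    "AE x in lborel. f x = f' x" "AE x in lborel. g x = g' x"
    by (auto simp: ae_eq_def)
  have "AE x in lborel. cdot (f x) (g x) = cdot (f' x) (g' x)"
    using *(5,6) by eventually_elim simp
  then show "(LINT x|lborel. cdot (f x) (g x)) = (LINT x|lborel. cdot (f' x) (g' x))"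
    using integrable_cdot[OF *(1,3)] integrable_cdot[OF *(2,4)]
    by (intro integral_cong_AE) auto
qed

instantiation l2 :: real_inner
begin

definition "plus = l2_add"
definition "0 = l2_zero"
definition "uminus (\<phi> :: l2) = (-1) *\<^sub>C \<phi>"
definition "minus (\<phi> :: l2) \<psi> = \<phi> + (- \<psi>)"
definition "scaleR r (\<phi> :: l2) = complex_of_real r *\<^sub>C \<phi>"
definition "inner (\<phi> :: l2) \<psi> = Re (cinner \<phi> \<psi>)"
definition "norm (\<phi> :: l2) = sqrt (inner \<phi> \<phi>)"
definition "sgn (\<phi> :: l2) = inverse (norm \<phi>) *\<^sub>R \<phi>"
definition "dist (\<phi> :: l2) \<psi> = norm (\<phi> - \<psi>)"
definition "uniformity = (INF e\<in>{0<..}. principal {(\<phi> :: l2, \<psi>). dist \<phi> \<psi> < e})"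
definition "open (U :: l2 set) \<longleftrightarrow>
  (\<forall>\<phi>\<in>U. eventually (\<lambda>(\<phi>', \<psi>). \<phi>' = \<phi> \<longrightarrow> \<psi> \<in> U) uniformity)"

instance
proof
  note defs = plus_l2_def zero_l2_def uminus_l2_def minus_l2_def scaleR_l2_def
  fix \<phi> \<psi> \<eta> :: l2 and r s :: real
  show "\<phi> + \<psi> + \<eta> = \<phi> + (\<psi> + \<eta>)" unfolding defs
    by transfer (auto simp: ae_eq_def sq_integrable_add algebra_simps)
  show "\<phi> + \<psi> = \<psi> + \<phi>" unfolding defs
    by transfer (auto simp: ae_eq_def sq_integrable_add algebra_simps)
  show "0 + \<phi> = \<phi>" unfolding defs
    by transfer (auto simp: ae_eq_def)
  show "- \<phi> + \<phi> = 0" unfolding defs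
    by transfer (auto simp: ae_eq_def sq_integrable_add sq_integrable_smult sq_integrable_zero
        vec_eq_iff)
  show "\<phi> - \<psi> = \<phi> + - \<psi>" unfolding defs ..
  show "r *\<^sub>R (\<phi> + \<psi>) = r *\<^sub>R \<phi> + r *\<^sub>R \<psi>" unfolding defs
    by transfer (auto simp: ae_eq_def sq_integrable_add sq_integrable_smult vec_eq_iff algebra_simps)
  show "(r + s) *\<^sub>R \<phi> = r *\<^sub>R \<phi> + s *\<^sub>R \<phi>" unfolding defs
    by transfer (auto simp: ae_eq_def sq_integrable_add sq_integrable_smult vec_eq_iff algebra_simps)
  show "r *\<^sub>R s *\<^sub>R \<phi> = (r * s) *\<^sub>R \<phi>" unfolding defs
    by transfer (auto simp: ae_eq_def sq_integrable_smult vec_eq_iff algebra_simps)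
  show "1 *\<^sub>R \<phi> = \<phi>" unfolding defs
    by transfer (auto simp: ae_eq_def sq_integrable_smult vec_eq_iff)
  show "sgn \<phi> = inverse (norm \<phi>) *\<^sub>R \<phi>" by (rule sgn_l2_def)
  show "dist \<phi> \<psi> = norm (\<phi> - \<psi>)" by (rule dist_l2_def)
  show "uniformity = (INF e\<in>{0<..}. principal {(\<phi> :: l2, \<psi>). dist \<phi> \<psi> < e})"
    by (rule uniformity_l2_def)
  show "open U \<longleftrightarrow> (\<forall>\<phi>\<in>U. \<forall>\<^sub>F (\<phi>', \<psi>) in uniformity. \<phi>' = \<phi> \<longrightarrow> \<psi> \<in> U)" for U :: "l2 set"
    by (rule open_l2_def)
  show "norm \<phi> = sqrt (inner \<phi> \<phi>)" by (rule norm_l2_def)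
  show "inner \<phi> \<psi> = inner \<psi> \<phi>" unfolding inner_l2_def
    by transfer
      (auto simp: ae_eq_def integrable_cdot Re_cdot inner_commute simp flip: integral_Re)
  show "inner (\<phi> + \<psi>) \<eta> = inner \<phi> \<eta> + inner \<psi> \<eta>" unfolding inner_l2_def defs
  proof transfer
    fix f g h assume "ae_eq f f" "ae_eq g g" "ae_eq h h"
    then have *: "f \<in> sq_integrable" "g \<in> sq_integrable" "h \<in> sq_integrable"
      by (auto simp: ae_eq_def)
    have "(LINT x|lborel. cdot (f x + g x) (h x)) =
        (LINT x|lborel. cdot (f x) (h x) + cdot (g x) (h x))"
      by (simp add: cdot_def algebra_simps sum.distrib)
    also have "\<dots> = (LINT x|lborel. cdot (f x) (h x)) + (LINT x|lborel. cdot (g x) (h x))"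
      using * by (intro Bochner_Integration.integral_add integrable_cdot)
    finally show "Re (LINT x|lborel. cdot (f x + g x) (h x)) =
        Re (LINT x|lborel. cdot (f x) (h x)) + Re (LINT x|lborel. cdot (g x) (h x))"
      by simp
  qed
  show "inner (r *\<^sub>R \<phi>) \<psi> = r * inner \<phi> \<psi>" unfolding inner_l2_def defs
  proof transfer
    fix f g and r :: real
    have "(LINT x|lborel. cdot (complex_of_real r *s f x) (g x)) =
        (LINT x|lborel. complex_of_real r * cdot (f x) (g x))"
      by (simp add: cdot_def sum_distrib_left algebra_simps)
    then show "Re (LINT x|lborel. cdot (complex_of_real r *s f x) (g x)) =
        r * Re (LINT x|lborel. cdot (f x) (g x))"
      by simp
  qed
  have sq: "Re (LINT x|lborel. cdot (f x) (f x)) = (LINT x|lborel. (norm (f x))\<^sup>2)"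
    if "ae_eq f f" for f
    using that
    by (auto simp: ae_eq_def integrable_cdot Re_cdot power2_norm_eq_inner simp flip: integral_Re)
  show "0 \<le> inner \<phi> \<phi>" unfolding inner_l2_def
    by transfer (simp add: sq)
  show "inner \<phi> \<phi> = 0 \<longleftrightarrow> \<phi> = 0" unfolding inner_l2_def defs
  proof transfer
    fix f assume f: "ae_eq f f"
    then have i: "integrable lborel (\<lambda>x. (norm (f x))\<^sup>2)"
      by (auto simp: ae_eq_def sq_integrable_def)
    show "Re (LINT x|lborel. cdot (f x) (f x)) = 0 \<longleftrightarrow> ae_eq f (\<lambda>x. 0)"
      unfolding sq[OF f] integral_nonneg_eq_0_iff_AE[OF i, simplified]
      using f by (auto simp: ae_eq_def sq_integrable_zero)
  qed
qed

end


section \<open>Spectral measures and functional calculus\<close>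

text \<open>
  An unbounded operator is represented by its graph, a subset of \<open>l2 \<times> l2\<close>; the graph of the closure
  of a closable operator is then the topological closure of its graph.
\<close>

definition is_proj_measure :: "(real set \<Rightarrow> l2 \<Rightarrow> l2) \<Rightarrow> bool" where
  "is_proj_measure E \<longleftrightarrow>
    (\<forall>B\<in>sets borel.
      (\<forall>\<phi> \<psi>. E B (\<phi> + \<psi>) = E B \<phi> + E B \<psi>) \<and>
      (\<forall>c \<phi>. E B (c *\<^sub>C \<phi>) = c *\<^sub>C E B \<phi>) \<and>
      (\<forall>\<phi>. E B (E B \<phi>) = E B \<phi>) \<and>
      (\<forall>\<phi> \<psi>. cinner (E B \<phi>) \<psi> = cinner \<phi> (E B \<psi>))) \<and>
    (\<forall>\<phi>. E UNIV \<phi> = \<phi>) \<and>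
    (\<forall>B :: nat \<Rightarrow> real set. range B \<subseteq> sets borel \<longrightarrow> disjoint_family B \<longrightarrow>
      (\<forall>\<phi>. (\<lambda>n. E (B n) \<phi>) sums E (\<Union>n. B n) \<phi>))"

definition vec_measure :: "(real set \<Rightarrow> l2 \<Rightarrow> l2) \<Rightarrow> l2 \<Rightarrow> real measure" where
  "vec_measure E \<psi> = measure_of UNIV (sets borel) (\<lambda>B. ennreal ((norm (E B \<psi>))\<^sup>2))"

definition simple_spectral_integral ::
    "(real set \<Rightarrow> l2 \<Rightarrow> l2) \<Rightarrow> (real \<Rightarrow> complex) \<Rightarrow> l2 \<Rightarrow> l2" where
  "simple_spectral_integral E s \<psi> = (\<Sum>c\<in>range s. c *\<^sub>C E (s -` {c}) \<psi>)"

text \<open>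
  \<open>has_spectral_integral E f \<psi> \<phi>\<close> means that \<open>\<psi>\<close> lies in the domain of \<open>\<integral>f dE\<close> and is mapped to \<open>\<phi>\<close>:
  the integral is the continuous extension of the isometry \<open>s \<mapsto> (\<integral>s dE) \<psi>\<close> from simple functions
  to \<open>L\<^sup>2(vec_measure E \<psi>)\<close>.  In particular, such a \<open>\<phi>\<close> exists only if \<open>f\<close> is square integrable with
  respect to \<open>vec_measure E \<psi>\<close>.
\<close>

definition has_spectral_integral ::
    "(real set \<Rightarrow> l2 \<Rightarrow> l2) \<Rightarrow> (real \<Rightarrow> complex) \<Rightarrow> l2 \<Rightarrow> l2 \<Rightarrow> bool" where
  "has_spectral_integral E f \<psi> \<phi> \<longleftrightarrow>
    f \<in> borel_measurable borel \<and>
    (\<exists>s. (\<forall>n. simple_function borel (s n)) \<and>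
      ((\<lambda>n. \<integral>\<^sup>+x. ennreal ((cmod (s n x - f x))\<^sup>2) \<partial>vec_measure E \<psi>) \<longlonglongrightarrow> 0) \<and>
      ((\<lambda>n. simple_spectral_integral E (s n) \<psi>) \<longlonglongrightarrow> \<phi>))"

definition is_spectral_measure_of :: "(real set \<Rightarrow> l2 \<Rightarrow> l2) \<Rightarrow> (l2 \<times> l2) set \<Rightarrow> bool" where
  "is_spectral_measure_of E A \<longleftrightarrow>
    is_proj_measure E \<and> A = {(\<psi>, \<phi>). has_spectral_integral E complex_of_real \<psi> \<phi>}"

text \<open>
  By the spectral theorem every self-adjoint \<open>A\<close> has a spectral measure, which is unique on Borel
  sets; the choice below only concerns its irrelevant values on non-Borel sets.
\<close>

definition spectral_measure :: "(l2 \<times> l2) set \<Rightarrow> real set \<Rightarrow> l2 \<Rightarrow> l2" where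
  "spectral_measure A = (SOME E. is_spectral_measure_of E A)"

definition fun_calc :: "(real \<Rightarrow> complex) \<Rightarrow> (l2 \<times> l2) set \<Rightarrow> l2 \<Rightarrow> l2" where
  "fun_calc f A \<psi> = (THE \<phi>. has_spectral_integral (spectral_measure A) f \<psi> \<phi>)"

text \<open>The unitary operator \<open>e\<^sup>i\<^sup>t\<^sup>A\<close>.\<close>

definition exp_i :: "real \<Rightarrow> (l2 \<times> l2) set \<Rightarrow> l2 \<Rightarrow> l2" where
  "exp_i t A = fun_calc (\<lambda>x. exp (\<i> * complex_of_real (t * x))) A"


section \<open>Operators on Schwartz space\<close>

definition vderiv :: "(real \<Rightarrow> complex) \<Rightarrow> real \<Rightarrow> complex" where
  "vderiv f = (\<lambda>x. vector_derivative f (at x))"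

definition schwartz :: "(real \<Rightarrow> complex) set" where
  "schwartz = {f. \<forall>n. (\<forall>x. (vderiv ^^ n) f differentiable (at x)) \<and>
    (\<forall>k. bounded (range (\<lambda>x. complex_of_real x ^ k * (vderiv ^^ n) f x)))}"

text \<open>
  The algebraic tensor product of \<open>\<complex>\<^sup>2\<close> with Schwartz space consists of the spinors both of whose
  components are Schwartz functions.
\<close>

definition schwartz2 :: "(real \<Rightarrow> complex ^ 2) set" where
  "schwartz2 = {\<Psi>. \<forall>i. (\<lambda>x. \<Psi> x $ i) \<in> schwartz}"

definition tensor_op :: "complex ^ 2 ^ 2 \<Rightarrow> ((real \<Rightarrow> complex) \<Rightarrow> real \<Rightarrow> complex) \<Rightarrow>
    (real \<Rightarrow> complex ^ 2) \<Rightarrow> real \<Rightarrow> complex ^ 2" (infixr "\<otimes>\<^sub>o" 70) where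
  "(\<sigma> \<otimes>\<^sub>o T) \<Psi> = (\<lambda>x. \<sigma> *v (\<chi> j. T (\<lambda>y. \<Psi> y $ j) x))"

definition sigma_x :: "complex ^ 2 ^ 2" where
  "sigma_x = vector [vector [0, 1], vector [1, 0]]"
definition sigma_z :: "complex ^ 2 ^ 2" where
  "sigma_z = vector [vector [1, 0], vector [0, -1]]"
definition sigma_plus :: "complex ^ 2 ^ 2" where
  "sigma_plus = vector [vector [0, 1], vector [0, 0]]"
definition sigma_minus :: "complex ^ 2 ^ 2" where
  "sigma_minus = vector [vector [0, 0], vector [1, 0]]"

definition annih :: "(real \<Rightarrow> complex) \<Rightarrow> real \<Rightarrow> complex" where
  "annih f = (\<lambda>x. (1 / sqrt 2) *\<^sub>R (complex_of_real x * f x + vderiv f x))"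

definition creat :: "(real \<Rightarrow> complex) \<Rightarrow> real \<Rightarrow> complex" where
  "creat f = (\<lambda>x. (1 / sqrt 2) *\<^sub>R (complex_of_real x * f x - vderiv f x))"

definition rabi_op :: "real \<Rightarrow> real \<Rightarrow> real \<Rightarrow> (real \<Rightarrow> complex ^ 2) \<Rightarrow> real \<Rightarrow> complex ^ 2" where
  "rabi_op lam Om om \<Psi> = (\<lambda>x.
    (Om / 2) *\<^sub>R (sigma_z \<otimes>\<^sub>o id) \<Psi> x + om *\<^sub>R (mat 1 \<otimes>\<^sub>o (creat \<circ> annih)) \<Psi> x
    + lam *\<^sub>R (sigma_x \<otimes>\<^sub>o (\<lambda>f y. annih f y + creat f y)) \<Psi> x)"

definition rwa_op :: "real \<Rightarrow> real \<Rightarrow> real \<Rightarrow> (real \<Rightarrow> complex ^ 2) \<Rightarrow> real \<Rightarrow> complex ^ 2" where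
  "rwa_op lam Om om \<Psi> = (\<lambda>x.
    (Om / 2) *\<^sub>R (sigma_z \<otimes>\<^sub>o id) \<Psi> x + om *\<^sub>R (mat 1 \<otimes>\<^sub>o (creat \<circ> annih)) \<Psi> x
    + lam *\<^sub>R ((sigma_plus \<otimes>\<^sub>o annih) \<Psi> x + (sigma_minus \<otimes>\<^sub>o creat) \<Psi> x))"

definition free_op :: "real \<Rightarrow> (real \<Rightarrow> complex ^ 2) \<Rightarrow> real \<Rightarrow> complex ^ 2" where
  "free_op om \<Psi> = (\<lambda>x.
    (om / 2) *\<^sub>R (sigma_z \<otimes>\<^sub>o id) \<Psi> x + om *\<^sub>R (mat 1 \<otimes>\<^sub>o (creat \<circ> annih)) \<Psi> x)"

text \<open>
  \<open>abs_l2\<close> maps a square integrable function (in particular any element of \<open>schwartz2\<close>) to its class.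
\<close>

definition op_closure :: "((real \<Rightarrow> complex ^ 2) \<Rightarrow> real \<Rightarrow> complex ^ 2) \<Rightarrow> (l2 \<times> l2) set" where
  "op_closure T = closure {(abs_l2 \<Psi>, abs_l2 (T \<Psi>)) | \<Psi>. \<Psi> \<in> schwartz2}"

definition H_rabi :: "real \<Rightarrow> real \<Rightarrow> real \<Rightarrow> (l2 \<times> l2) set" where
  "H_rabi lam Om om = op_closure (rabi_op lam Om om)"

definition H_RWA :: "real \<Rightarrow> real \<Rightarrow> real \<Rightarrow> (l2 \<times> l2) set" where
  "H_RWA lam Om om = op_closure (rwa_op lam Om om)"

definition H_free :: "real \<Rightarrow> (l2 \<times> l2) set" where
  "H_free om = op_closure (free_op om)"

definition num_op :: "(l2 \<times> l2) set" where
  "num_op = op_closure (mat 1 \<otimes>\<^sub>o (creat \<circ> annih))"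

definition U1 :: "real \<Rightarrow> real \<Rightarrow> real \<Rightarrow> real \<Rightarrow> l2 \<Rightarrow> l2" where
  "U1 lam Om om t = exp_i t (H_free om) \<circ> exp_i (- t) (H_rabi lam Om om)"

definition U2 :: "real \<Rightarrow> real \<Rightarrow> real \<Rightarrow> real \<Rightarrow> l2 \<Rightarrow> l2" where
  "U2 lam Om om t = exp_i t (H_free om) \<circ> exp_i (- t) (H_RWA lam Om om)"

end

theory Submission
  imports Defs "HOL-Probability.Probability" "HOL-Real_Asymp.Real_Asymp"
begin

text \<open>
  In the interaction picture the two Hamiltonians differ by a term that oscillates with frequency
  \<open>2\<omega>\<close>. Integrating it by parts, \<open>U\<^sub>2 - U\<^sub>1\<close> becomes a boundary term \<open>i S(t) U\<^sub>2(t)\<close> of size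
  \<open>\<lambda>/\<omega> sin(\<omega>t)\<close> plus an integral of \<open>H\<^sub>1(s) S(s) - S(s) H\<^sub>2\<close>. Since the rotating-wave dynamics
  preserves the total excitation number, both can be estimated by moments of the initial state: the
  boundary term is bounded below by \<open>(N - 1)\<^sub>+\<^sup>1\<^sup>/\<^sup>2\<close>, the integrand above by the two other moments.

  The functional calculus is made concrete by eigenbases. For the number operator, the free and the
  rotating-wave Hamiltonian these come from the Hermite functions. The full Hamiltonian has no
  explicit one, but its interaction is small relative to the free part, so it has a compact resolvent.
\<close>

section \<open>The complex inner product\<close>

text \<open>\<open>spectral_measure\<close> and \<open>fun_calc\<close> are choices
  (\<open>SOME\<close>, \<open>THE\<close>) and say nothing until a spectral measure of the closed
  graph is exhibited. An eigenbasis supplies one, and its vectors then pin down every other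
  candidate on Borel sets. It also decides how the evolutions are differentiated: e^(isH) is seen
  only through the scalars exp(i s l) <e, .> for eigenvectors e of the full Hamiltonian. The
  eigenvalue equation moves H onto the explicit vectors \<open>bvec k\<close>, so e^(-isH) Psi never
  has to lie in a domain. The constants: the primitive, vanishing at 0, of a phase of frequency 2
  omega has modulus sin(omega s)/omega on [0, pi/omega]; integrating this sine gives (1 - cos(omega
  t))/omega^2. In the integrand the detuning yields |Delta|, and the three ways to combine a
  counter-rotating hop with a further coupling yield 3 lambda. The rotating-wave flow mixes the two
  spins of excitation sector m, where N is m - 1 or m. Only their joint weight is conserved, so each
  estimate takes the worse spin; hence the shifts in (N - 1)_+, N + 2 and N + 3.\<close>

lemma scaleC_add_right: "c *\<^sub>C (x + y) = c *\<^sub>C x + c *\<^sub>C y"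
  unfolding plus_l2_def
  by transfer (auto simp: ae_eq_def sq_integrable_add sq_integrable_smult vec_eq_iff algebra_simps)

lemma scaleC_add_left: "(c + d) *\<^sub>C x = c *\<^sub>C x + d *\<^sub>C x"
  unfolding plus_l2_def
  by transfer (auto simp: ae_eq_def sq_integrable_add sq_integrable_smult vec_eq_iff algebra_simps)

lemma scaleC_scaleC [simp]: "c *\<^sub>C d *\<^sub>C x = (c * d) *\<^sub>C x"
  by transfer (auto simp: ae_eq_def sq_integrable_smult vec_eq_iff)

lemma scaleC_one [simp]: "1 *\<^sub>C x = x"
  by transfer (auto simp: ae_eq_def sq_integrable_smult vec_eq_iff)

lemma scaleR_scaleC: "r *\<^sub>R (x::l2) = complex_of_real r *\<^sub>C x"
  by (rule scaleR_l2_def)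

lemma scaleC_zero_left [simp]: "0 *\<^sub>C x = 0"
  using scaleR_scaleC[of 0 x] by simp

lemma scaleC_minus_left: "(- c) *\<^sub>C x = - (c *\<^sub>C x)"
  by (metis scaleC_add_left add.right_inverse scaleC_zero_left minus_unique)

lemma scaleC_zero_right [simp]: "c *\<^sub>C 0 = 0"
  by (metis scaleC_add_right add_cancel_right_right)

lemma scaleC_diff_right: "c *\<^sub>C (x - y) = c *\<^sub>C x - c *\<^sub>C y"
  by (metis scaleC_add_right add_diff_cancel diff_add_cancel)

lemma scaleC_diff_left: "(c - d) *\<^sub>C x = c *\<^sub>C x - d *\<^sub>C x"
  by (metis scaleC_add_left add_diff_cancel diff_add_cancel)

lemma scaleC_sum_right: "c *\<^sub>C sum f A = (\<Sum>a\<in>A. c *\<^sub>C f a)"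
  by (induction A rule: infinite_finite_induct) (auto simp: scaleC_add_right)

lemma cinner_add_right: "cinner x (y + z) = cinner x y + cinner x z"
  unfolding plus_l2_def
proof transfer
  fix f g h assume "ae_eq f f" "ae_eq g g" "ae_eq h h"
  then have *: "f \<in> sq_integrable" "g \<in> sq_integrable" "h \<in> sq_integrable"
    by (auto simp: ae_eq_def)
  have "(LINT x|lborel. cdot (f x) (g x + h x)) = (LINT x|lborel. cdot (f x) (g x) + cdot (f x) (h x))"
    by (simp add: cdot_def algebra_simps sum.distrib)
  also have "\<dots> = (LINT x|lborel. cdot (f x) (g x)) + (LINT x|lborel. cdot (f x) (h x))"
    using * by (intro Bochner_Integration.integral_add integrable_cdot)
  finally show "(LINT x|lborel. cdot (f x) (g x + h x))
      = (LINT x|lborel. cdot (f x) (g x)) + (LINT x|lborel. cdot (f x) (h x))" .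
qed

lemma cinner_scaleC_right [simp]: "cinner x (c *\<^sub>C y) = c * cinner x y"
proof transfer
  fix f g and c :: complex
  have "(LINT x|lborel. cdot (f x) (c *s g x)) = (LINT x|lborel. c * cdot (f x) (g x))"
    by (simp add: cdot_def sum_distrib_left algebra_simps)
  then show "(LINT x|lborel. cdot (f x) (c *s g x)) = c * (LINT x|lborel. cdot (f x) (g x))"
    by simp
qed

lemma cinner_commute: "cinner x y = cnj (cinner y x)"
proof transfer
  fix f g
  have "cnj (LINT x|lborel. cdot (g x) (f x)) = (LINT x|lborel. cnj (cdot (g x) (f x)))"
    by simp
  then show "(LINT x|lborel. cdot (f x) (g x)) = cnj (LINT x|lborel. cdot (g x) (f x))"
    by (simp add: cdot_def algebra_simps)
qed

lemma cinner_scaleC_left [simp]: "cinner (c *\<^sub>C x) y = cnj c * cinner x y"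
  by (subst (1 2) cinner_commute) simp

lemma cinner_add_left: "cinner (x + y) z = cinner x z + cinner y z"
  by (subst (1 2 3) cinner_commute) (simp add: cinner_add_right)

lemma cinner_zero_right [simp]: "cinner x 0 = 0"
  by (metis cinner_scaleC_right scaleC_zero_right mult_zero_left scaleC_zero_left)

lemma cinner_zero_left [simp]: "cinner 0 x = 0"
  by (subst cinner_commute) simp

lemma cinner_diff_right: "cinner x (y - z) = cinner x y - cinner x z"
  by (metis cinner_add_right add_diff_cancel diff_add_cancel)

lemma cinner_diff_left: "cinner (x - y) z = cinner x z - cinner y z"
  by (metis cinner_add_left add_diff_cancel diff_add_cancel)

lemma cinner_sum_right: "cinner x (sum f A) = (\<Sum>a\<in>A. cinner x (f a))"
  by (induction A rule: infinite_finite_induct) (auto simp: cinner_add_right)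

lemma cinner_sum_left: "cinner (sum f A) x = (\<Sum>a\<in>A. cinner (f a) x)"
  by (induction A rule: infinite_finite_induct) (auto simp: cinner_add_left)

lemma Re_cinner: "Re (cinner x y) = inner x y"
  by (simp add: inner_l2_def)

lemma cinner_self: "cinner x x = complex_of_real ((norm x)\<^sup>2)"
proof -
  have "Im (cinner x x) = 0"
    using arg_cong[OF cinner_commute[of x x], of Im] by simp
  then show ?thesis
    by (simp add: complex_eq_iff Re_cinner power2_norm_eq_inner)
qed

lemma norm_scaleC [simp]: "norm (c *\<^sub>C x) = cmod c * norm x"
proof -
  have "complex_of_real ((norm (c *\<^sub>C x))\<^sup>2) = (c * cnj c) * complex_of_real ((norm x)\<^sup>2)"
    unfolding cinner_self[symmetric] by simp
  also have "\<dots> = complex_of_real ((cmod c * norm x)\<^sup>2)"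
    by (simp only: complex_norm_square[symmetric] power_mult_distrib of_real_mult)
  finally have "(norm (c *\<^sub>C x))\<^sup>2 = (cmod c * norm x)\<^sup>2"
    by (simp only: of_real_eq_iff)
  then show ?thesis
    by (simp add: power2_eq_iff_nonneg)
qed

text \<open>Multiplying \<open>x\<close> by its own inner product with \<open>y\<close> makes the
  pairing real and non-negative, which reduces the claim to the real Cauchy-Schwarz
  inequality.\<close>

lemma cinner_Cauchy_Schwarz: "cmod (cinner x y) \<le> norm x * norm y"
proof -
  let ?z = "cinner x y"
  have "(cmod ?z)\<^sup>2 = Re (cinner (?z *\<^sub>C x) y)"
    by (metis Re_complex_of_real cinner_scaleC_left complex_norm_square mult.commute)
  also have "\<dots> \<le> norm (?z *\<^sub>C x) * norm y"
    unfolding Re_cinner by (rule norm_cauchy_schwarz)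
  finally have "cmod ?z * cmod ?z \<le> cmod ?z * (norm x * norm y)"
    by (simp add: power2_eq_square mult.assoc)
  then show ?thesis
    by (cases "?z = 0") auto
qed

lemma bounded_linear_cinner_right: "bounded_linear (cinner x)"
proof (rule bounded_linear_intro)
  show "norm (cinner x y) \<le> norm y * norm x" for y
    using cinner_Cauchy_Schwarz[of x y] by (simp add: mult.commute)
qed (auto simp: cinner_add_right scaleR_scaleC scaleR_conv_of_real)

lemma bounded_linear_scaleC_right: "bounded_linear (\<lambda>x. c *\<^sub>C x)"
  by (rule bounded_linear_intro[where K = "cmod c"])
    (auto simp: scaleC_add_right scaleR_scaleC mult.commute)

lemma tendsto_cinner [tendsto_intros]:
  assumes "(f \<longlongrightarrow> x) F" "(g \<longlongrightarrow> y) F"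
  shows "((\<lambda>n. cinner (f n) (g n)) \<longlongrightarrow> cinner x y) F"
proof -
  \<comment> \<open>Antilinearity in the first argument turns the imaginary part into a real inner
    product, so convergence is inherited from \<open>inner\<close>.\<close>
  have "cinner a b = Complex (inner a b) (inner (\<i> *\<^sub>C a) b)" for a b
    by (simp add: complex_eq_iff flip: Re_cinner)
  moreover have "((\<lambda>n. Complex (inner (f n) (g n)) (inner (\<i> *\<^sub>C f n) (g n)))
      \<longlongrightarrow> Complex (inner x y) (inner (\<i> *\<^sub>C x) y)) F"
    by (intro tendsto_Complex tendsto_inner assms bounded_linear.tendsto[OF bounded_linear_scaleC_right])
  ultimately show ?thesis by simp
qed

lemma tendsto_scaleC_right [tendsto_intros]:
  "(f \<longlongrightarrow> x) F \<Longrightarrow> ((\<lambda>n. c *\<^sub>C f n) \<longlongrightarrow> c *\<^sub>C x) F"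
  by (rule bounded_linear.tendsto[OF bounded_linear_scaleC_right])

lemma continuous_on_cinner [continuous_intros]:
  "continuous_on S f \<Longrightarrow> continuous_on S g \<Longrightarrow> continuous_on S (\<lambda>x. cinner (f x) (g x))"
  unfolding continuous_on_def by (auto intro: tendsto_cinner)

lemma continuous_on_scaleC_right [continuous_intros]:
  "continuous_on S f \<Longrightarrow> continuous_on S (\<lambda>x. c *\<^sub>C f x)"
  unfolding continuous_on_def by (auto intro: tendsto_scaleC_right)

lemma norm_sum_orthogonal:
  fixes f :: "'k \<Rightarrow> l2"
  assumes "\<And>j k. j \<in> K \<Longrightarrow> k \<in> K \<Longrightarrow> j \<noteq> k \<Longrightarrow> cinner (f j) (f k) = 0"
  shows "(norm (\<Sum>k\<in>K. f k))\<^sup>2 = (\<Sum>k\<in>K. (norm (f k))\<^sup>2)"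
proof (cases "finite K")
  case True
  have "inner (f j) (f k) = 0" if "j \<in> K" "k \<in> K" "j \<noteq> k" for j k
    using assms[OF that] by (simp add: Re_cinner[symmetric])
  then have "(\<Sum>k\<in>K. inner (f j) (f k)) = inner (f j) (f j)" if "j \<in> K" for j
    using True that by (subst sum.remove[of _ j]) (auto intro!: sum.neutral)
  then show ?thesis
    unfolding power2_norm_eq_inner inner_sum_left by (simp add: inner_sum_right)
qed simp

section \<open>Completeness\<close>

lemma abs_l2_add: "f \<in> sq_integrable \<Longrightarrow> g \<in> sq_integrable \<Longrightarrow>
    abs_l2 f + abs_l2 g = abs_l2 (\<lambda>x. f x + g x)"
  by (simp add: plus_l2_def l2_add.abs_eq ae_eq_def)

lemma abs_l2_scaleC: "f \<in> sq_integrable \<Longrightarrow> c *\<^sub>C abs_l2 f = abs_l2 (\<lambda>x. c *s f x)"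
  by (simp add: scaleC.abs_eq ae_eq_def)

lemma sq_integrable_minus: "f \<in> sq_integrable \<Longrightarrow> (\<lambda>x. - f x) \<in> sq_integrable"
  by (auto simp: sq_integrable_def)

lemma sq_integrable_diff:
  "f \<in> sq_integrable \<Longrightarrow> g \<in> sq_integrable \<Longrightarrow> (\<lambda>x. f x - g x) \<in> sq_integrable"
  using sq_integrable_add[OF _ sq_integrable_minus, of f g] by simp

lemma abs_l2_diff: "f \<in> sq_integrable \<Longrightarrow> g \<in> sq_integrable \<Longrightarrow>
    abs_l2 f - abs_l2 g = abs_l2 (\<lambda>x. f x - g x)"
  using abs_l2_add[of f "\<lambda>x. -1 *s g x"] abs_l2_scaleC[of g "-1"] sq_integrable_smult[of g "-1"]
  by (simp add: minus_l2_def uminus_l2_def vec_eq_iff)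

lemma cinner_abs_l2: "f \<in> sq_integrable \<Longrightarrow> g \<in> sq_integrable \<Longrightarrow>
    cinner (abs_l2 f) (abs_l2 g) = (LINT x|lborel. cdot (f x) (g x))"
  by (simp add: cinner.abs_eq ae_eq_def)

lemma l2_representative: obtains f where "f \<in> sq_integrable" "x = abs_l2 f"
  by (metis Quotient_abs_rep[OF Quotient_l2] Quotient_rep_reflp[OF Quotient_l2] ae_eq_def)

lemma nn_integral_norm_abs_l2:
  assumes "f \<in> sq_integrable"
  shows "(\<integral>\<^sup>+x. ennreal ((norm (f x))\<^sup>2) \<partial>lborel) = ennreal ((norm (abs_l2 f))\<^sup>2)"
proof -
  have "(norm (abs_l2 f))\<^sup>2 = Re (LINT x|lborel. cdot (f x) (f x))"
    by (simp add: power2_norm_eq_inner cinner_abs_l2 assms flip: Re_cinner)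
  also have "\<dots> = (LINT x|lborel. (norm (f x))\<^sup>2)"
    using assms by (auto simp: integrable_cdot Re_cdot power2_norm_eq_inner simp flip: integral_Re)
  finally show ?thesis
    using assms by (simp add: nn_integral_eq_integral sq_integrable_def)
qed

text \<open>Riesz--Fischer: the subsequence is chosen so that its increments, weighted by \<open>4\<^sup>k\<close>, are still
  square summable in mean; Fatou's lemma then identifies the almost everywhere limit.\<close>

lemma l2_Cauchy_convergent:
  fixes X :: "nat \<Rightarrow> l2"
  assumes "Cauchy X"
  shows "convergent X"
proof -
  have "\<forall>n. \<exists>f. f \<in> sq_integrable \<and> X n = abs_l2 f"
    by (metis l2_representative)
  then obtain f where f: "\<And>n. f n \<in> sq_integrable" and X: "\<And>n. X n = abs_l2 (f n)"
    by metis
  have [measurable]: "f n \<in> borel_measurable lborel" for n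
    using f[of n] by (simp add: sq_integrable_def)
  have dist_eq: "(\<integral>\<^sup>+x. ennreal ((norm (f m x - f n x))\<^sup>2) \<partial>lborel) = ennreal ((norm (X m - X n))\<^sup>2)" for m n
    using nn_integral_norm_abs_l2[OF sq_integrable_diff[OF f f, of m n]] by (simp add: X abs_l2_diff f)
  have "\<forall>k. \<exists>M. \<forall>m\<ge>M. \<forall>n\<ge>M. dist (X m) (X n) < (1/4)^k"
    using assms unfolding Cauchy_def by (metis divide_pos_pos zero_less_numeral zero_less_one zero_less_power)
  then obtain M where M: "\<And>k m n. m \<ge> M k \<Longrightarrow> n \<ge> M k \<Longrightarrow> dist (X m) (X n) < (1/4)^k"
    by metis
  \<comment> \<open>The partial sums of \<open>M\<close> dominate \<open>M k\<close> for all k \<le>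
    l, so one index sequence serves every scale (1/4)^k.\<close>
  define r where "r k = (\<Sum>i\<le>k. M i)" for k
  have r: "r l \<ge> M k" if "l \<ge> k" for k l
    unfolding r_def using that by (intro member_le_sum) auto
  define d where "d k x = f (r (Suc k)) x - f (r k) x" for k x
  have [measurable]: "d k \<in> borel_measurable lborel" for k
    unfolding d_def by measurable
  have dk: "(\<integral>\<^sup>+x. ennreal (4 ^ k * (norm (d k x))\<^sup>2) \<partial>lborel) \<le> ennreal ((1/4)^k)" for k
  proof -
    have "(\<integral>\<^sup>+x. ennreal (4 ^ k * (norm (d k x))\<^sup>2) \<partial>lborel)
        = ennreal (4 ^ k) * (\<integral>\<^sup>+x. ennreal ((norm (d k x))\<^sup>2) \<partial>lborel)"
      by (simp add: ennreal_mult' nn_integral_cmult)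
    also have "\<dots> = ennreal (4 ^ k * (norm (X (r (Suc k)) - X (r k)))\<^sup>2)"
      by (simp add: d_def dist_eq ennreal_mult')
    also have "\<dots> \<le> ennreal (4 ^ k * ((1/4)^k)\<^sup>2)"
      using M[OF r r, of k "Suc k" k]
      by (intro ennreal_leI mult_left_mono power_mono) (auto simp: dist_norm)
    also have "4 ^ k * ((1/4)^k)\<^sup>2 = ((1/4)^k :: real)"
      by (simp add: power2_eq_square power_divide)
    finally show ?thesis .
  qed
  have "(\<integral>\<^sup>+x. (\<Sum>k. ennreal (4 ^ k * (norm (d k x))\<^sup>2)) \<partial>lborel)
      = (\<Sum>k. (\<integral>\<^sup>+x. ennreal (4 ^ k * (norm (d k x))\<^sup>2) \<partial>lborel))"
    by (intro nn_integral_suminf) measurable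
  also have "\<dots> \<le> (\<Sum>k. ennreal ((1/4)^k))"
    by (intro suminf_le dk) auto
  also have "\<dots> < \<infinity>"
    by (subst suminf_ennreal2) (auto simp: summable_geometric)
  finally have "AE x in lborel. (\<Sum>k. ennreal (4 ^ k * (norm (d k x))\<^sup>2)) \<noteq> \<infinity>"
    by (intro nn_integral_PInf_AE) auto
  then have conv: "AE x in lborel. convergent (\<lambda>k. f (r k) x)"
  proof eventually_elim
    case (elim x)
    have le: "ennreal (4 ^ k * (norm (d k x))\<^sup>2) \<le> (\<Sum>k. ennreal (4 ^ k * (norm (d k x))\<^sup>2))" for k
      using sum_le_suminf[OF summableI, of "{k}"] by auto
    define C where "C = enn2real (\<Sum>k. ennreal (4 ^ k * (norm (d k x))\<^sup>2))"
    have "(\<Sum>k. ennreal (4 ^ k * (norm (d k x))\<^sup>2)) < top"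
      using elim by (simp add: less_top)
    then have C: "(\<Sum>k. ennreal (4 ^ k * (norm (d k x))\<^sup>2)) = ennreal C" "C \<ge> 0"
      unfolding C_def by (simp_all only: ennreal_enn2real enn2real_nonneg)
    have "norm (d k x) \<le> sqrt C * (1/2)^k" for k
    proof -
      have "4 ^ k * (norm (d k x))\<^sup>2 \<le> C"
        using le[of k] C by simp
      moreover have "4 ^ k * (norm (d k x))\<^sup>2 = (2 ^ k * norm (d k x))\<^sup>2"
        by (simp add: power_mult_distrib) (simp add: power2_eq_square flip: power_mult_distrib)
      ultimately have "2 ^ k * norm (d k x) \<le> sqrt C"
        by (simp add: real_le_rsqrt)
      then show ?thesis
        by (simp add: power_divide field_simps)
    qed
    then have "summable (\<lambda>k. d k x)"
      using summable_comparison_test'[of "\<lambda>k. sqrt C * (1/2)^k" 0 "\<lambda>k. d k x"]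
      by (simp add: summable_mult summable_geometric)
    then have "convergent (\<lambda>k. \<Sum>i<k. d i x)"
      by (simp add: summable_iff_convergent)
    then have "convergent (\<lambda>k. (\<Sum>i<k. d i x) + f (r 0) x)"
      by (intro convergent_add convergent_const)
    then show ?case
      by (simp add: d_def sum_lessThan_telescope[of "\<lambda>k. f (r k) x"])
  qed
  define g where "g x = lim (\<lambda>k. f (r k) x)" for x
  have [measurable]: "g \<in> borel_measurable lborel"
    unfolding g_def by measurable
  have fatou: "(\<integral>\<^sup>+x. ennreal ((norm (g x - f n x))\<^sup>2) \<partial>lborel) \<le> ennreal (e\<^sup>2)"
    if e: "\<And>k. k \<ge> K \<Longrightarrow> norm (X (r k) - X n) \<le> e" for n e K
  proof -
    have "(\<integral>\<^sup>+x. ennreal ((norm (g x - f n x))\<^sup>2) \<partial>lborel)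
        = (\<integral>\<^sup>+x. liminf (\<lambda>k. ennreal ((norm (f (r k) x - f n x))\<^sup>2)) \<partial>lborel)"
    proof (rule nn_integral_cong_AE)
      show "AE x in lborel. ennreal ((norm (g x - f n x))\<^sup>2)
          = liminf (\<lambda>k. ennreal ((norm (f (r k) x - f n x))\<^sup>2))"
        using conv
      proof eventually_elim
        case (elim x)
        then have "(\<lambda>k. f (r k) x) \<longlonglongrightarrow> g x"
          by (simp add: g_def convergent_LIMSEQ_iff)
        then have "(\<lambda>k. ennreal ((norm (f (r k) x - f n x))\<^sup>2)) \<longlonglongrightarrow> ennreal ((norm (g x - f n x))\<^sup>2)"
          by (intro tendsto_intros tendsto_ennrealI)
        then show ?case
          by (intro lim_imp_Liminf[symmetric]) simp_all
      qed
    qed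
    also have "\<dots> \<le> liminf (\<lambda>k. (\<integral>\<^sup>+x. ennreal ((norm (f (r k) x - f n x))\<^sup>2) \<partial>lborel))"
      by (intro nn_integral_liminf) measurable
    also have "\<dots> = liminf (\<lambda>k. ennreal ((norm (X (r k) - X n))\<^sup>2))"
      by (simp add: dist_eq)
    also have "\<dots> \<le> limsup (\<lambda>k. ennreal ((norm (X (r k) - X n))\<^sup>2))"
      by (simp add: Liminf_le_Limsup)
    also have "\<dots> \<le> ennreal (e\<^sup>2)"
      by (rule Limsup_bounded)
        (auto simp: eventually_sequentially intro!: exI[of _ K] ennreal_leI power_mono e)
    finally show ?thesis .
  qed
  have sq: "(\<lambda>x. g x - f n x) \<in> sq_integrable"
    if "\<And>k. k \<ge> K \<Longrightarrow> norm (X (r k) - X n) \<le> e" for n e K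
    unfolding sq_integrable_def
    using fatou[of K n e, OF that]
    by (auto intro!: integrableI_nonneg simp: le_less_trans[OF _ ennreal_less_top])
  have "g \<in> sq_integrable"
  proof -
    have "(\<lambda>x. g x - f (M 0) x) \<in> sq_integrable"
      by (rule sq[of 0 _ 1]) (use M[of 0 _ "M 0"] r[of 0] in \<open>auto simp: dist_norm intro: less_imp_le\<close>)
    from sq_integrable_add[OF this f[of "M 0"]] show ?thesis by simp
  qed
  have "X \<longlonglongrightarrow> abs_l2 g"
  proof (rule metric_LIMSEQ_I)
    fix e :: real assume "e > 0"
    then obtain k where k: "(1/4)^k < e"
      using real_arch_pow_inv[of e "1/4"] by auto
    have "dist (X n) (abs_l2 g) < e" if n: "n \<ge> M k" for n
    proof -
      have "(\<integral>\<^sup>+x. ennreal ((norm (g x - f n x))\<^sup>2) \<partial>lborel) \<le> ennreal (((1/4)^k)\<^sup>2)"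
        by (rule fatou[of k]) (use M[of k _ n] r[of k] n in \<open>auto simp: dist_norm intro: less_imp_le\<close>)
      then have "(norm (abs_l2 g - X n))\<^sup>2 \<le> ((1/4)^k)\<^sup>2"
        using nn_integral_norm_abs_l2[OF sq_integrable_diff[OF \<open>g \<in> sq_integrable\<close> f[of n]]]
        by (simp add: X abs_l2_diff f \<open>g \<in> sq_integrable\<close>)
      then have "norm (abs_l2 g - X n) \<le> (1/4)^k"
        by (rule power2_le_imp_le) simp
      then show ?thesis
        using k by (simp add: dist_norm norm_minus_commute)
    qed
    then show "\<exists>no. \<forall>n\<ge>no. dist (X n) (abs_l2 g) < e" by blast
  qed
  then show ?thesis by (auto simp: convergent_def)
qed

instance l2 :: banach
  by intro_classes (rule l2_Cauchy_convergent)

section \<open>Hilbert bases\<close>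

text \<open>Zero vectors are admitted, so that the index type may be larger than the basis.\<close>

definition hilbert_basis :: "('k \<Rightarrow> l2) \<Rightarrow> bool" where
  "hilbert_basis e \<longleftrightarrow> (\<forall>j k. j \<noteq> k \<longrightarrow> cinner (e j) (e k) = 0) \<and>
    (\<forall>k. e k = 0 \<or> norm (e k) = 1) \<and> (\<forall>x. (\<forall>k. cinner (e k) x = 0) \<longrightarrow> x = 0)"

text \<open>By Pythagoras, partial sums over nested finite sets differ by a tail of the squared
  norms. The net of finite partial sums is therefore Cauchy, and completeness of \<open>l2\<close>
  gives its limit.\<close>

lemma summable_orthogonal:
  fixes f :: "'k \<Rightarrow> l2"
  assumes orth: "\<And>j k. j \<noteq> k \<Longrightarrow> cinner (f j) (f k) = 0"
    and summ: "(\<lambda>k. (norm (f k))\<^sup>2) summable_on UNIV"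
  shows "f summable_on UNIV"
proof -
  let ?p = "\<lambda>k. (norm (f k))\<^sup>2"
  have "\<exists>P. eventually P (finite_subsets_at_top UNIV) \<and>
      (\<forall>F F'. P F \<and> P F' \<longrightarrow> dist (sum f F) (sum f F') < e)" if "e > 0" for e
  proof -
    define d where "d = (e/4)\<^sup>2"
    have "d > 0" using that by (simp add: d_def)
    then obtain F0 where F0: "finite F0" "dist (sum ?p F0) (infsum ?p UNIV) \<le> d"
      using infsum_finite_approximation[OF summ, of d] by auto
    have close: "dist (sum f F) (sum f F0) \<le> e/4" if "finite F" "F0 \<subseteq> F" for F
    proof -
      have "(norm (sum f F - sum f F0))\<^sup>2 = (norm (sum f (F - F0)))\<^sup>2"
        using that F0 by (simp add: sum_diff)
      also have "\<dots> = sum ?p (F - F0)"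
        by (intro norm_sum_orthogonal orth)
      also have "\<dots> = sum ?p F - sum ?p F0"
        using that F0 by (simp add: sum_diff)
      also have "\<dots> \<le> d"
        using finite_sum_le_infsum[OF summ, of F] that F0 by (simp add: dist_norm)
      finally show ?thesis
        unfolding d_def dist_norm by (rule power2_le_imp_le) (use \<open>e > 0\<close> in simp)
    qed
    define P where "P F \<longleftrightarrow> finite F \<and> F0 \<subseteq> F" for F
    have "dist (sum f F) (sum f F') < e" if "P F" "P F'" for F F'
      using close[of F] close[of F'] that \<open>e > 0\<close> dist_triangle2[of "sum f F" "sum f F'" "sum f F0"]
      unfolding P_def by linarith
    moreover have "eventually P (finite_subsets_at_top UNIV)"
      unfolding P_def eventually_finite_subsets_at_top using F0 by auto
    ultimately show ?thesis by blast
  qed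
  then have "cauchy_filter (filtermap (sum f) (finite_subsets_at_top UNIV))"
    by (simp add: cauchy_filter_metric_filtermap)
  then obtain L where "(sum f \<longlongrightarrow> L) (finite_subsets_at_top UNIV)"
    using complete_uniform[where S = "UNIV :: l2 set"] complete_UNIV by (force simp: filterlim_def)
  then show ?thesis
    by (auto simp: summable_on_def has_sum_def)
qed

context
  fixes e :: "'k \<Rightarrow> l2"
  assumes basis: "hilbert_basis e"
begin

lemma basis_cinner: "cinner (e j) (e k) = (if j = k \<and> e k \<noteq> 0 then 1 else 0)"
  using basis unfolding hilbert_basis_def by (auto simp: cinner_self)

lemma basis_eqI: "(\<And>k. cinner (e k) x = cinner (e k) y) \<Longrightarrow> x = y"
  using basis unfolding hilbert_basis_def by (metis cinner_diff_right eq_iff_diff_eq_0)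

lemma basis_norm_le: "norm (e k) \<le> 1"
  using basis unfolding hilbert_basis_def by (metis norm_zero order_refl zero_le_one)

text \<open>A void index has coefficient 0, and elsewhere \<open>norm (e k)\<close> is 1; the factor
  left by zero vectors can therefore be dropped in sums of squared coefficients.\<close>

lemma basis_coeff: "cmod (cinner (e k) x) * norm (e k) = cmod (cinner (e k) x)"
  using basis unfolding hilbert_basis_def by (metis cinner_zero_left mult.right_neutral mult_zero_left norm_zero)

lemma cinner_basis_sum:
  assumes "finite K"
  shows "cinner (e j) (\<Sum>k\<in>K. c k *\<^sub>C e k) = (if j \<in> K \<and> e j \<noteq> 0 then c j else 0)"
proof -
  have "cinner (e j) (\<Sum>k\<in>K. c k *\<^sub>C e k) = (\<Sum>k\<in>K. if k = j then (if e j \<noteq> 0 then c j else 0) else 0)"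
    unfolding cinner_sum_right by (intro sum.cong) (auto simp: basis_cinner)
  also have "\<dots> = (if j \<in> K \<and> e j \<noteq> 0 then c j else 0)"
    using assms by (simp add: sum.delta)
  finally show ?thesis .
qed

lemma norm_basis_sum:
  "(norm (\<Sum>k\<in>K. c k *\<^sub>C e k))\<^sup>2 = (\<Sum>k\<in>K. (cmod (c k) * norm (e k))\<^sup>2)"
  by (subst norm_sum_orthogonal) (auto simp: basis_cinner)

lemma Bessel:
  assumes "finite K"
  shows "(\<Sum>k\<in>K. (cmod (cinner (e k) x))\<^sup>2) \<le> (norm x)\<^sup>2"
proof -
  let ?y = "\<Sum>k\<in>K. cinner (e k) x *\<^sub>C e k"
  let ?s = "\<Sum>k\<in>K. (cmod (cinner (e k) x))\<^sup>2"
  have y: "(norm ?y)\<^sup>2 = ?s"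
    by (simp add: norm_basis_sum basis_coeff)
  have "cinner ?y x = complex_of_real ?s"
    by (simp add: cinner_sum_left complex_norm_square mult.commute[of "cnj _"] flip: of_real_power)
  then have "?s = inner ?y x"
    by (simp flip: Re_cinner)
  also have "\<dots> \<le> norm ?y * norm x"
    by (rule norm_cauchy_schwarz)
  finally have "norm ?y * norm ?y \<le> norm ?y * norm x"
    using y by (simp add: power2_eq_square)
  then have "norm ?y \<le> norm x"
    by (cases "norm ?y = 0") auto
  then show ?thesis
    using power_mono[of "norm ?y" "norm x" 2] y by simp
qed

text \<open>Riesz-Fischer for a basis with void indices: whatever \<open>c\<close> prescribes there
  is lost, hence the case split in the recovered coefficients.\<close>

lemma has_sum_coeff:
  assumes "(\<lambda>k. (cmod (c k))\<^sup>2) summable_on UNIV"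
  obtains x where "((\<lambda>k. c k *\<^sub>C e k) has_sum x) UNIV"
    and "\<And>k. cinner (e k) x = (if e k = 0 then 0 else c k)"
proof -
  have "(\<lambda>k. (norm (c k *\<^sub>C e k))\<^sup>2) summable_on UNIV"
    by (rule summable_on_comparison_test[OF assms])
      (auto simp: power_mult_distrib mult_left_le power_le_one basis_norm_le)
  then have "(\<lambda>k. c k *\<^sub>C e k) summable_on UNIV"
    by (intro summable_orthogonal) (auto simp: basis_cinner)
  then obtain x where x: "((\<lambda>k. c k *\<^sub>C e k) has_sum x) UNIV"
    by (auto simp: summable_on_def)
  moreover have "cinner (e j) x = (if e j = 0 then 0 else c j)" for j
  proof -
    have "((\<lambda>k. cinner (e j) (c k *\<^sub>C e k)) has_sum cinner (e j) x) UNIV"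
      using has_sum_bounded_linear[OF bounded_linear_cinner_right x] by (simp add: o_def)
    moreover have "((\<lambda>k. cinner (e j) (c k *\<^sub>C e k)) has_sum (if e j = 0 then 0 else c j)) UNIV"
      by (subst has_sum_cong_neutral[where T = "{j}" and g = "\<lambda>_. if e j = 0 then 0 else c j"])
        (auto simp: basis_cinner intro: has_sum_finiteI)
    ultimately show ?thesis by (rule has_sum_unique)
  qed
  ultimately show ?thesis using that by blast
qed

lemma summable_coeff: "(\<lambda>k. (cmod (cinner (e k) x))\<^sup>2) summable_on UNIV"
  by (rule nonneg_bdd_above_summable_on) (auto simp: bdd_above_def intro!: exI[of _ "(norm x)\<^sup>2"] Bessel)

lemma basis_expansion: "((\<lambda>k. cinner (e k) x *\<^sub>C e k) has_sum x) UNIV"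
proof -
  obtain y where y: "((\<lambda>k. cinner (e k) x *\<^sub>C e k) has_sum y) UNIV"
    "\<And>k. cinner (e k) y = (if e k = 0 then 0 else cinner (e k) x)"
    using has_sum_coeff[OF summable_coeff] by blast
  have "y = x"
    by (rule basis_eqI) (auto simp: y)
  then show ?thesis using y by simp
qed

lemma Parseval: "((\<lambda>k. (cmod (cinner (e k) x))\<^sup>2) has_sum (norm x)\<^sup>2) UNIV"
proof -
  have "((\<lambda>k. cinner x (cinner (e k) x *\<^sub>C e k)) has_sum cinner x x) UNIV"
    using has_sum_bounded_linear[OF bounded_linear_cinner_right basis_expansion] by (simp add: o_def)
  then have "((\<lambda>k. Re (cinner x (cinner (e k) x *\<^sub>C e k))) has_sum Re (cinner x x)) UNIV"
    by (rule has_sum_Re)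
  moreover have "Re (cinner x (cinner (e k) x *\<^sub>C e k)) = (cmod (cinner (e k) x))\<^sup>2" for k
    by (simp add: cinner_commute[of x] complex_norm_square[symmetric] del: of_real_power)
  ultimately show ?thesis
    by (simp add: cinner_self)
qed

end

section \<open>Spectral calculus in an eigenbasis\<close>

text \<open>This turns unordered sums into integrals over counting measure, where Parseval can be
  combined with a change of variables and with dominated convergence.\<close>

lemma nn_integral_count_space_has_sum:
  fixes f :: "'k \<Rightarrow> real"
  assumes "(f has_sum S) UNIV" "\<And>k. f k \<ge> 0"
  shows "(\<integral>\<^sup>+k. ennreal (f k) \<partial>count_space UNIV) = ennreal S"
proof -
  have "(\<lambda>k. norm (f k)) summable_on UNIV"
    using assms by (simp add: summable_on_def) blast
  then have abs: "Infinite_Set_Sum.abs_summable_on f UNIV"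
    by (simp only: abs_summable_equivalent)
  then have "(\<integral>\<^sup>+k. ennreal (f k) \<partial>count_space UNIV) = ennreal (infsetsum f UNIV)"
    unfolding infsetsum_def by (intro nn_integral_eq_integral) (auto simp: abs_summable_on_def assms)
  then show ?thesis
    using infsetsum_infsum[OF abs] infsumI[OF assms(1)] by simp
qed

section \<open>Projection-valued measures and their scalar measures\<close>

context
  fixes E :: "real set \<Rightarrow> l2 \<Rightarrow> l2"
  assumes E: "is_proj_measure E"
begin

lemma proj_add: "B \<in> sets borel \<Longrightarrow> E B (x + y) = E B x + E B y"
  using E by (simp add: is_proj_measure_def)

lemma proj_idem: "B \<in> sets borel \<Longrightarrow> E B (E B x) = E B x"
  using E by (simp add: is_proj_measure_def)

lemma proj_sym: "B \<in> sets borel \<Longrightarrow> cinner (E B x) y = cinner x (E B y)"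
  using E by (simp add: is_proj_measure_def)

lemma proj_UNIV: "E UNIV x = x"
  using E by (simp add: is_proj_measure_def)

lemma proj_sums: "range B \<subseteq> sets borel \<Longrightarrow> disjoint_family B \<Longrightarrow> (\<lambda>n::nat. E (B n) x) sums E (\<Union>n. B n) x"
  using E by (simp add: is_proj_measure_def)

lemma proj_empty: "E {} x = 0"
proof -
  have "(\<lambda>n::nat. E {} x) sums E {} x"
    using proj_sums[of "\<lambda>_. {}"] by (simp add: disjoint_family_on_def)
  then have "(\<lambda>n::nat. E {} x) \<longlonglongrightarrow> 0"
    by (intro summable_LIMSEQ_zero sums_summable)
  then show ?thesis
    by (simp add: LIMSEQ_const_iff)
qed

lemma norm_proj: "B \<in> sets borel \<Longrightarrow> (norm (E B x))\<^sup>2 = inner x (E B x)"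
  by (metis Re_cinner power2_norm_eq_inner proj_idem proj_sym)

lemma proj_Un:
  assumes "B \<in> sets borel" "C \<in> sets borel" "B \<inter> C = {}"
  shows "E (B \<union> C) x = E B x + E C x"
proof -
  have "(\<lambda>n. E (binaryset B C n) x) sums E (\<Union>n. binaryset B C n) x"
    by (rule proj_sums)
      (use assms in \<open>auto simp: binaryset_def disjoint_family_on_def split: if_splits\<close>)
  moreover have "(\<lambda>n. E (binaryset B C n) x) sums (E B x + E C x)"
    by (rule binaryset_sums[where f = "\<lambda>S. E S x"]) (rule proj_empty)
  ultimately show ?thesis
    using sums_unique2 by (force simp: UN_binaryset_eq)
qed

lemma norm_proj_le: "B \<in> sets borel \<Longrightarrow> norm (E B x) \<le> norm x"
proof (cases "E B x = 0")
  case False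
  assume "B \<in> sets borel"
  then have "norm (E B x) * norm (E B x) \<le> norm x * norm (E B x)"
    using norm_cauchy_schwarz[of x "E B x"] norm_proj[of B x] by (simp add: power2_eq_square)
  then show ?thesis
    using False by simp
qed simp

text \<open>\<open>is_proj_measure\<close> postulates no product rule; it follows from norms. For y
  = E B x, additivity gives ||E (B \<union> C) y||^2 = ||y||^2 + ||E C y||^2, and the left side is
  at most ||y||^2.\<close>

lemma proj_orthogonal:
  assumes B: "B \<in> sets borel" and C: "C \<in> sets borel" and "B \<inter> C = {}"
  shows "E C (E B x) = 0"
proof -
  let ?y = "E B x"
  have U: "B \<union> C \<in> sets borel" using assms by auto
  have "(norm (E (B \<union> C) ?y))\<^sup>2 = inner ?y (E B ?y) + inner ?y (E C ?y)"
    using norm_proj[OF U] proj_Un[OF assms] by (simp add: inner_add_right)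
  also have "\<dots> = (norm ?y)\<^sup>2 + (norm (E C ?y))\<^sup>2"
    using norm_proj[OF B, of ?y] norm_proj[OF C, of ?y] proj_idem[OF B] by simp
  finally have "(norm ?y)\<^sup>2 + (norm (E C ?y))\<^sup>2 \<le> (norm ?y)\<^sup>2"
    using power_mono[OF norm_proj_le[OF U] norm_ge_zero, of ?y 2] by simp
  then show ?thesis by simp
qed

lemma proj_finite_Union:
  assumes "finite F" "\<And>c. c \<in> F \<Longrightarrow> B c \<in> sets borel" "disjoint_family_on B F"
  shows "E (\<Union>c\<in>F. B c) x = (\<Sum>c\<in>F. E (B c) x)"
  using assms
proof (induction F)
  case empty
  then show ?case by (simp add: proj_empty)
next
  case (insert c F)
  have "E (B c \<union> (\<Union>c\<in>F. B c)) x = E (B c) x + E (\<Union>c\<in>F. B c) x"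
    by (rule proj_Un) (use insert in \<open>auto simp: disjoint_family_on_def\<close>)
  then show ?case
    using insert by (auto simp: disjoint_family_on_def)
qed

text \<open>\<open>measure_of\<close> takes the prescribed values only if they form a genuine
  measure. Countable additivity holds because the squared norm equals <x, E B x>, which is linear in
  E B x.\<close>

lemma emeasure_vec_measure:
  assumes "B \<in> sets borel"
  shows "emeasure (vec_measure E x) B = ennreal ((norm (E B x))\<^sup>2)"
  unfolding vec_measure_def
proof (rule emeasure_measure_of_sigma)
  show "sigma_algebra UNIV (sets (borel :: real measure))"
    by (metis sets.sigma_algebra_axioms space_borel)
  show "positive (sets borel) (\<lambda>B. ennreal ((norm (E B x))\<^sup>2))"
    by (simp add: positive_def proj_empty)
  show "countably_additive (sets borel) (\<lambda>B. ennreal ((norm (E B x))\<^sup>2))"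
  proof (rule countably_additiveI)
    fix A :: "nat \<Rightarrow> real set"
    assume A: "range A \<subseteq> sets borel" "disjoint_family A" "(\<Union>n. A n) \<in> sets borel"
    have "(\<lambda>n. inner x (E (A n) x)) sums inner x (E (\<Union>n. A n) x)"
      by (rule bounded_linear.sums[OF bounded_linear_inner_right proj_sums[OF A(1,2)]])
    then have *: "(\<lambda>n. (norm (E (A n) x))\<^sup>2) sums (norm (E (\<Union>n. A n) x))\<^sup>2"
      using A by (simp add: norm_proj image_subset_iff)
    then show "(\<Sum>n. ennreal ((norm (E (A n) x))\<^sup>2)) = ennreal ((norm (E (\<Union>n. A n) x))\<^sup>2)"
      using sums_unique[OF *] by (subst suminf_ennreal2) (auto simp: sums_summable)
  qed
qed fact

lemma sets_vec_measure [measurable_cong]: "sets (vec_measure E x) = sets borel"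
  unfolding vec_measure_def using sets.sigma_sets_eq[where 'a = real and M = borel] by (simp add: sets_measure_of)

lemma space_vec_measure: "space (vec_measure E x) = UNIV"
  unfolding vec_measure_def by simp

text \<open>The projections onto the level sets of \<open>s\<close> add up to the identity, so a y
  is itself a combination of the orthogonal vectors E (s^-1 c) y. Carrying \<open>a\<close> along
  lets the same identity measure how far \<open>s\<close> is from an eigenvalue.\<close>

lemma simple_spectral_isometry:
  assumes s: "simple_function borel s"
  shows "(\<integral>\<^sup>+x. ennreal ((cmod (s x - a))\<^sup>2) \<partial>vec_measure E y)
      = ennreal ((norm (simple_spectral_integral E s y - a *\<^sub>C y))\<^sup>2)"
proof -
  have fin: "finite (range s)" and meas: "s -` {c} \<in> sets borel" for c
    using simple_functionD(1)[OF s] simple_functionD(2)[OF s, of "{c}"] by (auto simp: space_borel)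
  have disj: "disjoint_family_on (\<lambda>c. s -` {c}) (range s)"
    by (auto simp: disjoint_family_on_def)
  have "(\<Union>c\<in>range s. s -` {c}) = UNIV" by auto
  then have y: "y = (\<Sum>c\<in>range s. E (s -` {c}) y)"
    using proj_finite_Union[OF fin meas disj, of y] by (simp add: proj_UNIV)
  have "simple_spectral_integral E s y - a *\<^sub>C y = (\<Sum>c\<in>range s. (c - a) *\<^sub>C E (s -` {c}) y)"
    unfolding simple_spectral_integral_def
    by (subst (2) y) (simp add: scaleC_sum_right scaleC_diff_left sum_subtractf)
  moreover have "cinner (E (s -` {c}) y) (E (s -` {d}) y) = 0" if "c \<noteq> d" for c d
  proof -
    have "s -` {d} \<inter> s -` {c} = {}"
      using that by auto
    then show ?thesis
      using proj_orthogonal[OF meas meas, of d c y] by (simp add: proj_sym[OF meas])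
  qed
  ultimately have "(norm (simple_spectral_integral E s y - a *\<^sub>C y))\<^sup>2
      = (\<Sum>c\<in>range s. (cmod (c - a))\<^sup>2 * (norm (E (s -` {c}) y))\<^sup>2)"
    by (simp add: norm_sum_orthogonal power_mult_distrib)
  moreover have "(\<integral>\<^sup>+x. ennreal ((cmod (s x - a))\<^sup>2) \<partial>vec_measure E y)
      = (\<integral>\<^sup>+x. (\<Sum>c\<in>range s. ennreal ((cmod (c - a))\<^sup>2) * indicator (s -` {c}) x) \<partial>vec_measure E y)"
    using fin by (intro nn_integral_cong) (simp add: indicator_def if_distrib[where f = "\<lambda>u. _ * u"] sum.delta' cong: if_cong)
  moreover have "\<dots> = (\<Sum>c\<in>range s. ennreal ((cmod (c - a))\<^sup>2) * ennreal ((norm (E (s -` {c}) y))\<^sup>2))"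
    using meas
    by (subst nn_integral_sum) (auto simp: nn_integral_cmult_indicator sets_vec_measure emeasure_vec_measure)
  ultimately show ?thesis
    by (simp add: ennreal_mult'[symmetric] sum_ennreal)
qed

text \<open>For an eigenvector \<open>y\<close> the variance \<open>\<integral>|x - a|\<^sup>2 d\<mu>\<^sub>y\<close> vanishes, so \<open>\<mu>\<^sub>y\<close> is a point mass at \<open>a\<close>.\<close>

lemma proj_eigenvector:
  assumes "has_spectral_integral E complex_of_real y (complex_of_real a *\<^sub>C y)" and B: "B \<in> sets borel"
  shows "E B y = (if a \<in> B then y else 0)"
proof -
  let ?\<mu> = "vec_measure E y"
  obtain s where s: "\<And>n. simple_function borel (s n)"
    "(\<lambda>n. \<integral>\<^sup>+x. ennreal ((cmod (s n x - complex_of_real x))\<^sup>2) \<partial>?\<mu>) \<longlonglongrightarrow> 0"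
    "(\<lambda>n. simple_spectral_integral E (s n) y) \<longlonglongrightarrow> complex_of_real a *\<^sub>C y"
    using assms unfolding has_spectral_integral_def by blast
  have [measurable]: "s n \<in> borel_measurable borel" for n
    by (intro borel_measurable_simple_function s)
  have "(\<lambda>n. (norm (simple_spectral_integral E (s n) y - complex_of_real a *\<^sub>C y))\<^sup>2) \<longlonglongrightarrow> 0"
    using tendsto_power[OF tendsto_norm[OF tendsto_diff[OF s(3) tendsto_const]],
        of "complex_of_real a *\<^sub>C y" 2] by simp
  then have "(\<lambda>n. \<integral>\<^sup>+x. ennreal ((cmod (s n x - complex_of_real a))\<^sup>2) \<partial>?\<mu>) \<longlonglongrightarrow> 0"
    unfolding simple_spectral_isometry[OF s(1)] using tendsto_ennrealI by fastforce
  from tendsto_add[OF ennreal_tendsto_cmult[OF _ s(2), of 2] ennreal_tendsto_cmult[OF _ this, of 2]]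
  have lim: "(\<lambda>n. 2 * (\<integral>\<^sup>+x. ennreal ((cmod (s n x - complex_of_real x))\<^sup>2) \<partial>?\<mu>)
      + 2 * (\<integral>\<^sup>+x. ennreal ((cmod (s n x - complex_of_real a))\<^sup>2) \<partial>?\<mu>)) \<longlonglongrightarrow> 0"
    by simp
  have le: "(\<integral>\<^sup>+x. ennreal ((x - a)\<^sup>2) \<partial>?\<mu>)
      \<le> 2 * (\<integral>\<^sup>+x. ennreal ((cmod (s n x - complex_of_real x))\<^sup>2) \<partial>?\<mu>)
      + 2 * (\<integral>\<^sup>+x. ennreal ((cmod (s n x - complex_of_real a))\<^sup>2) \<partial>?\<mu>)" for n
  proof -
    have pt: "(x - a)\<^sup>2 \<le> 2 * (cmod (s n x - complex_of_real x))\<^sup>2 + 2 * (cmod (s n x - complex_of_real a))\<^sup>2" for x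
    proof -
      let ?u = "cmod (s n x - complex_of_real x)" and ?v = "cmod (s n x - complex_of_real a)"
      have "\<bar>x - a\<bar> = cmod ((s n x - complex_of_real a) - (s n x - complex_of_real x))"
        by (simp flip: of_real_diff)
      also have "\<dots> \<le> ?u + ?v"
        using norm_triangle_ineq4[of "s n x - complex_of_real a" "s n x - complex_of_real x"] by simp
      finally have "(x - a)\<^sup>2 \<le> (?u + ?v)\<^sup>2"
        using power_mono[of "\<bar>x - a\<bar>" "?u + ?v" 2] by simp
      also have "\<dots> \<le> 2 * ?u\<^sup>2 + 2 * ?v\<^sup>2"
        using sum_squares_bound[of ?u ?v] by (simp add: power2_sum)
      finally show ?thesis .
    qed
    have "(\<integral>\<^sup>+x. ennreal ((x - a)\<^sup>2) \<partial>?\<mu>) \<le> (\<integral>\<^sup>+x. 2 * ennreal ((cmod (s n x - complex_of_real x))\<^sup>2)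
        + 2 * ennreal ((cmod (s n x - complex_of_real a))\<^sup>2) \<partial>?\<mu>)"
      using ennreal_leI[OF pt] by (intro nn_integral_mono) (simp add: ennreal_plus ennreal_mult')
    also have "\<dots> = 2 * (\<integral>\<^sup>+x. ennreal ((cmod (s n x - complex_of_real x))\<^sup>2) \<partial>?\<mu>)
      + 2 * (\<integral>\<^sup>+x. ennreal ((cmod (s n x - complex_of_real a))\<^sup>2) \<partial>?\<mu>)"
      by (subst nn_integral_add) (auto simp: nn_integral_cmult)
    finally show ?thesis .
  qed
  have "(\<integral>\<^sup>+x. ennreal ((x - a)\<^sup>2) \<partial>?\<mu>) \<le> 0"
    by (rule LIMSEQ_le_const[OF lim]) (use le in auto)
  then have "AE x in ?\<mu>. x = a"
    by (simp add: nn_integral_0_iff_AE)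
  then have "emeasure ?\<mu> (- {a}) = 0"
    by (subst (asm) AE_iff_measurable[of "- {a}"]) (auto simp: space_vec_measure sets_vec_measure)
  then have null: "E C y = 0" if "C \<in> sets borel" "a \<notin> C" for C
    using emeasure_mono[of C "- {a}" ?\<mu>] that by (auto simp: sets_vec_measure emeasure_vec_measure)
  show ?thesis
  proof (cases "a \<in> B")
    case True
    then have "E (- B) y = 0"
      using B by (intro null) auto
    moreover have "E (B \<union> - B) y = E B y + E (- B) y"
      by (rule proj_Un) (use B in auto)
    ultimately show ?thesis
      using True by (simp add: proj_UNIV)
  qed (simp add: null B)
qed

end

section \<open>Spectral integrals in an orthonormal basis\<close>

context
  fixes e :: "'k \<Rightarrow> l2" and l :: "'k \<Rightarrow> real"
  assumes basis: "hilbert_basis e"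
begin

lemma cinner_expansion: "((\<lambda>k. cnj (cinner (e k) x) * cinner (e k) y) has_sum cinner x y) UNIV"
proof -
  have "((\<lambda>k. cinner x (cinner (e k) y *\<^sub>C e k)) has_sum cinner x y) UNIV"
    using has_sum_bounded_linear[OF bounded_linear_cinner_right basis_expansion[OF basis]]
    by (simp add: o_def)
  then show ?thesis
    by (simp add: cinner_commute[of x "e _"] mult.commute)
qed

definition basis_proj :: "real set \<Rightarrow> l2 \<Rightarrow> l2" where
  "basis_proj B x = infsum (\<lambda>k. cinner (e k) x *\<^sub>C e k) {k. l k \<in> B}"

lemma basis_proj_coeff: "cinner (e k) (basis_proj B x) = (if l k \<in> B then cinner (e k) x else 0)"
proof -
  let ?c = "\<lambda>k. if l k \<in> B then cinner (e k) x else 0"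
  have "(\<lambda>k. (cmod (?c k))\<^sup>2) summable_on UNIV"
    by (rule summable_on_comparison_test[OF summable_coeff[OF basis, of x]]) auto
  from has_sum_coeff[OF basis this] obtain y where y: "((\<lambda>k. ?c k *\<^sub>C e k) has_sum y) UNIV"
    "\<And>k. cinner (e k) y = (if e k = 0 then 0 else ?c k)" by blast
  have "basis_proj B x = infsum (\<lambda>k. ?c k *\<^sub>C e k) UNIV"
    unfolding basis_proj_def by (rule infsum_cong_neutral) auto
  then show ?thesis
    using y infsumI[OF y(1)] by auto
qed

lemma is_proj_measure_basis_proj: "is_proj_measure basis_proj"
  unfolding is_proj_measure_def
proof (intro conjI ballI allI impI)
  note eqI = basis_eqI[OF basis]
  fix B :: "real set" and x y :: l2 and c :: complex
  show "basis_proj B (x + y) = basis_proj B x + basis_proj B y"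
    by (rule eqI) (simp add: basis_proj_coeff cinner_add_right)
  show "basis_proj B (c *\<^sub>C x) = c *\<^sub>C basis_proj B x"
    by (rule eqI) (simp add: basis_proj_coeff)
  show "basis_proj B (basis_proj B x) = basis_proj B x"
    by (rule eqI) (simp add: basis_proj_coeff)
  show "basis_proj UNIV x = x"
    by (rule eqI) (simp add: basis_proj_coeff)
  have "((\<lambda>k. cnj (cinner (e k) x) * cinner (e k) (basis_proj B y)) has_sum cinner (basis_proj B x) y) UNIV"
    using cinner_expansion[of "basis_proj B x" y]
    by (rule has_sum_cong[THEN iffD1, rotated]) (simp add: basis_proj_coeff)
  then show "cinner (basis_proj B x) y = cinner x (basis_proj B y)"
    by (rule has_sum_unique[OF _ cinner_expansion])
next
  fix B :: "nat \<Rightarrow> real set" and x :: l2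
  assume disj: "disjoint_family B"
  let ?g = "\<lambda>k. cinner (e k) x *\<^sub>C e k"
  \<comment> \<open>Countable additivity is Fubini for unordered sums: disjointness of the B n makes
    \<open>snd\<close> injective on this Sigma set, which is summed once as a whole and once fibre
    by fibre.\<close>
  let ?S = "Sigma UNIV (\<lambda>n. {k. l k \<in> B n})"
  have inj: "inj_on snd ?S"
    using disj by (auto simp: inj_on_def disjoint_family_on_def)
  have img: "snd ` ?S = {k. l k \<in> (\<Union>n. B n)}"
    by (auto simp: image_iff)
  have sub: "?g summable_on K" for K
    using summable_on_subset_banach[OF has_sum_imp_summable[OF basis_expansion[OF basis]]] by blast
  have "(?g has_sum basis_proj (\<Union>n. B n) x) (snd ` ?S)"
    unfolding img basis_proj_def using sub by (rule has_sum_infsum)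
  then have "((\<lambda>p. ?g (snd p)) has_sum basis_proj (\<Union>n. B n) x) ?S"
    by (simp add: has_sum_reindex[OF inj] o_def)
  then have "((\<lambda>n. basis_proj (B n) x) has_sum basis_proj (\<Union>n. B n) x) UNIV"
    by (rule has_sum_Sigma[OF isUCont_plus]) (simp add: basis_proj_def sub)
  then show "(\<lambda>n. basis_proj (B n) x) sums basis_proj (\<Union>n. B n) x"
    by (rule has_sum_imp_sums)
qed

lemma basis_proj_basis: "basis_proj B (e k) = (if l k \<in> B then e k else 0)"
  by (rule basis_eqI[OF basis]) (auto simp: basis_proj_coeff basis_cinner[OF basis])

context
  fixes E :: "real set \<Rightarrow> l2 \<Rightarrow> l2"
  assumes E: "is_proj_measure E"
    and E_basis: "\<And>B k. B \<in> sets borel \<Longrightarrow> E B (e k) = (if l k \<in> B then e k else 0)"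
begin

text \<open>Here \<open>E\<close> is arbitrary apart from its action on the basis, because
  \<open>spectral_measure\<close> is a choice that is known only through its eigenvectors.\<close>

lemma proj_coeff: "B \<in> sets borel \<Longrightarrow> cinner (e k) (E B x) = (if l k \<in> B then cinner (e k) x else 0)"
  by (subst proj_sym[OF E, symmetric]) (auto simp: E_basis)

lemma simple_spectral_integral_coeff:
  assumes s: "simple_function borel s"
  shows "cinner (e k) (simple_spectral_integral E s x) = s (l k) * cinner (e k) x"
proof -
  have fin: "finite (range s)" and meas: "s -` {c} \<in> sets borel" for c
    using simple_functionD(1)[OF s] simple_functionD(2)[OF s, of "{c}"] by (auto simp: space_borel)
  have "cinner (e k) (simple_spectral_integral E s x)
      = (\<Sum>c\<in>range s. if c = s (l k) then s (l k) * cinner (e k) x else 0)"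
    unfolding simple_spectral_integral_def cinner_sum_right
    by (intro sum.cong) (auto simp: proj_coeff meas)
  then show ?thesis
    using fin by (simp add: sum.delta)
qed

text \<open>By Parseval for E B y, the scalar spectral measure of y is the image under
  \<open>l\<close> of counting measure weighted by |<e k, y>|^2.\<close>

lemma nn_integral_vec_measure:
  assumes [measurable]: "g \<in> borel_measurable borel"
  shows "(\<integral>\<^sup>+x. g x \<partial>vec_measure E y)
    = (\<integral>\<^sup>+k. ennreal ((cmod (cinner (e k) y))\<^sup>2) * g (l k) \<partial>count_space UNIV)"
proof -
  let ?D = "density (count_space UNIV) (\<lambda>k. ennreal ((cmod (cinner (e k) y))\<^sup>2))"
  have [measurable]: "l \<in> ?D \<rightarrow>\<^sub>M borel"
    by (simp add: measurable_density_eq1)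
  have "vec_measure E y = distr ?D borel l"
  proof (rule measure_eqI)
    fix B assume "B \<in> sets (vec_measure E y)"
    then have B [measurable]: "B \<in> sets borel" by (simp add: sets_vec_measure[OF E])
    have "emeasure (distr ?D borel l) B = emeasure ?D (l -` B)"
      by (subst emeasure_distr) auto
    also have "\<dots> = (\<integral>\<^sup>+k. ennreal ((cmod (cinner (e k) y))\<^sup>2) * indicator (l -` B) k \<partial>count_space UNIV)"
      by (subst emeasure_density) auto
    also have "\<dots> = (\<integral>\<^sup>+k. ennreal ((cmod (cinner (e k) (E B y)))\<^sup>2) \<partial>count_space UNIV)"
      by (intro nn_integral_cong) (auto simp: proj_coeff indicator_def)
    also have "\<dots> = ennreal ((norm (E B y))\<^sup>2)"
      by (rule nn_integral_count_space_has_sum[OF Parseval[OF basis]]) simp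
    finally show "emeasure (vec_measure E y) B = emeasure (distr ?D borel l) B"
      by (simp add: emeasure_vec_measure[OF E] B)
  qed (simp add: sets_vec_measure[OF E])
  then show ?thesis
    by (simp add: nn_integral_distr nn_integral_density)
qed

text \<open>Necessity: a single coefficient of the error is bounded by the integral of |s n - f|^2.
  Sufficiency: the existence of \<open>z\<close> makes f (l k) <e k, y> square summable, which is
  the domain condition and provides the majorant for dominated convergence.\<close>

lemma has_spectral_integral_iff:
  "has_spectral_integral E f y z \<longleftrightarrow>
    f \<in> borel_measurable borel \<and> (\<forall>k. cinner (e k) z = f (l k) * cinner (e k) y)"
proof -
  have diff: "a * c - b * c = c * (a - b)" for a b c :: complex
    by (simp add: algebra_simps)
  show ?thesis
  proof safe
    assume I: "has_spectral_integral E f y z"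
    then show [measurable]: "f \<in> borel_measurable borel"
      by (simp add: has_spectral_integral_def)
    fix k
    obtain s where s: "\<And>n. simple_function borel (s n)"
      "(\<lambda>n. \<integral>\<^sup>+x. ennreal ((cmod (s n x - f x))\<^sup>2) \<partial>vec_measure E y) \<longlonglongrightarrow> 0"
      "(\<lambda>n. simple_spectral_integral E (s n) y) \<longlonglongrightarrow> z"
      using I unfolding has_spectral_integral_def by blast
    have [measurable]: "s n \<in> borel_measurable borel" for n
      by (intro borel_measurable_simple_function s)
    have le: "ennreal ((cmod (s n (l k) * cinner (e k) y - f (l k) * cinner (e k) y))\<^sup>2)
        \<le> (\<integral>\<^sup>+x. ennreal ((cmod (s n x - f x))\<^sup>2) \<partial>vec_measure E y)" for n
      using nn_integral_ge_point[of k UNIV "\<lambda>k. ennreal ((cmod (cinner (e k) y))\<^sup>2) * ennreal ((cmod (s n (l k) - f (l k)))\<^sup>2)"]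
      by (simp add: nn_integral_vec_measure diff norm_mult power_mult_distrib ennreal_mult')
    have "(\<lambda>n. ennreal ((cmod (s n (l k) * cinner (e k) y - f (l k) * cinner (e k) y))\<^sup>2)) \<longlonglongrightarrow> ennreal 0"
      unfolding ennreal_0 by (rule tendsto_sandwich[OF _ _ tendsto_const s(2)]) (use le in auto)
    then have "(\<lambda>n. (cmod (s n (l k) * cinner (e k) y - f (l k) * cinner (e k) y))\<^sup>2) \<longlonglongrightarrow> 0"
      by (subst (asm) tendsto_ennreal_iff) auto
    then have "(\<lambda>n. s n (l k) * cinner (e k) y) \<longlonglongrightarrow> f (l k) * cinner (e k) y"
      by (simp add: tendsto_norm_zero_iff LIM_zero_iff)
    moreover have "(\<lambda>n. s n (l k) * cinner (e k) y) \<longlonglongrightarrow> cinner (e k) z"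
      using tendsto_cinner[OF tendsto_const s(3), of "e k"] by (simp add: simple_spectral_integral_coeff s)
    ultimately show "cinner (e k) z = f (l k) * cinner (e k) y"
      using LIMSEQ_unique by blast
  next
    assume f [measurable]: "f \<in> borel_measurable borel"
      and z: "\<forall>k. cinner (e k) z = f (l k) * cinner (e k) y"
    obtain s where s: "\<And>n. simple_function borel (s n)" "\<And>x. (\<lambda>n. s n x) \<longlonglongrightarrow> f x"
      "\<And>n x. dist (s n x) 0 \<le> 2 * dist (f x) 0"
      using borel_measurable_implies_sequence_metric[OF f, of 0] by (auto simp: space_borel)
    have [measurable]: "s n \<in> borel_measurable borel" for n
      by (intro borel_measurable_simple_function s)
    define u where "u n k = (cmod (cinner (e k) (simple_spectral_integral E (s n) y - z)))\<^sup>2" for n k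
    have u: "u n k = (cmod (cinner (e k) y))\<^sup>2 * (cmod (s n (l k) - f (l k)))\<^sup>2" for n k
      by (simp add: u_def cinner_diff_right simple_spectral_integral_coeff s z diff norm_mult power_mult_distrib)
    have int_u: "(\<integral>\<^sup>+k. ennreal (u n k) \<partial>count_space UNIV)
        = ennreal ((norm (simple_spectral_integral E (s n) y - z))\<^sup>2)" for n
      unfolding u_def by (rule nn_integral_count_space_has_sum[OF Parseval[OF basis]]) simp
    \<comment> \<open>The approximants satisfy |s n| \<le> 2 |f|, so the error is at most 3 |f|;
      this is the origin of 9.\<close>
    have u_le: "u n k \<le> 9 * (cmod (cinner (e k) z))\<^sup>2" for n k
    proof -
      have "cmod (s n (l k) - f (l k)) \<le> 3 * cmod (f (l k))"
        using norm_triangle_ineq4[of "s n (l k)" "f (l k)"] s(3)[of n "l k"] by simp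
      then have "(cmod (s n (l k) - f (l k)))\<^sup>2 \<le> (3 * cmod (f (l k)))\<^sup>2"
        by (intro power_mono) auto
      then have "(cmod (s n (l k) - f (l k)))\<^sup>2 * (cmod (cinner (e k) y))\<^sup>2
          \<le> (3 * cmod (f (l k)))\<^sup>2 * (cmod (cinner (e k) y))\<^sup>2"
        by (intro mult_right_mono) auto
      then show ?thesis
        by (simp add: u z norm_mult power_mult_distrib mult_ac)
    qed
    have "(\<lambda>n. \<integral>\<^sup>+k. ennreal (u n k) \<partial>count_space UNIV) \<longlonglongrightarrow> (\<integral>\<^sup>+k. 0 \<partial>count_space (UNIV :: 'k set))"
    proof (rule nn_integral_dominated_convergence[where u = "\<lambda>n k. ennreal (u n k)" and u' = "\<lambda>_. 0"
          and w = "\<lambda>k. 9 * ennreal ((cmod (cinner (e k) z))\<^sup>2)"])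
      show "(\<integral>\<^sup>+k. 9 * ennreal ((cmod (cinner (e k) z))\<^sup>2) \<partial>count_space UNIV) < \<infinity>"
        by (simp add: nn_integral_cmult nn_integral_count_space_has_sum[OF Parseval[OF basis]] ennreal_mult_less_top)
      show "AE k in count_space UNIV. ennreal (u n k) \<le> 9 * ennreal ((cmod (cinner (e k) z))\<^sup>2)" for n
        using ennreal_leI[OF u_le] by (simp add: ennreal_mult')
      have "(\<lambda>n. u n k) \<longlonglongrightarrow> (cmod (cinner (e k) y))\<^sup>2 * (cmod (f (l k) - f (l k)))\<^sup>2" for k
        unfolding u by (intro tendsto_intros s)
      then show "AE k in count_space UNIV. (\<lambda>n. ennreal (u n k)) \<longlonglongrightarrow> 0"
        using tendsto_ennrealI by fastforce
    qed auto
    then have lim: "(\<lambda>n. \<integral>\<^sup>+k. ennreal (u n k) \<partial>count_space UNIV) \<longlonglongrightarrow> 0" by simp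
    have "(\<lambda>n. (norm (simple_spectral_integral E (s n) y - z))\<^sup>2) \<longlonglongrightarrow> 0"
      using lim unfolding int_u ennreal_0[symmetric] by (subst (asm) tendsto_ennreal_iff) auto
    then have "(\<lambda>n. simple_spectral_integral E (s n) y) \<longlonglongrightarrow> z"
      by (simp add: tendsto_norm_zero_iff LIM_zero_iff)
    moreover have "(\<lambda>n. \<integral>\<^sup>+x. ennreal ((cmod (s n x - f x))\<^sup>2) \<partial>vec_measure E y) \<longlonglongrightarrow> 0"
      using lim by (simp add: nn_integral_vec_measure u ennreal_mult')
    ultimately show "has_spectral_integral E f y z"
    unfolding has_spectral_integral_def using s(1) f by blast
  qed
qed

end

end

text \<open>Equality of sets makes \<open>A\<close> the maximal multiplication operator: the
  existence of a y with these coefficients is the domain condition, so self-adjointness is part of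
  the notion.\<close>

definition eigenbasis :: "('k \<Rightarrow> l2) \<Rightarrow> ('k \<Rightarrow> real) \<Rightarrow> (l2 \<times> l2) set \<Rightarrow> bool" where
  "eigenbasis e l A \<longleftrightarrow> hilbert_basis e \<and>
    A = {(x, y). \<forall>k. cinner (e k) y = complex_of_real (l k) * cinner (e k) x}"

lemma eigenbasis_hilbert_basis: "eigenbasis e l A \<Longrightarrow> hilbert_basis e"
  by (simp add: eigenbasis_def)

lemma eigenbasis_coeff:
  "eigenbasis e l A \<Longrightarrow> (x, y) \<in> A \<Longrightarrow> cinner (e k) y = complex_of_real (l k) * cinner (e k) x"
  by (simp add: eigenbasis_def)

text \<open>\<open>basis_proj\<close> shows that the choice in \<open>spectral_measure\<close> is
  not vacuous. The chosen measure is not known to be \<open>basis_proj\<close>, but each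
  \<open>e k\<close> is an eigenvector of its spectral integral, so \<open>proj_eigenvector\<close>
  fixes its values there.\<close>

lemma spectral_measure_eigenbasis:
  assumes "eigenbasis e l A"
  shows "is_proj_measure (spectral_measure A)"
    and "\<And>B k. B \<in> sets borel \<Longrightarrow> spectral_measure A B (e k) = (if l k \<in> B then e k else 0)"
proof -
  have basis: "hilbert_basis e"
    and A: "A = {(x, y). \<forall>k. cinner (e k) y = complex_of_real (l k) * cinner (e k) x}"
    using assms by (auto simp: eigenbasis_def)
  have "is_spectral_measure_of (basis_proj e l) A"
    unfolding is_spectral_measure_of_def A
    using is_proj_measure_basis_proj[OF basis, of l]
      has_spectral_integral_iff[OF basis is_proj_measure_basis_proj[OF basis, of l], of l]
      basis_proj_basis[OF basis, of l] by auto
  then have spec: "is_spectral_measure_of (spectral_measure A) A"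
    unfolding spectral_measure_def by (rule someI[of "\<lambda>E. is_spectral_measure_of E A"])
  then show 1: "is_proj_measure (spectral_measure A)"
    by (simp add: is_spectral_measure_of_def)
  fix B :: "real set" and k assume "B \<in> sets borel"
  moreover have "(e k, complex_of_real (l k) *\<^sub>C e k) \<in> A"
    unfolding A by (auto simp: basis_cinner[OF basis])
  then have "has_spectral_integral (spectral_measure A) complex_of_real (e k) (complex_of_real (l k) *\<^sub>C e k)"
    using spec by (auto simp: is_spectral_measure_of_def)
  ultimately show "spectral_measure A B (e k) = (if l k \<in> B then e k else 0)"
    by (intro proj_eigenvector[OF 1])
qed

lemma fun_calc_eqI:
  assumes A: "eigenbasis e l A" and f: "f \<in> borel_measurable borel"
    and y: "\<And>k. cinner (e k) y = f (l k) * cinner (e k) x"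
  shows "fun_calc f A x = y"
proof -
  note iff = has_spectral_integral_iff[OF eigenbasis_hilbert_basis[OF A] spectral_measure_eigenbasis[OF A]]
  show ?thesis
    unfolding fun_calc_def
  proof (rule the_equality)
    show "has_spectral_integral (spectral_measure A) f x y"
      by (simp add: iff f y)
    fix y' assume "has_spectral_integral (spectral_measure A) f x y'"
    then show "y' = y"
      by (intro basis_eqI[OF eigenbasis_hilbert_basis[OF A]]) (simp add: iff y)
  qed
qed

section \<open>Operators with compact resolvent\<close>

definition closed_symmetric :: "(l2 \<times> l2) set \<Rightarrow> bool" where
  "closed_symmetric A \<longleftrightarrow> closed A \<and> (0, 0) \<in> A \<and>
    (\<forall>x u y v. (x, u) \<in> A \<longrightarrow> (y, v) \<in> A \<longrightarrow> (x + y, u + v) \<in> A \<and> cinner u y = cinner x v) \<and>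
    (\<forall>c x u. (x, u) \<in> A \<longrightarrow> (c *\<^sub>C x, c *\<^sub>C u) \<in> A)"

lemma closed_symmetric_sum:
  assumes "closed_symmetric A" "\<And>k. k \<in> K \<Longrightarrow> (f k, g k) \<in> A"
  shows "(\<Sum>k\<in>K. c k *\<^sub>C f k, \<Sum>k\<in>K. c k *\<^sub>C g k) \<in> A"
  using assms(2) by (induction K rule: infinite_finite_induct)
    (use assms(1) in \<open>auto simp: closed_symmetric_def\<close>)

text \<open>A closed symmetric operator with a total orthogonal set of eigenvectors is already the
  maximal diagonal operator: symmetry transfers the eigenvalue to the other argument, and conversely
  the finite partial sums of both expansions lie in the graph, which is closed.\<close>

lemma eigenbasisI:
  assumes A: "closed_symmetric A" and basis: "hilbert_basis e"
    and eig: "\<And>k. (e k, complex_of_real (l k) *\<^sub>C e k) \<in> A"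
  shows "eigenbasis e l A"
proof -
  have "cinner (e k) y = complex_of_real (l k) * cinner (e k) x" if "(x, y) \<in> A" for x y k
    using A that eig[of k] unfolding closed_symmetric_def by (metis cinner_scaleC_left complex_cnj_complex_of_real)
  moreover have "(x, y) \<in> A" if xy: "\<And>k. cinner (e k) y = complex_of_real (l k) * cinner (e k) x" for x y
  proof (rule Lim_in_closed_set)
    show "closed A" using A by (simp add: closed_symmetric_def)
    let ?F = "finite_subsets_at_top (UNIV :: 'a set)"
    have "(\<Sum>k\<in>K. cinner (e k) x *\<^sub>C e k, \<Sum>k\<in>K. cinner (e k) x *\<^sub>C complex_of_real (l k) *\<^sub>C e k) \<in> A" for K
      by (rule closed_symmetric_sum[OF A]) (rule eig)
    then show "\<forall>\<^sub>F K in ?F. (\<Sum>k\<in>K. cinner (e k) x *\<^sub>C e k, \<Sum>k\<in>K. cinner (e k) y *\<^sub>C e k) \<in> A"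
      by (simp add: xy mult.commute)
    show "((\<lambda>K. (\<Sum>k\<in>K. cinner (e k) x *\<^sub>C e k, \<Sum>k\<in>K. cinner (e k) y *\<^sub>C e k)) \<longlongrightarrow> (x, y)) ?F"
      by (intro tendsto_Pair) (use basis_expansion[OF basis] in \<open>auto simp: has_sum_def\<close>)
  qed simp
  ultimately show ?thesis
    using basis unfolding eigenbasis_def by blast
qed

text \<open>By induction the set is a Minkowski sum of discs spanned by the single vectors
  \<open>b j\<close>.\<close>

lemma compact_combinations:
  assumes "finite K"
  shows "compact {\<Sum>k\<in>K. c k *\<^sub>C b k | c. \<forall>k\<in>K. cmod (c k) \<le> r k}"
  using assms
proof (induction K)
  case (insert j K)
  have "compact ((\<lambda>a. a *\<^sub>C b j) ` cball 0 (r j))"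
  proof (intro compact_continuous_image continuous_on_subset[OF linear_continuous_on])
    show "bounded_linear (\<lambda>a. a *\<^sub>C b j)"
      by (rule bounded_linear_intro[where K = "norm (b j)"])
        (auto simp: scaleC_add_left scaleR_scaleC scaleR_conv_of_real)
  qed auto
  from compact_sums[OF this insert.IH]
  have "compact {x + y | x y. x \<in> (\<lambda>a. a *\<^sub>C b j) ` cball 0 (r j) \<and>
      y \<in> {\<Sum>k\<in>K. c k *\<^sub>C b k | c. \<forall>k\<in>K. cmod (c k) \<le> r k}}" .
  also have "\<dots> = {\<Sum>k\<in>insert j K. c k *\<^sub>C b k | c. \<forall>k\<in>insert j K. cmod (c k) \<le> r k}" (is "?L = ?R")
  proof (intro equalityI subsetI)
    fix z assume "z \<in> ?L"
    then obtain a c where *: "z = a *\<^sub>C b j + (\<Sum>k\<in>K. c k *\<^sub>C b k)" "cmod a \<le> r j" "\<forall>k\<in>K. cmod (c k) \<le> r k"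
      by auto
    have "z = (\<Sum>k\<in>insert j K. (c(j := a)) k *\<^sub>C b k)"
      using insert(1,2) * by (auto intro!: sum.cong)
    then show "z \<in> ?R"
      using * by (intro CollectI exI[of _ "c(j := a)"]) auto
  next
    fix z assume "z \<in> ?R"
    then obtain c where c: "z = (\<Sum>k\<in>insert j K. c k *\<^sub>C b k)" "\<forall>k\<in>insert j K. cmod (c k) \<le> r k"
      by blast
    then have "z = c j *\<^sub>C b j + (\<Sum>k\<in>K. c k *\<^sub>C b k)"
      using insert(1,2) by simp
    with c(2) show "z \<in> ?L"
      by (intro CollectI exI[of _ "c j *\<^sub>C b j"] exI[of _ "\<Sum>k\<in>K. c k *\<^sub>C b k"]) auto
  qed
  finally show ?case .
qed simp

text \<open>Finite sublevel sets of \<open>d\<close> make the tails of the coefficients uniformly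
  small, so up to \<epsilon> only finitely many coordinates matter. This is the usual compact
  embedding of a weighted sequence space.\<close>

lemma compact_weighted_coefficients:
  fixes B :: "'k \<Rightarrow> l2" and d :: "'k \<Rightarrow> real"
  assumes basis: "hilbert_basis B" and d: "\<And>k. d k > 0" and fin: "\<And>r. finite {k. d k \<le> r}" and r: "r > 0"
  shows "compact {x. \<forall>K. finite K \<longrightarrow> (\<Sum>k\<in>K. (d k * cmod (cinner (B k) x))\<^sup>2) \<le> r\<^sup>2}" (is "compact ?S")
proof -
  have "closed {x. finite K \<longrightarrow> (\<Sum>k\<in>K. (d k * cmod (cinner (B k) x))\<^sup>2) \<le> r\<^sup>2}" for K
    by (cases "finite K") (auto intro!: closed_Collect_le continuous_intros)
  then have "closed ?S"
    by (rule closed_Collect_all)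
  moreover have "\<exists>C. finite C \<and> ?S \<subseteq> (\<Union>x\<in>C. ball x \<epsilon>)" if "\<epsilon> > 0" for \<epsilon>
  proof -
    \<comment> \<open>Outside \<open>K\<close> the weight exceeds 3 r/\<epsilon>, so the tail is at
      most \<epsilon>/3; with an \<epsilon>/2 net for the head the sum stays below
      \<epsilon>.\<close>
    define K where "K = {k. d k \<le> 3 * r / \<epsilon>}"
    have K: "finite K" by (simp add: K_def fin)
    let ?P = "\<lambda>x. \<Sum>k\<in>K. cinner (B k) x *\<^sub>C B k"
    let ?T = "{\<Sum>k\<in>K. c k *\<^sub>C B k | c. \<forall>k\<in>K. cmod (c k) \<le> r / d k}"
    have "compact ?T"
      by (rule compact_combinations[OF K])
    then have "\<exists>C. finite C \<and> ?T \<subseteq> (\<Union>x\<in>C. ball x (\<epsilon>/2))"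
      unfolding compact_eq_totally_bounded using \<open>\<epsilon> > 0\<close> by (elim conjE allE[of _ "\<epsilon>/2"]) simp
    then obtain C where C: "finite C" "?T \<subseteq> (\<Union>x\<in>C. ball x (\<epsilon>/2))"
      by blast
    have "x \<in> (\<Union>x\<in>C. ball x \<epsilon>)" if "x \<in> ?S" for x
    proof -
      have x: "(\<Sum>k\<in>K. (d k * cmod (cinner (B k) x))\<^sup>2) \<le> r\<^sup>2" if "finite K" for K
        using \<open>x \<in> ?S\<close> that by blast
      have "d k * cmod (cinner (B k) x) \<le> r" for k
        by (rule power2_le_imp_le) (use x[of "{k}"] r in auto)
      then have "?P x \<in> ?T"
        using d by (intro CollectI exI[of _ "\<lambda>k. cinner (B k) x"]) (auto simp: field_simps)
      then obtain c where c: "c \<in> C" "dist c (?P x) < \<epsilon>/2"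
        using C by auto
      have coeff: "cinner (B k) (x - ?P x) = (if k \<in> K then 0 else cinner (B k) x)" for k
        by (auto simp: cinner_diff_right cinner_basis_sum[OF basis K])
      have "(norm (x - ?P x))\<^sup>2 \<le> (\<epsilon>/3)\<^sup>2"
      proof (rule has_sum_le_finite_sums[OF Parseval[OF basis]])
        fix F :: "'k set" assume "finite F"
        have "(\<Sum>k\<in>F. (cmod (cinner (B k) (x - ?P x)))\<^sup>2)
            \<le> (\<Sum>k\<in>F. (\<epsilon> / (3 * r))\<^sup>2 * (d k * cmod (cinner (B k) x))\<^sup>2)"
        proof (rule sum_mono)
          fix k assume "k \<in> F"
          have "cmod (cinner (B k) (x - ?P x)) \<le> \<epsilon> / (3 * r) * (d k * cmod (cinner (B k) x))"
          proof (cases "k \<in> K")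
            case False
            then have "1 \<le> \<epsilon> / (3 * r) * d k"
              using r \<open>\<epsilon> > 0\<close> by (simp add: K_def field_simps)
            then show ?thesis
              using False mult_right_mono[of 1 "\<epsilon> / (3 * r) * d k" "cmod (cinner (B k) x)"]
              by (simp add: coeff mult.assoc)
          qed (use r \<open>\<epsilon> > 0\<close> d[of k] in \<open>simp add: coeff\<close>)
          then show "(cmod (cinner (B k) (x - ?P x)))\<^sup>2 \<le> (\<epsilon> / (3 * r))\<^sup>2 * (d k * cmod (cinner (B k) x))\<^sup>2"
            unfolding power_mult_distrib[symmetric] by (intro power_mono) auto
        qed
        also have "\<dots> = (\<epsilon> / (3 * r))\<^sup>2 * (\<Sum>k\<in>F. (d k * cmod (cinner (B k) x))\<^sup>2)"
          by (simp add: sum_distrib_left)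
        also have "\<dots> \<le> (\<epsilon> / (3 * r))\<^sup>2 * r\<^sup>2"
          by (intro mult_left_mono x \<open>finite F\<close>) auto
        also have "\<dots> = (\<epsilon>/3)\<^sup>2"
          using r by (simp add: power_divide power_mult_distrib)
        finally show "(\<Sum>k\<in>F. (cmod (cinner (B k) (x - ?P x)))\<^sup>2) \<le> (\<epsilon>/3)\<^sup>2" .
      qed
      then have "dist (?P x) x \<le> \<epsilon>/3"
        unfolding dist_norm norm_minus_commute[of "?P x"]
        by (rule power2_le_imp_le) (use \<open>\<epsilon> > 0\<close> in simp)
      then have "dist c x < \<epsilon>"
        using c(2) \<open>\<epsilon> > 0\<close> dist_triangle[of c x "?P x"] by linarith
      then show ?thesis using c(1) by auto
    qed
    then show ?thesis using C(1) by blast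
  qed
  ultimately show ?thesis
    unfolding compact_eq_totally_bounded complete_eq_closed by (intro conjI allI impI)
qed

text \<open>A sequence of unit vectors maximising \<open>norm (R x)\<close> accumulates at an eigenvector of \<open>R\<^sup>2\<close>.\<close>

lemma compact_self_adjoint_eigenvector:
  fixes R :: "l2 \<Rightarrow> l2"
  assumes add: "\<And>x y. R (x + y) = R x + R y" and scale: "\<And>c x. R (c *\<^sub>C x) = c *\<^sub>C R x"
    and sym: "\<And>x y. cinner (R x) y = cinner x (R y)"
    and inj: "\<And>x. R x = 0 \<Longrightarrow> x = 0"
    and bound: "\<And>x. norm (R x) \<le> C * norm x"
    and compact: "compact S" "\<And>x. norm x \<le> 1 \<Longrightarrow> R x \<in> S"
    and V: "closed V" "\<And>x y. x \<in> V \<Longrightarrow> y \<in> V \<Longrightarrow> x + y \<in> V" "\<And>c x. x \<in> V \<Longrightarrow> c *\<^sub>C x \<in> V"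
      "\<And>x. x \<in> V \<Longrightarrow> R x \<in> V" "x0 \<in> V" "x0 \<noteq> 0"
  obtains v r where "v \<in> V" "norm v = 1" "r \<noteq> 0" "R v = complex_of_real r *\<^sub>C v"
proof -
  have lin: "bounded_linear R"
    by (rule bounded_linear_intro[where K = C]) (auto simp: add scale scaleR_scaleC bound mult.commute)
  define U where "U = {x \<in> V. norm x = 1}"
  have unit: "complex_of_real (1 / norm x) *\<^sub>C x \<in> U" if "x \<in> V" "x \<noteq> 0" for x
    using that V(3) by (simp add: U_def norm_divide)
  define M where "M = (SUP x\<in>U. norm (R x))"
  have bdd: "bdd_above ((\<lambda>x. norm (R x)) ` U)"
    using bound by (auto simp: bdd_above_def U_def intro!: exI[of _ C]) (metis mult.right_neutral)
  have M_ge: "norm (R x) \<le> M" if "x \<in> U" for x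
    unfolding M_def using that bdd by (rule cSUP_upper)
  have M_bound: "norm (R x) \<le> M * norm x" if "x \<in> V" for x
  proof (cases "x = 0")
    case False
    then show ?thesis
      using M_ge[OF unit[OF that False]] by (simp add: scale field_simps norm_divide)
  qed (use lin in \<open>simp add: linear_simps\<close>)
  \<comment> \<open>Positivity of the supremum is where injectivity of \<open>R\<close> enters; it
    makes the eigenvalue found below non-zero.\<close>
  have "M > 0"
  proof -
    obtain y where "y \<in> U" using unit[OF V(5,6)] by blast
    then have "R y \<noteq> 0" using inj[of y] by (auto simp: U_def)
    then show ?thesis using M_ge[OF \<open>y \<in> U\<close>] by (meson less_le_trans zero_less_norm_iff)
  qed
  have "\<exists>x\<in>U. M - 1 / real (Suc n) < norm (R x)" for n
  proof -
    have "M - 1 / real (Suc n) < (SUP x\<in>U. norm (R x))" by (simp add: M_def)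
    then show ?thesis
      using unit[OF V(5,6)] bdd by (subst (asm) less_cSUP_iff) auto
  qed
  then obtain x where x: "\<And>n. x n \<in> U" "\<And>n. M - 1 / real (Suc n) < norm (R (x n))"
    by metis
  have lim: "(\<lambda>n. norm (R (x n))) \<longlonglongrightarrow> M"
  proof (rule tendsto_sandwich[where h = "\<lambda>_. M"])
    show "(\<lambda>n. M - 1 / real (Suc n)) \<longlonglongrightarrow> M"
      using tendsto_diff[OF tendsto_const LIMSEQ_inverse_real_of_nat] by (simp add: inverse_eq_divide)
  qed (auto intro!: always_eventually M_ge x(1) less_imp_le[OF x(2)] simp del: of_nat_Suc)
  have x1: "norm (x n) = 1" "x n \<in> V" for n
    using x(1) by (auto simp: U_def)
  obtain w g where g: "strict_mono g" "(\<lambda>n. R (x (g n))) \<longlonglongrightarrow> w"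
  proof (rule seq_compactE[OF compact_imp_seq_compact[OF compact(1)], of "\<lambda>n. R (x n)"])
    show "\<forall>n. R (x n) \<in> S" using compact(2) x1 by simp
  qed (use that in \<open>auto simp: o_def\<close>)
  \<comment> \<open>Expanding the square and using ||R R x|| \<le> M^2 on the invariant subspace
    leaves a quantity that tends to 0 along the maximising sequence.\<close>
  have RR: "(norm (R (R (x n)) - complex_of_real (M\<^sup>2) *\<^sub>C x n))\<^sup>2 \<le> 2 * M^4 - 2 * M\<^sup>2 * (norm (R (x n)))\<^sup>2" for n
  proof -
    have "inner (R (R (x n))) (x n) = (norm (R (x n)))\<^sup>2"
      unfolding power2_norm_eq_inner Re_cinner[symmetric] by (simp only: sym)
    moreover have "(norm (R (R (x n))))\<^sup>2 \<le> M^4"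
    proof -
      have "norm (R (R (x n))) \<le> M * norm (R (x n))"
        by (rule M_bound[OF V(4)[OF x1(2)]])
      also have "\<dots> \<le> M * M"
        using M_ge[OF x(1)] \<open>M > 0\<close> by (intro mult_left_mono) auto
      finally have "(norm (R (R (x n))))\<^sup>2 \<le> (M * M)\<^sup>2"
        by (intro power_mono) auto
      then show ?thesis by (simp add: power2_eq_square power4_eq_xxxx)
    qed
    moreover have "(norm (a - r *\<^sub>R b))\<^sup>2 = (norm a)\<^sup>2 - 2 * r * inner a b + r\<^sup>2 * (norm b)\<^sup>2" for a b :: l2 and r
      unfolding power2_norm_eq_inner inner_diff_left inner_diff_right inner_scaleR_left inner_scaleR_right
        inner_commute[of b a] by (simp add: algebra_simps power2_eq_square)
    from this[of "R (R (x n))" "M\<^sup>2" "x n"]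
    have "(norm (R (R (x n)) - M\<^sup>2 *\<^sub>R x n))\<^sup>2
        = (norm (R (R (x n))))\<^sup>2 - 2 * M\<^sup>2 * inner (R (R (x n))) (x n) + M^4"
      by (simp only: x1 power_one mult_1_right power_mult[symmetric]) simp
    ultimately show ?thesis
      unfolding scaleR_scaleC[symmetric] by simp
  qed
  have "(\<lambda>n. 2 * M^4 - 2 * M\<^sup>2 * (norm (R (x n)))\<^sup>2) \<longlonglongrightarrow> 2 * M^4 - 2 * M\<^sup>2 * M\<^sup>2"
    by (intro tendsto_intros lim)
  then have "(\<lambda>n. 2 * M^4 - 2 * M\<^sup>2 * (norm (R (x n)))\<^sup>2) \<longlonglongrightarrow> 0"
    by (simp add: power4_eq_xxxx power2_eq_square)
  then have "(\<lambda>n. (norm (R (R (x n)) - complex_of_real (M\<^sup>2) *\<^sub>C x n))\<^sup>2) \<longlonglongrightarrow> 0"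
    by (rule tendsto_sandwich[OF _ _ tendsto_const, rotated 2]) (use RR in auto)
  then have "(\<lambda>n. R (R (x n)) - complex_of_real (M\<^sup>2) *\<^sub>C x n) \<longlonglongrightarrow> 0"
    by (simp add: tendsto_norm_zero_iff)
  then have "(\<lambda>n. R (R (x (g n))) - complex_of_real (M\<^sup>2) *\<^sub>C x (g n)) \<longlonglongrightarrow> 0"
    using LIMSEQ_subseq_LIMSEQ[OF _ g(1)] by (fastforce simp: o_def)
  from tendsto_diff[OF bounded_linear.tendsto[OF lin g(2)] this]
  have "(\<lambda>n. complex_of_real (M\<^sup>2) *\<^sub>C x (g n)) \<longlonglongrightarrow> R w" by simp
  from tendsto_scaleC_right[OF this, of "complex_of_real (1 / M\<^sup>2)"]
  obtain v where v: "(\<lambda>n. x (g n)) \<longlonglongrightarrow> v" and Rw: "R w = complex_of_real (M\<^sup>2) *\<^sub>C v"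
    using \<open>M > 0\<close> by (auto simp flip: of_real_mult of_real_power) 
  have vV: "v \<in> V"
    by (rule closed_sequentially[OF V(1) _ v]) (simp add: x1)
  have v1: "norm v = 1"
    using tendsto_norm[OF v] x1 by (simp add: LIMSEQ_const_iff)
  have "R v = w"
    using bounded_linear.tendsto[OF lin v] g(2) LIMSEQ_unique by blast
  then have RRv: "R (R v) = complex_of_real (M\<^sup>2) *\<^sub>C v" using Rw by simp
  \<comment> \<open>R^2 - M^2 factors as (R - M)(R + M) and annihilates \<open>v\<close>: either (R
    + M) v vanishes and -M is an eigenvalue, or it is an eigenvector for M.\<close>
  define u where "u = R v + complex_of_real M *\<^sub>C v"
  show ?thesis
  proof (cases "u = 0")
    case True
    then have "R v = complex_of_real (- M) *\<^sub>C v"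
      by (simp add: u_def scaleC_minus_left add_eq_0_iff)
    then show ?thesis using that[of v "- M"] vV v1 \<open>M > 0\<close> by simp
  next
    case False
    have "u \<in> V" using vV V by (simp add: u_def)
    have Ru: "R u = complex_of_real M *\<^sub>C u"
      by (simp add: u_def add scale RRv scaleC_add_right power2_eq_square add.commute)
    let ?v = "complex_of_real (1 / norm u) *\<^sub>C u"
    have "?v \<in> V" "norm ?v = 1"
      using unit[OF \<open>u \<in> V\<close> False] by (auto simp: U_def)
    moreover have "R ?v = complex_of_real M *\<^sub>C ?v"
      by (simp add: scale Ru mult.commute)
    ultimately show ?thesis using that[of ?v M] \<open>M > 0\<close> by simp
  qed
qed

text \<open>The shifted operator \<open>A + \<mu>\<close> is within relative distance \<open>1/2\<close> of the diagonal operator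
  \<open>B k \<mapsto> d k B k\<close>; hence it is onto and its inverse \<open>R\<close> is compact.  A maximal orthonormal set of
  eigenvectors of \<open>R\<close> is total, since its complement contains no eigenvector.\<close>

theorem relatively_bounded_eigenbasis:
  fixes B :: "'k \<Rightarrow> l2" and t :: "'k \<Rightarrow> l2" and d :: "'k \<Rightarrow> real" and \<mu> :: real
  assumes A: "closed_symmetric A" and basis: "hilbert_basis B" and t: "\<And>k. (B k, t k) \<in> A"
    and d1: "\<And>k. d k \<ge> 1" and fin: "\<And>r. finite {k. d k \<le> r}"
    and rel: "\<And>K c. finite K \<Longrightarrow>
      norm (\<Sum>k\<in>K. c k *\<^sub>C (t k + complex_of_real \<mu> *\<^sub>C B k - complex_of_real (d k) *\<^sub>C B k))
      \<le> 1/2 * norm (\<Sum>k\<in>K. c k *\<^sub>C complex_of_real (d k) *\<^sub>C B k)"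
  obtains e :: "l2 \<Rightarrow> l2" and l where "eigenbasis e l A"
proof -

  \<comment> \<open>The shifted operator on finite combinations\<close>
  have d0: "d k > 0" for k using d1[of k] by linarith
  define T where "T k = t k + complex_of_real \<mu> *\<^sub>C B k" for k
  define G where "G = {(\<Sum>k\<in>K. c k *\<^sub>C B k, \<Sum>k\<in>K. c k *\<^sub>C T k) | K c. finite K}"
  have G_scale: "(c *\<^sub>C x, c *\<^sub>C y) \<in> G" if xy: "(x, y) \<in> G" for c x y
  proof -
    obtain K a where "finite K" "x = (\<Sum>k\<in>K. a k *\<^sub>C B k)" "y = (\<Sum>k\<in>K. a k *\<^sub>C T k)"
      using xy by (auto simp: G_def)
    then show ?thesis
      unfolding G_def by (intro CollectI exI[of _ K] exI[of _ "\<lambda>k. c * a k"]) (simp add: scaleC_sum_right)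
  qed
  have G_add: "(x + x', y + y') \<in> G" if xy: "(x, y) \<in> G" and xy': "(x', y') \<in> G" for x y x' y'
  proof -
    obtain K a where K: "finite K" "x = (\<Sum>k\<in>K. a k *\<^sub>C B k)" "y = (\<Sum>k\<in>K. a k *\<^sub>C T k)"
      using xy by (auto simp: G_def)
    obtain K' a' where K': "finite K'" "x' = (\<Sum>k\<in>K'. a' k *\<^sub>C B k)" "y' = (\<Sum>k\<in>K'. a' k *\<^sub>C T k)"
      using xy' by (auto simp: G_def)
    let ?a = "\<lambda>k. (if k \<in> K then a k else 0) + (if k \<in> K' then a' k else 0)"
    have "(\<Sum>k\<in>K \<union> K'. ?a k *\<^sub>C f k) = (\<Sum>k\<in>K. a k *\<^sub>C f k) + (\<Sum>k\<in>K'. a' k *\<^sub>C f k)" for f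
    proof -
      have "(\<Sum>k\<in>K \<union> K'. (if k \<in> K then a k else 0) *\<^sub>C f k) = (\<Sum>k\<in>K. a k *\<^sub>C f k)"
        using K(1) K'(1) by (intro sum.mono_neutral_cong_right) auto
      moreover have "(\<Sum>k\<in>K \<union> K'. (if k \<in> K' then a' k else 0) *\<^sub>C f k) = (\<Sum>k\<in>K'. a' k *\<^sub>C f k)"
        using K(1) K'(1) by (intro sum.mono_neutral_cong_right) auto
      ultimately show ?thesis
        by (simp add: scaleC_add_left sum.distrib)
    qed
    then show ?thesis
      unfolding G_def using K K' by (intro CollectI exI[of _ "K \<union> K'"] exI[of _ ?a]) auto
  qed
  \<comment> \<open>The relative bound gives ||z|| \<le> 2 ||y|| for the diagonal image z of x, and
    the coefficients of z are those of x weighted by \<open>d\<close>.\<close>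
  have G_bound: "(\<Sum>k\<in>F. (d k * cmod (cinner (B k) x))\<^sup>2) \<le> (2 * norm y)\<^sup>2"
    if F: "finite F" and xy: "(x, y) \<in> G" for F x y
  proof -
    obtain K a where K: "finite K" "x = (\<Sum>k\<in>K. a k *\<^sub>C B k)" "y = (\<Sum>k\<in>K. a k *\<^sub>C T k)"
      using xy by (auto simp: G_def)
    define z where "z = (\<Sum>k\<in>K. (a k * complex_of_real (d k)) *\<^sub>C B k)"
    have "y - z = (\<Sum>k\<in>K. a k *\<^sub>C (T k - complex_of_real (d k) *\<^sub>C B k))"
      by (simp add: K z_def scaleC_diff_right sum_subtractf)
    then have "norm (y - z) \<le> 1/2 * norm z"
      using rel[OF K(1), of a] by (simp add: T_def z_def)
    then have nz: "norm z \<le> 2 * norm y"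
      using norm_triangle_ineq2[of z y] by (simp add: norm_minus_commute)
    have "d k * cmod (cinner (B k) x) = cmod (cinner (B k) z)" for k
      using d0[of k] by (simp add: K z_def cinner_basis_sum[OF basis K(1)] norm_mult)
    then have "(\<Sum>k\<in>F. (d k * cmod (cinner (B k) x))\<^sup>2) \<le> (norm z)\<^sup>2"
      using Bessel[OF basis F, of z] by simp
    also have "\<dots> \<le> (2 * norm y)\<^sup>2"
      using nz by (intro power_mono) auto
    finally show ?thesis .
  qed

  \<comment> \<open>The closure of the shifted operator\<close>
  define A0 where "A0 = closure G"
  have A0_add: "(x + x', y + y') \<in> A0" if "(x, y) \<in> A0" "(x', y') \<in> A0" for x y x' y'
  proof -
    obtain f g where f: "\<And>n. f n \<in> G" "f \<longlonglongrightarrow> (x, y)" and g: "\<And>n. g n \<in> G" "g \<longlonglongrightarrow> (x', y')"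
      using \<open>(x, y) \<in> A0\<close> \<open>(x', y') \<in> A0\<close> by (auto simp: A0_def closure_sequential)
    have "f n + g n \<in> G" for n
      using G_add[of "fst (f n)" "snd (f n)" "fst (g n)" "snd (g n)"] f(1)[of n] g(1)[of n]
      by (simp add: plus_prod_def)
    then show ?thesis
      using tendsto_add[OF f(2) g(2)] unfolding A0_def closure_sequential
      by (intro exI[of _ "\<lambda>n. f n + g n"]) auto
  qed
  have A0_scale: "(c *\<^sub>C x, c *\<^sub>C y) \<in> A0" if xy: "(x, y) \<in> A0" for c x y
  proof -
    obtain f where f: "\<And>n. f n \<in> G" "f \<longlonglongrightarrow> (x, y)"
      using xy by (auto simp: A0_def closure_sequential)
    have "(c *\<^sub>C fst (f n), c *\<^sub>C snd (f n)) \<in> G" for n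
      using f(1)[of n] by (intro G_scale) simp
    moreover have "(\<lambda>n. (c *\<^sub>C fst (f n), c *\<^sub>C snd (f n))) \<longlonglongrightarrow> (c *\<^sub>C x, c *\<^sub>C y)"
      using tendsto_fst[OF f(2)] tendsto_snd[OF f(2)] by (intro tendsto_Pair tendsto_scaleC_right) auto
    ultimately show ?thesis
      unfolding A0_def closure_sequential by (intro exI[of _ "\<lambda>n. (c *\<^sub>C fst (f n), c *\<^sub>C snd (f n))"]) auto
  qed
  have A0_bound: "(\<Sum>k\<in>F. (d k * cmod (cinner (B k) x))\<^sup>2) \<le> (2 * norm y)\<^sup>2"
    if F: "finite F" and xy: "(x, y) \<in> A0" for F x y
  proof -
    have "closure G \<subseteq> {p. (\<Sum>k\<in>F. (d k * cmod (cinner (B k) (fst p)))\<^sup>2) \<le> (2 * norm (snd p))\<^sup>2}"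
    proof (rule closure_minimal)
      show "G \<subseteq> {p. (\<Sum>k\<in>F. (d k * cmod (cinner (B k) (fst p)))\<^sup>2) \<le> (2 * norm (snd p))\<^sup>2}"
        using G_bound[OF F] by force
    qed (intro closed_Collect_le continuous_intros)
    then show ?thesis using xy by (auto simp: A0_def)
  qed
  have A0_norm: "norm x \<le> 2 * norm y" if xy: "(x, y) \<in> A0" for x y
  proof -
    have "(norm x)\<^sup>2 \<le> (2 * norm y)\<^sup>2"
    proof (rule has_sum_le_finite_sums[OF Parseval[OF basis]])
      fix F :: "'k set" assume F: "finite F"
      have "(\<Sum>k\<in>F. (cmod (cinner (B k) x))\<^sup>2) \<le> (\<Sum>k\<in>F. (d k * cmod (cinner (B k) x))\<^sup>2)"
        using mult_right_mono[OF d1 norm_ge_zero, of "cinner (B _) x"] by (intro sum_mono power_mono) simp_all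
      also have "\<dots> \<le> (2 * norm y)\<^sup>2" by (rule A0_bound[OF F xy])
      finally show "(\<Sum>k\<in>F. (cmod (cinner (B k) x))\<^sup>2) \<le> (2 * norm y)\<^sup>2" .
    qed
    then show ?thesis by (rule power2_le_imp_le) simp
  qed
  have A0_A: "(x, y - complex_of_real \<mu> *\<^sub>C x) \<in> A" if xy: "(x, y) \<in> A0" for x y
  proof -
    let ?g = "\<lambda>p. (fst p, snd p - complex_of_real \<mu> *\<^sub>C fst p)"
    have "closed (?g -` A)"
      using A by (intro closed_vimage continuous_intros) (simp add: closed_symmetric_def)
    moreover have "G \<subseteq> ?g -` A"
    proof clarsimp
      fix x y assume "(x, y) \<in> G"
      then obtain K a where K: "finite K" "x = (\<Sum>k\<in>K. a k *\<^sub>C B k)" "y = (\<Sum>k\<in>K. a k *\<^sub>C T k)"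
        by (auto simp: G_def)
      have "y - complex_of_real \<mu> *\<^sub>C x = (\<Sum>k\<in>K. a k *\<^sub>C t k)"
        by (simp add: K T_def scaleC_add_right scaleC_sum_right sum.distrib mult.commute)
      then show "(x, y - complex_of_real \<mu> *\<^sub>C x) \<in> A"
        using closed_symmetric_sum[OF A t] K(2) by simp
    qed
    ultimately have "closure G \<subseteq> ?g -` A" by (intro closure_minimal)
    then show ?thesis using xy by (auto simp: A0_def)
  qed

  \<comment> \<open>Density of the range\<close>
  have dense: "closure (snd ` G) = UNIV"
  proof -
    have ne: "snd ` G \<noteq> {}"
      by (auto simp: G_def intro!: exI[of _ "{}"])
    have "infdist \<phi> (snd ` G) = 0" for \<phi>
    proof (rule ccontr)
      define \<delta> where "\<delta> = infdist \<phi> (snd ` G)"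
      assume "infdist \<phi> (snd ` G) \<noteq> 0"
      then have "\<delta> > 0" using infdist_nonneg[of \<phi> "snd ` G"] by (simp add: \<delta>_def)
      \<comment> \<open>One Neumann step beats the distance \<delta>: with a residual r below 6/5
        \<delta> and a truncation error of \<delta>/5, the correction q satisfies ||r - q|| <
        \<delta>/5 + 1/2 (6/5 + 1/5) \<delta> = 9/10 \<delta>.\<close>
      have "\<exists>w\<in>snd ` G. dist \<phi> w < \<delta> * 6/5"
      proof (rule ccontr)
        assume "\<not> ?thesis"
        then have le: "\<delta> * 6/5 \<le> dist \<phi> w" if "w \<in> snd ` G" for w
          using that by (meson not_less)
        have "\<delta> * 6/5 \<le> infdist \<phi> (snd ` G)"
          using cINF_greatest[OF ne le] ne by (simp only: infdist_def if_False)
        then show False using \<open>\<delta> > 0\<close> by (simp add: \<delta>_def)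
      qed
      then obtain v w where w: "(v, w) \<in> G" "dist \<phi> w < \<delta> * 6/5" by auto
      define r where "r = \<phi> - w"
      obtain K where K: "finite K" "dist (\<Sum>k\<in>K. cinner (B k) r *\<^sub>C B k) r \<le> \<delta>/5"
        using has_sum_finite_approximation[OF basis_expansion[OF basis, of r], of "\<delta>/5"] \<open>\<delta> > 0\<close> by auto
      define p where "p = (\<Sum>k\<in>K. cinner (B k) r *\<^sub>C B k)"
      \<comment> \<open>\<open>q\<close> is the shifted operator applied to the diagonal inverse of
        \<open>p\<close>; hence it lies in the range and within 1/2 ||p|| of
        \<open>p\<close>.\<close>
      define q where "q = (\<Sum>k\<in>K. (cinner (B k) r / complex_of_real (d k)) *\<^sub>C T k)"
      have "q - p = (\<Sum>k\<in>K. (cinner (B k) r / complex_of_real (d k)) *\<^sub>C (T k - complex_of_real (d k) *\<^sub>C B k))"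
        using d0 by (simp add: p_def q_def scaleC_diff_right sum_subtractf less_imp_neq[symmetric])
      moreover have "p = (\<Sum>k\<in>K. (cinner (B k) r / complex_of_real (d k)) *\<^sub>C complex_of_real (d k) *\<^sub>C B k)"
        using d0 by (simp add: p_def less_imp_neq[symmetric])
      ultimately have qp: "norm (q - p) \<le> 1/2 * norm p"
        using rel[OF K(1)] by (simp only: T_def)
      have "norm p \<le> norm r + \<delta>/5"
        using K(2) norm_triangle_sub[of p r] by (simp add: p_def dist_norm)
      moreover have "norm r < \<delta> * 6/5" using w(2) by (simp add: r_def dist_norm)
      moreover have "norm (r - q) \<le> norm (r - p) + norm (q - p)"
        using norm_triangle_ineq4[of "r - p" "q - p"] by simp
      moreover have "norm (r - p) \<le> \<delta>/5"
        using K(2) by (simp add: p_def dist_norm norm_minus_commute)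
      ultimately have "norm (r - q) < \<delta>"
        using qp \<open>\<delta> > 0\<close> by linarith
      moreover have "w + q \<in> snd ` G"
      proof -
        have "(\<Sum>k\<in>K. (cinner (B k) r / complex_of_real (d k)) *\<^sub>C B k, q) \<in> G"
          unfolding q_def G_def
            using K(1) by (intro CollectI exI[of _ K] exI[of _ "\<lambda>k. cinner (B k) r / complex_of_real (d k)"]) simp
        from G_add[OF w(1) this] show ?thesis by force
      qed
      then have "\<delta> \<le> dist \<phi> (w + q)"
        unfolding \<delta>_def by (rule infdist_le)
      ultimately show False
        by (simp add: r_def dist_norm algebra_simps)
    qed
    then show ?thesis
      using in_closure_iff_infdist_zero[OF ne] by auto
  qed

  \<comment> \<open>The inverse: bounded, symmetric, compact\<close>
  have onto: "\<exists>x. (x, \<phi>) \<in> A0" for \<phi>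
  proof -
    have "\<phi> \<in> closure (snd ` G)" by (simp add: dense)
    then obtain y where y: "\<And>n. y n \<in> snd ` G" "y \<longlonglongrightarrow> \<phi>"
      unfolding closure_sequential by blast
    then have "\<forall>n. \<exists>x. (x, y n) \<in> G" by force
    then obtain x where x: "\<And>n. (x n, y n) \<in> G" by metis
    \<comment> \<open>The lower bound on the operator turns convergence of the images into
      convergence of the preimages.\<close>
    have xy: "norm (x m - x n) \<le> 2 * norm (y m - y n)" for m n
    proof -
      have "(x m + (-1) *\<^sub>C x n, y m + (-1) *\<^sub>C y n) \<in> G"
        by (intro G_add G_scale x)
      then show ?thesis
        using A0_norm closure_subset[of G] unfolding A0_def by (auto simp: scaleC_minus_left)
    qed
    have "Cauchy x"
    proof (rule metric_CauchyI)
      fix \<epsilon> :: real assume "\<epsilon> > 0"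
      then obtain N where N: "\<And>m n. m \<ge> N \<Longrightarrow> n \<ge> N \<Longrightarrow> dist (y m) (y n) < \<epsilon>/2"
        using metric_CauchyD[OF LIMSEQ_imp_Cauchy[OF y(2)], of "\<epsilon>/2"] by auto
      have "dist (x m) (x n) < \<epsilon>" if "m \<ge> N" "n \<ge> N" for m n
        using N[OF that] xy[of m n] by (simp add: dist_norm)
      then show "\<exists>N. \<forall>m\<ge>N. \<forall>n\<ge>N. dist (x m) (x n) < \<epsilon>" by blast
    qed
    then obtain z where "x \<longlonglongrightarrow> z"
      using convergent_eq_Cauchy by blast
    then have "(\<lambda>n. (x n, y n)) \<longlonglongrightarrow> (z, \<phi>)"
      using y(2) by (rule tendsto_Pair)
    then show ?thesis
      using x unfolding A0_def closure_sequential
      by (intro exI[of _ z] exI[of _ "\<lambda>n. (x n, y n)"]) simp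
  qed
  have unique: "x = x'" if "(x, \<phi>) \<in> A0" "(x', \<phi>) \<in> A0" for x x' \<phi>
    using A0_norm[OF A0_add[OF that(1) A0_scale[OF that(2), of "-1"]]] by (simp add: scaleC_minus_left)
  define R where "R \<phi> = (SOME x. (x, \<phi>) \<in> A0)" for \<phi>
  have R: "(R \<phi>, \<phi>) \<in> A0" for \<phi>
    unfolding R_def using onto by (rule someI_ex)
  have R_eq: "R \<phi> = x" if "(x, \<phi>) \<in> A0" for x \<phi>
    using unique R that by blast
  have R_add: "R (x + y) = R x + R y" for x y
    by (intro R_eq A0_add R)
  have R_scale: "R (c *\<^sub>C x) = c *\<^sub>C R x" for c x
    by (intro R_eq A0_scale R)
  have symA: "cinner u y = cinner x v" if "(x, u) \<in> A" "(y, v) \<in> A" for x u y v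
    using A that unfolding closed_symmetric_def by blast
  have R_sym: "cinner (R x) y = cinner x (R y)" for x y
    using symA[OF A0_A[OF R[of x]] A0_A[OF R[of y]]] by (simp add: cinner_diff_left cinner_diff_right)
  \<comment> \<open>If R x = 0, then x is an image of 0 under the closure; symmetry against (B k, t
    k) makes every coefficient <B k, x> vanish.\<close>
  have R_inj: "x = 0" if "R x = 0" for x
  proof (rule basis_eqI[OF basis])
    fix k
    show "cinner (B k) x = cinner (B k) 0"
      using symA[OF t[of k] A0_A[OF R[of x]]] that by simp
  qed
  have R_bound: "norm (R x) \<le> 2 * norm x" for x
    by (rule A0_norm[OF R])
  let ?S = "{x. \<forall>K. finite K \<longrightarrow> (\<Sum>k\<in>K. (d k * cmod (cinner (B k) x))\<^sup>2) \<le> 2\<^sup>2}"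
  have S: "compact ?S"
    by (rule compact_weighted_coefficients[OF basis d0 fin]) simp
  have R_S: "R x \<in> ?S" if "norm x \<le> 1" for x
  proof clarify
    fix K :: "'k set" assume "finite K"
    have "(\<Sum>k\<in>K. (d k * cmod (cinner (B k) (R x)))\<^sup>2) \<le> (2 * norm x)\<^sup>2"
      by (rule A0_bound[OF \<open>finite K\<close> R])
    also have "\<dots> \<le> 2\<^sup>2" using that by (intro power_mono) auto
    finally show "(\<Sum>k\<in>K. (d k * cmod (cinner (B k) (R x)))\<^sup>2) \<le> 2\<^sup>2" .
  qed

  \<comment> \<open>A maximal orthonormal set of eigenvectors\<close>
  define \<O> where "\<O> = {S. (\<forall>v\<in>S. norm v = 1 \<and> (\<exists>r. r \<noteq> 0 \<and> R v = complex_of_real r *\<^sub>C v)) \<and>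
    (\<forall>v\<in>S. \<forall>w\<in>S. v \<noteq> w \<longrightarrow> cinner v w = 0)}"
  have "\<exists>M\<in>\<O>. \<forall>X\<in>\<O>. M \<subseteq> X \<longrightarrow> X = M"
  proof (rule subset_Zorn')
    fix C assume C: "subset.chain \<O> C"
    then have "\<And>X. X \<in> C \<Longrightarrow> X \<in> \<O>" and chain: "\<And>X Y. X \<in> C \<Longrightarrow> Y \<in> C \<Longrightarrow> X \<subseteq> Y \<or> Y \<subseteq> X"
      by (auto simp: subset_chain_def)
    then have 1: "\<And>X v. X \<in> C \<Longrightarrow> v \<in> X \<Longrightarrow> norm v = 1 \<and> (\<exists>r. r \<noteq> 0 \<and> R v = complex_of_real r *\<^sub>C v)"
      and 2: "\<And>X v w. X \<in> C \<Longrightarrow> v \<in> X \<Longrightarrow> w \<in> X \<Longrightarrow> v \<noteq> w \<Longrightarrow> cinner v w = 0"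
      unfolding \<O>_def by blast+
    show "\<Union>C \<in> \<O>"
      unfolding \<O>_def
    proof (intro CollectI conjI ballI impI)
      fix v w assume "v \<in> \<Union>C" "w \<in> \<Union>C" "v \<noteq> w"
      then obtain X Y where "X \<in> C" "v \<in> X" "Y \<in> C" "w \<in> Y" by blast
      then show "cinner v w = 0"
        using chain[of X Y] 2[of X v w] 2[of Y v w] \<open>v \<noteq> w\<close> by blast
    qed (use 1 in blast)+
  qed
  then obtain M where "M \<in> \<O>" and max: "\<And>X. X \<in> \<O> \<Longrightarrow> M \<subseteq> X \<Longrightarrow> X = M" by blast
  then have M1: "\<And>v. v \<in> M \<Longrightarrow> norm v = 1" and "\<forall>v\<in>M. \<exists>r. r \<noteq> 0 \<and> R v = complex_of_real r *\<^sub>C v"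
    and Morth: "\<And>v w. v \<in> M \<Longrightarrow> w \<in> M \<Longrightarrow> v \<noteq> w \<Longrightarrow> cinner v w = 0"
    unfolding \<O>_def by blast+
  then obtain r where r: "\<And>v. v \<in> M \<Longrightarrow> r v \<noteq> 0" "\<And>v. v \<in> M \<Longrightarrow> R v = complex_of_real (r v) *\<^sub>C v"
    by metis
  have total: "x0 = 0" if "\<And>v. v \<in> M \<Longrightarrow> cinner v x0 = 0" for x0
  proof (rule ccontr)
    assume "x0 \<noteq> 0"
    let ?V = "{x. \<forall>v. v \<in> M \<longrightarrow> cinner v x = 0}"
    have "closed {x. v \<in> M \<longrightarrow> cinner v x = 0}" for v
      by (cases "v \<in> M") (auto intro!: closed_Collect_eq continuous_intros)
    then have V: "closed ?V" by (rule closed_Collect_all)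
    have RV: "R x \<in> ?V" if "x \<in> ?V" for x
    proof clarify
      fix v assume v: "v \<in> M"
      have "cinner v (R x) = cinner (R v) x" by (simp add: R_sym)
      then show "cinner v (R x) = 0" using that v by (simp add: r)
    qed
    have V_add: "x + y \<in> ?V" if "x \<in> ?V" "y \<in> ?V" for x y
      using that by (auto simp: cinner_add_right)
    have V_scale: "c *\<^sub>C x \<in> ?V" if "x \<in> ?V" for x c
      using that by auto
    have x0: "x0 \<in> ?V"
      using that by auto
    obtain v \<rho> where v: "v \<in> ?V" "norm v = 1" "\<rho> \<noteq> 0" "R v = complex_of_real \<rho> *\<^sub>C v"
      by (rule compact_self_adjoint_eigenvector[OF R_add R_scale R_sym R_inj R_bound S R_S V V_add V_scale RV x0 \<open>x0 \<noteq> 0\<close>])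
    have "cinner w v = 0 \<and> cinner v w = 0" if "w \<in> M" for w
      using v(1) that cinner_commute[of v w] by auto
    then have "insert v M \<in> \<O>"
      using \<open>M \<in> \<O>\<close> v unfolding \<O>_def by auto
    then have "v \<in> M" using max[of "insert v M"] by blast
    then have "cinner v v = 0" using v(1) by blast
    then show False using v(2) by (simp add: cinner_self)
  qed
  \<comment> \<open>The eigenvectors index themselves, with 0 outside \<open>M\<close>; the
    eigenvalue r of the inverse becomes 1/r - \<mu> for \<open>A\<close>.\<close>
  define e where "e v = (if v \<in> M then v else 0)" for v
  define l where "l v = 1 / r v - \<mu>" for v
  have "hilbert_basis e"
    unfolding hilbert_basis_def
  proof (intro conjI allI impI)
    fix x assume x: "\<forall>v. cinner (e v) x = 0"
    show "x = 0"
    proof (rule total)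
      fix v assume "v \<in> M"
      then show "cinner v x = 0" using x[rule_format, of v] by (simp add: e_def)
    qed
  qed (auto simp: e_def M1 Morth)
  moreover have "(e v, complex_of_real (l v) *\<^sub>C e v) \<in> A" for v
  proof (cases "v \<in> M")
    case True
    have "(R v, v - complex_of_real \<mu> *\<^sub>C R v) \<in> A"
      by (rule A0_A[OF R])
    then have "(complex_of_real (1 / r v) *\<^sub>C R v, complex_of_real (1 / r v) *\<^sub>C (v - complex_of_real \<mu> *\<^sub>C R v)) \<in> A"
      using A unfolding closed_symmetric_def by blast
    then show ?thesis
      using True r by (simp add: e_def l_def scaleC_diff_right scaleC_diff_left)
  qed (use A in \<open>auto simp: e_def closed_symmetric_def\<close>)
  ultimately have "eigenbasis e l A"
    by (intro eigenbasisI[OF A])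
  then show thesis by (rule that)
qed

section \<open>Schwartz functions\<close>

lemma vderiv_eqI: "(\<And>x. (f has_vector_derivative g x) (at x)) \<Longrightarrow> vderiv f = g"
  unfolding vderiv_def by (auto intro: vector_derivative_at)

lemma schwartz_vderiv: "f \<in> schwartz \<Longrightarrow> vderiv f \<in> schwartz"
proof -
  assume f: "f \<in> schwartz"
  have "(vderiv ^^ n) (vderiv f) = (vderiv ^^ Suc n) f" for n
    by (simp add: funpow_swap1)
  then show ?thesis
    using f unfolding schwartz_def by (auto simp del: funpow.simps)
qed

lemma schwartz_has_vderiv: "f \<in> schwartz \<Longrightarrow> (f has_vector_derivative vderiv f x) (at x)"
proof -
  assume "f \<in> schwartz"
  then have "(vderiv ^^ 0) f differentiable (at x)"
    unfolding schwartz_def by blast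
  then show ?thesis
    by (simp add: vderiv_def vector_derivative_works)
qed

lemma schwartz_bounded: "f \<in> schwartz \<Longrightarrow> bounded (range (\<lambda>x. complex_of_real x ^ k * f x))"
proof -
  assume "f \<in> schwartz"
  then have "bounded (range (\<lambda>x. complex_of_real x ^ k * (vderiv ^^ 0) f x))"
    unfolding schwartz_def by blast
  then show ?thesis by simp
qed

text \<open>The definition of \<open>schwartz\<close> quantifies over all derivatives. Exhibiting a
  class that is stable under \<open>vderiv\<close> and whose members are differentiable and rapidly
  decreasing replaces an induction on n in each closure property.\<close>

lemma schwartz_coinduct:
  assumes f: "f \<in> C"
    and C: "\<And>f x. f \<in> C \<Longrightarrow> f differentiable (at x)" "\<And>f. f \<in> C \<Longrightarrow> vderiv f \<in> C"
      "\<And>f k. f \<in> C \<Longrightarrow> bounded (range (\<lambda>x. complex_of_real x ^ k * f x))"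
  shows "f \<in> schwartz"
proof -
  have "(vderiv ^^ n) f \<in> C" for n
    using f by (induction n) (auto intro: C)
  then show ?thesis
    unfolding schwartz_def using C by blast
qed

lemma schwartz_differentiable: "f \<in> schwartz \<Longrightarrow> f differentiable (at x)"
  using schwartz_has_vderiv by (metis differentiableI_vector)

lemma vderiv_add: "f \<in> schwartz \<Longrightarrow> g \<in> schwartz \<Longrightarrow> vderiv (\<lambda>x. f x + g x) = (\<lambda>x. vderiv f x + vderiv g x)"
  by (intro vderiv_eqI has_vector_derivative_add schwartz_has_vderiv)

lemma vderiv_cmult: "f \<in> schwartz \<Longrightarrow> vderiv (\<lambda>x. c * f x) = (\<lambda>x. c * vderiv f x)"
  by (intro vderiv_eqI has_vector_derivative_mult_right schwartz_has_vderiv)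

lemma schwartz_add: "f \<in> schwartz \<Longrightarrow> g \<in> schwartz \<Longrightarrow> (\<lambda>x. f x + g x) \<in> schwartz"
proof (rule schwartz_coinduct[where C = "{\<lambda>x. f x + g x | f g. f \<in> schwartz \<and> g \<in> schwartz}"], goal_cases)
  case 1
  then show ?case by blast
next
  case (2 f x)
  then show ?case
    using differentiable_add[OF schwartz_differentiable schwartz_differentiable] by blast
next
  case (3 f)
  then show ?case using vderiv_add schwartz_vderiv by blast
next
  case (4 f k)
  then obtain g h where g: "f = (\<lambda>x. g x + h x)" "g \<in> schwartz" "h \<in> schwartz" by blast
  have "bounded (range (\<lambda>x. complex_of_real x ^ k * g x + complex_of_real x ^ k * h x))"
    by (intro bounded_plus_comp schwartz_bounded g)
  then show ?case by (simp add: g distrib_left)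
qed

lemma schwartz_cmult: "f \<in> schwartz \<Longrightarrow> (\<lambda>x. c * f x) \<in> schwartz"
proof (rule schwartz_coinduct[where C = "{\<lambda>x. c * f x | f. f \<in> schwartz}"], goal_cases)
  case 1
  then show ?case by blast
next
  case (2 f x)
  then show ?case by (auto intro: schwartz_differentiable)
next
  case (3 f)
  then show ?case using vderiv_cmult schwartz_vderiv by blast
next
  case (4 f k)
  then obtain g where g: "f = (\<lambda>x. c * g x)" "g \<in> schwartz" by blast
  have "bounded ((\<lambda>z. c * z) ` range (\<lambda>x. complex_of_real x ^ k * g x))"
    by (intro bounded_linear_image bounded_linear_mult_right schwartz_bounded g)
  then show ?case by (simp add: g image_image mult_ac)
qed

text \<open>The derivative of x f is x f' + f, so the stable class has to consist of sums x f +
  g.\<close>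

lemma schwartz_xmult: "f \<in> schwartz \<Longrightarrow> (\<lambda>x. complex_of_real x * f x) \<in> schwartz"
proof (rule schwartz_coinduct[where C = "{\<lambda>x. complex_of_real x * f x + g x | f g. f \<in> schwartz \<and> g \<in> schwartz}"], goal_cases)
  case 1
  have "(\<lambda>x. 0) \<in> schwartz" using schwartz_cmult[OF 1, of 0] by simp
  then show ?case using 1 by (intro CollectI exI[of _ f] exI[of _ "\<lambda>x. 0"]) simp
next
  have deriv: "((\<lambda>x. complex_of_real x * g x + h x) has_vector_derivative
      complex_of_real x * vderiv g x + (g x + vderiv h x)) (at x)" if "g \<in> schwartz" "h \<in> schwartz" for g h x
    using that by (auto intro!: derivative_eq_intros schwartz_has_vderiv)
  {
    case (2 f x)
    then show ?case using deriv by (auto intro: differentiableI_vector)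
  next
    case (3 f)
    then obtain g h where g: "f = (\<lambda>x. complex_of_real x * g x + h x)" "g \<in> schwartz" "h \<in> schwartz" by blast
    have "vderiv f = (\<lambda>x. complex_of_real x * vderiv g x + (g x + vderiv h x))"
      unfolding g(1) by (rule vderiv_eqI) (rule deriv[OF g(2,3)])
    then show ?case
      using g(2,3) by (intro CollectI exI[of _ "vderiv g"] exI[of _ "\<lambda>x. g x + vderiv h x"])
        (auto intro: schwartz_vderiv schwartz_add)
  next
    case (4 f k)
    then obtain g h where g: "f = (\<lambda>x. complex_of_real x * g x + h x)" "g \<in> schwartz" "h \<in> schwartz" by blast
    have "bounded (range (\<lambda>x. complex_of_real x ^ Suc k * g x + complex_of_real x ^ k * h x))"
      by (intro bounded_plus_comp schwartz_bounded g)
    then show ?case by (simp add: g algebra_simps)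
  }
qed

section \<open>The Gaussian as a Schwartz function\<close>

lemma exp_ge_power_fact: "(y::real) ^ n / fact n \<le> exp y" if "y \<ge> 0"
proof -
  have s: "(\<lambda>i. y ^ i /\<^sub>R fact i) sums exp y" by (rule exp_converges)
  have "sum (\<lambda>i. y ^ i /\<^sub>R fact i) {n} \<le> suminf (\<lambda>i. y ^ i /\<^sub>R fact i)"
    by (rule sum_le_suminf) (use that sums_summable[OF s] in auto)
  then show ?thesis
    using sums_unique[OF s] by (simp add: divide_inverse mult.commute)
qed

text \<open>The detour through |x|^(2 n) makes the power even: 2^n (x^2/2)^n is at most 2^n n!
  exp(x^2/2) by a single term of the exponential series.\<close>

lemma power_gaussian_bound: "\<bar>x\<bar> ^ n * exp (- x\<^sup>2 / 2) \<le> 1 + 2 ^ n * fact n" for x :: real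
proof -
  have "\<bar>x\<bar> ^ n \<le> 1 + \<bar>x\<bar> ^ (2 * n)"
  proof (cases "\<bar>x\<bar> \<le> 1")
    case True
    then show ?thesis by (smt (verit) power_le_one abs_ge_zero zero_le_power)
  next
    case False
    then have "\<bar>x\<bar> ^ n \<le> \<bar>x\<bar> ^ (2 * n)" by (intro power_increasing) auto
    then show ?thesis by linarith
  qed
  then have "\<bar>x\<bar> ^ n * exp (- x\<^sup>2 / 2) \<le> (1 + \<bar>x\<bar> ^ (2 * n)) * exp (- x\<^sup>2 / 2)"
    by (rule mult_right_mono) simp
  also have "\<bar>x\<bar> ^ (2 * n) = 2 ^ n * ((x\<^sup>2 / 2) ^ n)"
    by (simp add: power_mult power_divide)
  also have "(1 + 2 ^ n * ((x\<^sup>2 / 2) ^ n)) * exp (- x\<^sup>2 / 2) \<le> (1 + 2 ^ n * (fact n * exp (x\<^sup>2 / 2))) * exp (- x\<^sup>2 / 2)"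
    using exp_ge_power_fact[of "x\<^sup>2 / 2" n]
    by (intro mult_right_mono add_left_mono mult_left_mono) (auto simp: field_simps)
  also have "\<dots> = exp (- x\<^sup>2 / 2) + 2 ^ n * fact n"
    by (simp add: algebra_simps flip: exp_add)
  also have "\<dots> \<le> 1 + 2 ^ n * fact n" by simp
  finally show ?thesis .
qed

definition gaussian :: "real \<Rightarrow> complex" where
  "gaussian x = complex_of_real (exp (- x\<^sup>2 / 2))"

lemma has_vderiv_gaussian: "(gaussian has_vector_derivative - complex_of_real x * gaussian x) (at x)"
proof -
  have "((\<lambda>x. exp (- x\<^sup>2 / 2)) has_real_derivative - x * exp (- x\<^sup>2 / 2)) (at x)"
    by (auto intro!: derivative_eq_intros)
  from has_vector_derivative_of_real[OF this] show ?thesis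
    unfolding gaussian_def by simp
qed

text \<open>The class of polynomial multiples of the Gaussian is stable: differentiation replaces
  the polynomial p by p' - x p.\<close>

lemma gaussian_schwartz: "gaussian \<in> schwartz"
proof (rule schwartz_coinduct[where C = "{\<lambda>x. poly p (complex_of_real x) * gaussian x | p. True}"], goal_cases)
  case 1
  show ?case by (intro CollectI exI[of _ 1]) auto
next
  have deriv: "((\<lambda>x. poly p (complex_of_real x) * gaussian x) has_vector_derivative
    poly (pderiv p - [:0, 1:] * p) (complex_of_real x) * gaussian x) (at x)" for p x
  proof -
    have id: "(complex_of_real has_vector_derivative 1) (at x)"
      by (rule has_vector_derivative_of_real[OF DERIV_ident, simplified])
    have "((\<lambda>x. poly p (complex_of_real x)) has_vector_derivative poly (pderiv p) (complex_of_real x)) (at x)"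
      using field_vector_diff_chain_at[of complex_of_real 1 x "poly p" "poly (pderiv p) (complex_of_real x)"]
        id poly_DERIV[of p "complex_of_real x"]
      by (simp add: o_def)
    from has_vector_derivative_mult[OF this has_vderiv_gaussian] show ?thesis
      by (simp add: algebra_simps)
  qed
  {
    case (2 f x)
    then show ?case using deriv by (auto intro: differentiableI_vector)
  next
    case (3 f)
    then obtain p where f: "f = (\<lambda>x. poly p (complex_of_real x) * gaussian x)" by blast
    show ?case
      using vderiv_eqI[OF deriv, of p] unfolding f
      by (intro CollectI exI[of _ "pderiv p - [:0, 1:] * p"]) simp
  next
    case (4 f k)
    then obtain p where f: "f = (\<lambda>x. poly p (complex_of_real x) * gaussian x)" by blast
    have "bounded (range (\<lambda>x. complex_of_real x ^ k * (poly p (complex_of_real x) * gaussian x)))"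
    proof (induction p arbitrary: k)
      case (pCons a p)
      have "bounded (range (\<lambda>x. complex_of_real x ^ k * gaussian x))"
        using power_gaussian_bound[of _ k]
        by (intro boundedI[where B = "1 + 2 ^ k * fact k"]) (auto simp: gaussian_def norm_mult norm_power)
      from bounded_linear_image[OF this bounded_linear_mult_right[of a]]
      have "bounded (range (\<lambda>x. a * (complex_of_real x ^ k * gaussian x)))"
        by (simp add: image_image)
      from bounded_plus_comp[OF this pCons.IH[of "Suc k"]]
      show ?case by (simp add: algebra_simps)
    qed (simp add: image_constant_conv)
    then show ?case by (simp add: f)
  }
qed

section \<open>Decay, square integrability and integration by parts\<close>

lemma schwartz_decay:
  assumes "f \<in> schwartz"
  obtains C where "C \<ge> 0" "\<And>x. norm (f x) \<le> C / (1 + x\<^sup>2)"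
proof -
  obtain a b where a: "\<And>x. norm (complex_of_real x ^ 0 * f x) \<le> a"
    and b: "\<And>x. norm (complex_of_real x ^ 2 * f x) \<le> b"
    using schwartz_bounded[OF assms, of 0] schwartz_bounded[OF assms, of 2]
    unfolding bounded_iff by blast
  have "norm (f x) \<le> (a + b) / (1 + x\<^sup>2)" for x
  proof -
    have "norm (f x) * (1 + x\<^sup>2) \<le> a + b"
      using a[of x] b[of x] by (simp add: norm_mult norm_power algebra_simps)
    then show ?thesis by (simp add: pos_le_divide_eq add_pos_nonneg)
  qed
  moreover have "a + b \<ge> 0"
    using a[of 0] b[of 0] norm_ge_zero order_trans by (metis add_nonneg_nonneg)
  ultimately show ?thesis using that by blast
qed

lemma schwartz_continuous: "f \<in> schwartz \<Longrightarrow> isCont f x"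
  using schwartz_has_vderiv has_vector_derivative_continuous by blast

lemma schwartz_measurable: "f \<in> schwartz \<Longrightarrow> f \<in> borel_measurable borel"
  by (intro borel_measurable_continuous_onI continuous_at_imp_continuous_on) (auto simp: schwartz_continuous)

lemma integrable_inverse_one_plus_square: "integrable lborel (\<lambda>x::real. 1 / (1 + x\<^sup>2))"
  using integrable_inverse_1_plus_square
  by (simp add: set_integrable_def einterval_def inverse_eq_divide)

lemma schwartz_tendsto_0:
  assumes "f \<in> schwartz"
  shows "(f \<longlongrightarrow> 0) at_top" "(f \<longlongrightarrow> 0) at_bot"
proof -
  obtain C where C: "\<And>x. norm (f x) \<le> C / (1 + x\<^sup>2)" using schwartz_decay[OF assms] by blast
  have "((\<lambda>x::real. C / (1 + x\<^sup>2)) \<longlongrightarrow> 0) at_top" by real_asymp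
  then show "(f \<longlongrightarrow> 0) at_top" by (rule Lim_null_comparison[rotated]) (simp add: C)
  have "((\<lambda>x::real. C / (1 + x\<^sup>2)) \<longlongrightarrow> 0) at_bot" by real_asymp
  then show "(f \<longlongrightarrow> 0) at_bot" by (rule Lim_null_comparison[rotated]) (simp add: C)
qed

lemma schwartz_square_integrable:
  assumes "f \<in> schwartz"
  shows "integrable lborel (\<lambda>x. (norm (f x))\<^sup>2)"
proof -
  obtain C where C: "C \<ge> 0" "\<And>x. norm (f x) \<le> C / (1 + x\<^sup>2)" using schwartz_decay[OF assms] by blast
  have [measurable]: "f \<in> borel_measurable borel" by (rule schwartz_measurable[OF assms])
  show ?thesis
  proof (rule Bochner_Integration.integrable_bound)
    show "integrable lborel (\<lambda>x::real. C\<^sup>2 * (1 / (1 + x\<^sup>2)))"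
      by (intro integrable_mult_right integrable_inverse_one_plus_square)
    have "(norm (f x))\<^sup>2 \<le> C\<^sup>2 * (1 / (1 + x\<^sup>2))" for x
    proof -
      have "(norm (f x))\<^sup>2 \<le> (C / (1 + x\<^sup>2))\<^sup>2"
        by (intro power_mono C) auto
      also have "\<dots> = C\<^sup>2 * (1 / (1 + x\<^sup>2) * (1 / (1 + x\<^sup>2)))"
        by (simp add: power2_eq_square)
      also have "\<dots> \<le> C\<^sup>2 * (1 * (1 / (1 + x\<^sup>2)))"
        by (intro mult_left_mono mult_right_mono) (auto simp: divide_le_eq_1 add_pos_nonneg)
      finally show ?thesis by simp
    qed
    then show "AE x in lborel. norm ((norm (f x))\<^sup>2) \<le> norm (C\<^sup>2 * (1 / (1 + x\<^sup>2)))"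
      by (auto intro!: AE_I2)
  qed measurable
qed

lemma integrable_cnj_mult:
  fixes f g :: "real \<Rightarrow> complex"
  assumes [measurable]: "f \<in> borel_measurable borel" "g \<in> borel_measurable borel"
    and f: "integrable lborel (\<lambda>x. (norm (f x))\<^sup>2)" and g: "integrable lborel (\<lambda>x. (norm (g x))\<^sup>2)"
  shows "integrable lborel (\<lambda>x. cnj (f x) * g x)"
proof (rule Bochner_Integration.integrable_bound)
  have [measurable]: "(\<lambda>x. cnj (f x)) \<in> borel_measurable borel"
    by (rule borel_measurable_continuous_on[where f = cnj]) (auto intro: continuous_intros)
  show "(\<lambda>x. cnj (f x) * g x) \<in> borel_measurable lborel"
    by measurable
  show "integrable lborel (\<lambda>x. (norm (f x))\<^sup>2 + (norm (g x))\<^sup>2)"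
    using f g by simp
  have "norm (f x) * norm (g x) \<le> (norm (f x))\<^sup>2 + (norm (g x))\<^sup>2" for x
    using sum_squares_bound[of "norm (f x)" "norm (g x)"] mult_nonneg_nonneg[OF norm_ge_zero norm_ge_zero, of "f x" "g x"]
    unfolding mult.assoc by linarith
  then show "AE x in lborel. norm (cnj (f x) * g x) \<le> norm ((norm (f x))\<^sup>2 + (norm (g x))\<^sup>2)"
    by (auto intro!: AE_I2 simp: norm_mult)
qed

text \<open>The scalar pairing lives on functions instead of classes in \<open>l2\<close>, so that
  \<open>annih\<close> and \<open>creat\<close> can be moved across it.\<close>

definition ip :: "(real \<Rightarrow> complex) \<Rightarrow> (real \<Rightarrow> complex) \<Rightarrow> complex" where
  "ip f g = (LINT x|lborel. cnj (f x) * g x)"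

lemma schwartz_integrable: "f \<in> schwartz \<Longrightarrow> g \<in> schwartz \<Longrightarrow> integrable lborel (\<lambda>x. cnj (f x) * g x)"
  by (intro integrable_cnj_mult schwartz_measurable schwartz_square_integrable)

lemma ip_add_right: "f \<in> schwartz \<Longrightarrow> g \<in> schwartz \<Longrightarrow> h \<in> schwartz \<Longrightarrow> ip f (\<lambda>x. g x + h x) = ip f g + ip f h"
  unfolding ip_def by (simp add: distrib_left schwartz_integrable)

lemma ip_cmult_right: "ip f (\<lambda>x. c * g x) = c * ip f g"
  unfolding ip_def by (simp add: mult.left_commute[of _ c])

lemma ip_commute: "ip f g = cnj (ip g f)"
proof -
  have "cnj (ip g f) = (LINT x|lborel. cnj (cnj (g x) * f x))"
    unfolding ip_def by (rule Bochner_Integration.integral_cnj[symmetric])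
  then show ?thesis by (simp add: ip_def mult.commute)
qed

lemma ip_add_left: "f \<in> schwartz \<Longrightarrow> g \<in> schwartz \<Longrightarrow> h \<in> schwartz \<Longrightarrow> ip (\<lambda>x. g x + h x) f = ip g f + ip h f"
  by (subst (1 2 3) ip_commute) (simp add: ip_add_right)

lemma ip_cmult_left: "ip (\<lambda>x. c * g x) f = cnj c * ip g f"
  by (subst (1 2) ip_commute) (simp add: ip_cmult_right)

lemma ip_xmult: "ip f (\<lambda>x. complex_of_real x * g x) = ip (\<lambda>x. complex_of_real x * f x) g"
  unfolding ip_def by (simp add: mult_ac)

text \<open>The product tends to 0 at both ends by Schwartz decay, so the integral of its derivative
  vanishes.\<close>

lemma ip_vderiv:
  assumes f: "f \<in> schwartz" and g: "g \<in> schwartz"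
  shows "ip f (vderiv g) = - ip (vderiv f) g"
proof -
  let ?F = "\<lambda>x. cnj (f x) * g x" and ?F' = "\<lambda>x. cnj (f x) * vderiv g x + cnj (vderiv f x) * g x"
  have int: "integrable lborel (\<lambda>x. cnj (f x) * vderiv g x)" "integrable lborel (\<lambda>x. cnj (vderiv f x) * g x)"
    by (intro schwartz_integrable schwartz_vderiv f g)+
  have lim: "(?F \<longlongrightarrow> 0) at_top" "(?F \<longlongrightarrow> 0) at_bot"
    using tendsto_mult[OF tendsto_cnj[OF schwartz_tendsto_0(1)[OF f]] schwartz_tendsto_0(1)[OF g]]
      tendsto_mult[OF tendsto_cnj[OF schwartz_tendsto_0(2)[OF f]] schwartz_tendsto_0(2)[OF g]] by simp_all
  have "(LBINT x=-\<infinity>..\<infinity>. ?F' x) = 0 - 0"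
  proof (rule interval_integral_FTC_integrable)
    show "(?F has_vector_derivative ?F' x) (at x)" for x
      by (intro has_vector_derivative_mult has_vector_derivative_cnj schwartz_has_vderiv f g)
    show "isCont ?F' x" for x
      by (intro continuous_intros schwartz_continuous schwartz_vderiv f g)
    show "set_integrable lborel (einterval (- \<infinity>) \<infinity>) ?F'"
      using int by (simp add: set_integrable_def einterval_def)
    show "((?F \<circ> real_of_ereal) \<longlongrightarrow> 0) (at_right (-\<infinity>))" "((?F \<circ> real_of_ereal) \<longlongrightarrow> 0) (at_left \<infinity>)"
      using lim by (simp_all add: ereal_tendsto_simps)
  qed simp
  then have "(LINT x|lborel. ?F' x) = 0"
    by (simp add: interval_lebesgue_integral_def set_lebesgue_integral_def einterval_def)
  then have "ip f (vderiv g) + ip (vderiv f) g = 0"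
    unfolding ip_def using int by simp
  then show ?thesis by (simp add: add_eq_0_iff)
qed

section \<open>Ladder operators on Schwartz functions\<close>

lemma annih_eq: "annih f = (\<lambda>x. complex_of_real (1 / sqrt 2) * (complex_of_real x * f x + vderiv f x))"
  unfolding annih_def scaleR_conv_of_real ..

lemma creat_eq: "creat f = (\<lambda>x. complex_of_real (1 / sqrt 2) * (complex_of_real x * f x + (-1) * vderiv f x))"
  unfolding creat_def scaleR_conv_of_real by simp

lemma schwartz_annih: "f \<in> schwartz \<Longrightarrow> annih f \<in> schwartz"
  unfolding annih_eq by (intro schwartz_cmult schwartz_add schwartz_xmult schwartz_vderiv)

lemma schwartz_creat: "f \<in> schwartz \<Longrightarrow> creat f \<in> schwartz"
  unfolding creat_eq by (intro schwartz_cmult schwartz_add schwartz_xmult schwartz_vderiv)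

lemma annih_add: "f \<in> schwartz \<Longrightarrow> g \<in> schwartz \<Longrightarrow> annih (\<lambda>x. f x + g x) = (\<lambda>x. annih f x + annih g x)"
  unfolding annih_eq by (simp add: vderiv_add algebra_simps)

lemma creat_add: "f \<in> schwartz \<Longrightarrow> g \<in> schwartz \<Longrightarrow> creat (\<lambda>x. f x + g x) = (\<lambda>x. creat f x + creat g x)"
  unfolding creat_eq by (simp add: vderiv_add algebra_simps add_divide_distrib)

lemma annih_cmult: "f \<in> schwartz \<Longrightarrow> annih (\<lambda>x. c * f x) = (\<lambda>x. c * annih f x)"
  unfolding annih_eq by (simp add: vderiv_cmult algebra_simps)

lemma creat_cmult: "f \<in> schwartz \<Longrightarrow> creat (\<lambda>x. c * f x) = (\<lambda>x. c * creat f x)"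
  unfolding creat_eq by (simp add: vderiv_cmult algebra_simps)

lemma ip_annih: "f \<in> schwartz \<Longrightarrow> g \<in> schwartz \<Longrightarrow> ip f (annih g) = ip (creat f) g"
  unfolding annih_eq creat_eq
  by (simp only: ip_cmult_right ip_cmult_left ip_add_right ip_add_left schwartz_xmult schwartz_vderiv
      schwartz_cmult ip_xmult ip_vderiv) simp

lemma ip_creat: "f \<in> schwartz \<Longrightarrow> g \<in> schwartz \<Longrightarrow> ip f (creat g) = ip (annih f) g"
  by (subst (1 2) ip_commute) (simp add: ip_annih)

lemma annih_creat:
  assumes f: "f \<in> schwartz"
  shows "annih (creat f) = (\<lambda>x. creat (annih f) x + f x)"
proof
  fix x
  define c where "c = complex_of_real (1 / sqrt 2)"
  have c: "c * c = 1/2"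
    by (simp add: c_def flip: of_real_mult)
  have 1: "vderiv (creat f) = (\<lambda>x. c * (complex_of_real x * vderiv f x + f x - vderiv (vderiv f) x))"
    unfolding creat_eq c_def[symmetric]
    by (rule vderiv_eqI) (auto intro!: derivative_eq_intros schwartz_has_vderiv schwartz_vderiv f simp: algebra_simps)
  have 2: "vderiv (annih f) = (\<lambda>x. c * (complex_of_real x * vderiv f x + f x + vderiv (vderiv f) x))"
    unfolding annih_eq c_def[symmetric]
    by (rule vderiv_eqI) (auto intro!: derivative_eq_intros schwartz_has_vderiv schwartz_vderiv f simp: algebra_simps)
  have "annih (creat f) x - creat (annih f) x = (c * c) * (2 * f x)"
    unfolding annih_eq[of "creat f"] creat_eq[of "annih f"] 1 2 unfolding annih_eq creat_eq c_def[symmetric]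
    by (simp add: algebra_simps)
  then show "annih (creat f) x = creat (annih f) x + f x"
    unfolding c by (simp add: algebra_simps)
qed

section \<open>Hermite functions\<close>

text \<open>Taking t = 0 shows that the positive and negative parts have equal mass. Unless both
  vanish, they are normalised to probability densities with the same characteristic function, and
  Levy's uniqueness theorem identifies them.\<close>

lemma AE_zero_if_Fourier_zero:
  fixes w :: "real \<Rightarrow> real"
  assumes int: "integrable lborel w"
    and zero: "\<And>t. (CLINT x|lborel. w x *\<^sub>R iexp (t * x)) = 0"
  shows "AE x in lborel. w x = 0"
proof -
  have [measurable]: "w \<in> borel_measurable borel" using int by auto
  define p q where "p x = max 0 (w x)" and "q x = max 0 (- w x)" for x
  have [measurable]: "p \<in> borel_measurable borel" "q \<in> borel_measurable borel"
    unfolding p_def q_def by measurable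
  have pq: "w x = p x - q x" "p x \<ge> 0" "q x \<ge> 0" for x
    by (auto simp: p_def q_def)
  have ip: "integrable lborel p" and iq: "integrable lborel q"
    unfolding p_def q_def using int by auto
  define m where "m = (LINT x|lborel. p x)"
  have "(CLINT x|lborel. complex_of_real (w x)) = 0"
    using zero[of 0] by (simp add: scaleR_conv_of_real)
  then have "(LINT x|lborel. w x) = 0" by simp
  then have mq: "(LINT x|lborel. q x) = m"
    using ip iq by (simp add: pq(1) m_def)
  show ?thesis
  proof (cases "m = 0")
    case True
    then have "AE x in lborel. p x = 0" "AE x in lborel. q x = 0"
      using mq integral_nonneg_eq_0_iff_AE[OF ip] integral_nonneg_eq_0_iff_AE[OF iq] pq
      by (auto simp: m_def)
    then show ?thesis by eventually_elim (simp add: pq(1))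
  next
    case False
    have "m > 0"
      using False integral_nonneg_AE[where M = lborel and f = p] pq by (simp add: m_def less_le)
    define D :: "(real \<Rightarrow> real) \<Rightarrow> real measure" where "D r = density lborel (\<lambda>x. ennreal (r x / m))" for r
    have dist: "real_distribution (D r)"
      if [measurable]: "r \<in> borel_measurable borel" and r: "integrable lborel r" "\<And>x. r x \<ge> 0" "(LINT x|lborel. r x) = m" for r
    proof -
      have "emeasure (D r) (space (D r)) = (\<integral>\<^sup>+x. ennreal (r x / m) \<partial>lborel)"
        unfolding D_def by (subst emeasure_density) auto
      also have "\<dots> = 1"
        using r \<open>m > 0\<close> by (subst nn_integral_eq_integral) auto
      finally show ?thesis
        by (intro real_distribution.intro prob_spaceI real_distribution_axioms.intro) (simp_all add: D_def)
    qed
    have char: "char (D r) t = (1 / m) *\<^sub>R (CLINT x|lborel. r x *\<^sub>R iexp (t * x))"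
      if [measurable]: "r \<in> borel_measurable borel" and r: "\<And>x. r x \<ge> 0" for r t
    proof -
      have "char (D r) t = (CLINT x|lborel. (r x / m) *\<^sub>R iexp (t * x))"
        unfolding char_def D_def using r \<open>m > 0\<close> by (subst integral_density) auto
      also have "\<dots> = (CLINT x|lborel. (1 / m) *\<^sub>R (r x *\<^sub>R iexp (t * x)))"
        by simp
      finally show ?thesis by (simp only: integral_scaleR_right)
    qed
    have ii: "integrable lborel (\<lambda>x. r x *\<^sub>R iexp (t * x))" if r: "integrable lborel r" for r :: "real \<Rightarrow> real" and t
    proof (rule Bochner_Integration.integrable_bound[OF r])
      have [measurable]: "r \<in> borel_measurable borel" using r by auto
      show "(\<lambda>x. r x *\<^sub>R iexp (t * x)) \<in> borel_measurable lborel" by measurable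
    qed simp
    have "(CLINT x|lborel. p x *\<^sub>R iexp (t * x)) = (CLINT x|lborel. q x *\<^sub>R iexp (t * x))" for t
      using zero[of t] ii[OF ip, of t] ii[OF iq, of t]
      by (simp add: pq(1) scaleR_diff_left)
    then have "char (D p) = char (D q)"
      by (intro ext) (simp add: char pq)
    then have "D p = D q"
      by (intro Levy_uniqueness dist) (auto simp: ip iq pq mq m_def)
    then have "AE x in lborel. ennreal (p x / m) = ennreal (q x / m)"
      unfolding D_def by (intro sigma_finite_measure.density_unique[OF sigma_finite_lborel]) auto
    then show ?thesis
      by eventually_elim (use \<open>m > 0\<close> in \<open>simp add: pq\<close>)
  qed
qed

lemma integrable_exp_minus_square: "integrable lborel (\<lambda>x::real. exp (- x\<^sup>2 / 2))"
proof -
  have "integrable lborel (\<lambda>x. sqrt (2 * pi) * normal_density 0 1 x)"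
    by (intro integrable_mult_right integrable_normal_density) simp
  then show ?thesis by (simp add: normal_density_def)
qed

lemma exp_partial_sum_le: "norm (\<Sum>j<n. z ^ j /\<^sub>R fact j) \<le> exp (norm z)" for z :: complex
proof -
  have "norm (\<Sum>j<n. z ^ j /\<^sub>R fact j) \<le> (\<Sum>j<n. norm z ^ j /\<^sub>R fact j)"
    by (rule sum_norm_le) (simp add: norm_power)
  also have "\<dots> \<le> (\<Sum>j. norm z ^ j /\<^sub>R fact j)"
    by (rule sum_le_suminf[OF sums_summable[OF exp_converges[of "norm z"]]]) auto
  also have "\<dots> = exp (norm z)"
    using sums_unique[OF exp_converges[of "norm z"]] by simp
  finally show ?thesis .
qed

text \<open>The Gaussian factor makes exp |t x| |w x| integrable for every t, so the exponential
  series in the Fourier transform of w may be integrated term by term, and each term is a multiple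
  of a moment.\<close>

lemma AE_zero_if_gaussian_moments_zero:
  fixes u :: "real \<Rightarrow> real"
  assumes [measurable]: "u \<in> borel_measurable borel" and u: "integrable lborel (\<lambda>x. (u x)\<^sup>2)"
    and moments: "\<And>j. (LINT x|lborel. x ^ j * (exp (- x\<^sup>2 / 2) * u x)) = 0"
  shows "AE x in lborel. u x = 0"
proof -
  define w where "w x = exp (- x\<^sup>2 / 2) * u x" for x
  have [measurable]: "w \<in> borel_measurable borel" unfolding w_def by measurable
  have exp_w: "integrable lborel (\<lambda>x. exp \<bar>t * x\<bar> * \<bar>w x\<bar>)" for t
  proof (rule Bochner_Integration.integrable_bound)
    show "integrable lborel (\<lambda>x. (u x)\<^sup>2 + exp (2 * t\<^sup>2) * exp (- x\<^sup>2 / 2))"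
      by (intro Bochner_Integration.integrable_add u integrable_mult_right integrable_exp_minus_square)
    have "exp \<bar>t * x\<bar> * \<bar>w x\<bar> \<le> (u x)\<^sup>2 + exp (2 * t\<^sup>2) * exp (- x\<^sup>2 / 2)" for x
    proof -
      have "exp \<bar>t * x\<bar> * \<bar>w x\<bar> = exp (\<bar>t * x\<bar> - x\<^sup>2 / 2) * \<bar>u x\<bar>"
        unfolding w_def abs_mult diff_conv_add_uminus exp_add by simp
      also have "\<dots> \<le> (exp (\<bar>t * x\<bar> - x\<^sup>2 / 2))\<^sup>2 + (u x)\<^sup>2"
        using sum_squares_bound[of "exp (\<bar>t * x\<bar> - x\<^sup>2 / 2)" "\<bar>u x\<bar>"]
          mult_nonneg_nonneg[OF exp_ge_zero abs_ge_zero, of "\<bar>t * x\<bar> - x\<^sup>2 / 2" "u x"]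
        unfolding mult.assoc power2_abs by linarith
      also have "(exp (\<bar>t * x\<bar> - x\<^sup>2 / 2))\<^sup>2 = exp (2 * \<bar>t\<bar> * \<bar>x\<bar> - x\<^sup>2)"
        by (simp add: abs_mult algebra_simps flip: exp_double)
      \<comment> \<open>From (2 |t| - |x|)^2 \<ge> 0: half of the quadratic decay absorbs the linear
        exponent.\<close>
      also have "\<dots> \<le> exp (2 * t\<^sup>2 - x\<^sup>2 / 2)"
        using zero_le_power2[of "2 * \<bar>t\<bar> - \<bar>x\<bar>"] by (simp add: power2_eq_square algebra_simps)
      also have "\<dots> = exp (2 * t\<^sup>2) * exp (- x\<^sup>2 / 2)"
        by (simp flip: exp_add)
      finally show ?thesis by simp
    qed
    then show "AE x in lborel. norm (exp \<bar>t * x\<bar> * \<bar>w x\<bar>) \<le> norm ((u x)\<^sup>2 + exp (2 * t\<^sup>2) * exp (- x\<^sup>2 / 2))"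
      by (auto intro!: AE_I2)
  qed measurable
  have int: "integrable lborel (\<lambda>x. x ^ j * w x)" for j
  proof (rule Bochner_Integration.integrable_bound)
    show "integrable lborel (\<lambda>x. fact j * (exp \<bar>1 * x\<bar> * \<bar>w x\<bar>))"
      by (intro integrable_mult_right exp_w)
    have "\<bar>x\<bar> ^ j \<le> fact j * exp \<bar>x\<bar>" for x :: real
      using exp_ge_power_fact[of "\<bar>x\<bar>" j] by (simp add: field_simps)
    then show "AE x in lborel. norm (x ^ j * w x) \<le> norm (fact j * (exp \<bar>1 * x\<bar> * \<bar>w x\<bar>))"
      by (auto intro!: AE_I2 mult_right_mono simp: abs_mult power_abs mult.assoc[symmetric])
  qed measurable
  have "AE x in lborel. w x = 0"
  proof (rule AE_zero_if_Fourier_zero)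
    show "integrable lborel w" using int[of 0] by simp
    fix t
    let ?s = "\<lambda>n x. \<Sum>j<n. (w x *\<^sub>R (\<i> * complex_of_real (t * x)) ^ j /\<^sub>R fact j)"
    have "(\<lambda>n. CLINT x|lborel. ?s n x) \<longlonglongrightarrow> (CLINT x|lborel. w x *\<^sub>R iexp (t * x))"
    proof (rule integral_dominated_convergence[where w = "\<lambda>x. exp \<bar>t * x\<bar> * \<bar>w x\<bar>"])
      have eq: "?s n x = w x *\<^sub>R (\<Sum>j<n. (\<i> * complex_of_real (t * x)) ^ j /\<^sub>R fact j)" for n x
        by (simp add: scaleR_right.sum mult.commute)
      show "AE x in lborel. (\<lambda>n. ?s n x) \<longlonglongrightarrow> w x *\<^sub>R iexp (t * x)"
        unfolding eq using exp_converges by (intro AE_I2 tendsto_scaleR tendsto_const) (auto simp: sums_def)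
      show "AE x in lborel. norm (?s n x) \<le> exp \<bar>t * x\<bar> * \<bar>w x\<bar>" for n
      proof (intro AE_I2)
        fix x
        have "norm (\<i> * complex_of_real (t * x)) = \<bar>t * x\<bar>"
          by (simp only: norm_mult norm_ii norm_of_real mult_1)
        then show "norm (?s n x) \<le> exp \<bar>t * x\<bar> * \<bar>w x\<bar>"
          using exp_partial_sum_le[of "\<i> * complex_of_real (t * x)" n] unfolding eq norm_scaleR
          by (simp only: real_norm_def mult.commute[of "\<bar>w x\<bar>"]) (intro mult_right_mono, auto)
      qed
    qed (auto intro: exp_w)
    moreover have "(CLINT x|lborel. ?s n x) = 0" for n
    proof -
      have trm: "w x *\<^sub>R (\<i> * complex_of_real (t * x)) ^ j /\<^sub>R fact j
          = ((\<i> * complex_of_real t) ^ j /\<^sub>R fact j) * complex_of_real (x ^ j * w x)" for x j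
        by (simp add: scaleR_conv_of_real power_mult_distrib mult_ac)
      have "(CLINT x|lborel. ?s n x) = (\<Sum>j<n. CLINT x|lborel. ((\<i> * complex_of_real t) ^ j /\<^sub>R fact j) * complex_of_real (x ^ j * w x))"
        unfolding trm by (intro Bochner_Integration.integral_sum integrable_mult_right integrable_of_real int)
      also have "\<dots> = (\<Sum>j<n. ((\<i> * complex_of_real t) ^ j /\<^sub>R fact j) * complex_of_real (LINT x|lborel. x ^ j * w x))"
        by (simp only: integral_mult_right_zero integral_complex_of_real)
      finally show ?thesis
        using moments by (simp add: w_def)
    qed
    ultimately show "(CLINT x|lborel. w x *\<^sub>R iexp (t * x)) = 0"
      by (simp add: LIMSEQ_const_iff)
  qed
  then show ?thesis by eventually_elim (simp add: w_def)
qed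

text \<open>The factor pi^(-1/4) normalises the Gaussian and 1/sqrt(n + 1) each further step; these
  are the orthonormal eigenfunctions of the harmonic oscillator.\<close>

fun hermite :: "nat \<Rightarrow> real \<Rightarrow> complex" where
  "hermite 0 = (\<lambda>x. complex_of_real (pi powr (- 1/4)) * gaussian x)"
| "hermite (Suc n) = (\<lambda>x. complex_of_real (1 / sqrt (real (Suc n))) * creat (hermite n) x)"

lemma hermite_schwartz: "hermite n \<in> schwartz"
proof (induction n)
  case 0
  show ?case unfolding hermite.simps by (intro schwartz_cmult gaussian_schwartz)
next
  case (Suc n)
  then show ?case unfolding hermite.simps by (intro schwartz_cmult schwartz_creat)
qed

lemma creat_hermite: "creat (hermite n) = (\<lambda>x. complex_of_real (sqrt (real (Suc n))) * hermite (Suc n) x)"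
proof
  fix x
  have "complex_of_real (sqrt (real (Suc n))) * complex_of_real (1 / sqrt (real (Suc n))) = 1"
    by (simp del: of_nat_Suc flip: of_real_mult)
  then show "creat (hermite n) x = complex_of_real (sqrt (real (Suc n))) * hermite (Suc n) x"
    by (simp only: hermite.simps mult.assoc[symmetric]) simp
qed

text \<open>Lowering follows from raising through the commutation relation
  \<open>annih_creat\<close>. At n = 0 the truncated index n - 1 is harmless, since its coefficient
  is sqrt 0.\<close>

lemma annih_hermite: "annih (hermite n) = (\<lambda>x. complex_of_real (sqrt (real n)) * hermite (n - 1) x)"
proof (induction n)
  case 0
  have "vderiv gaussian = (\<lambda>x. - complex_of_real x * gaussian x)"
    by (intro vderiv_eqI has_vderiv_gaussian)
  then have "annih gaussian = (\<lambda>x. 0)"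
    unfolding annih_eq by simp
  then show ?case
    by (simp add: annih_cmult gaussian_schwartz)
next
  case (Suc n)
  let ?s = "complex_of_real (sqrt (real (Suc n)))" and ?i = "complex_of_real (1 / sqrt (real (Suc n)))"
  have c: "?i * complex_of_real (real n + 1) = ?s"
  proof -
    have "1 / sqrt (real (Suc n)) * (real n + 1) = sqrt (real (Suc n))"
      using real_div_sqrt[of "real (Suc n)"] by (simp add: add.commute)
    then show ?thesis by (simp only: of_real_mult[symmetric])
  qed
  have n: "complex_of_real (sqrt (real n)) * creat (hermite (n - 1)) x = complex_of_real (real n) * hermite n x" for x
    by (cases n) (simp_all add: creat_hermite mult.assoc[symmetric] del: hermite.simps of_nat_Suc flip: of_real_mult)
  have "annih (hermite (Suc n)) = (\<lambda>x. ?i * (creat (annih (hermite n)) x + hermite n x))"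
    unfolding hermite.simps
    by (simp only: annih_cmult[OF schwartz_creat[OF hermite_schwartz]] annih_creat[OF hermite_schwartz])
  also have "\<dots> = (\<lambda>x. ?i * (complex_of_real (real n) * hermite n x + hermite n x))"
    unfolding Suc by (simp only: creat_cmult[OF hermite_schwartz] n)
  also have "\<dots> = (\<lambda>x. (?i * complex_of_real (real n + 1)) * hermite n x)"
    by (simp add: algebra_simps add_divide_distrib)
  finally show ?case unfolding c by simp
qed

lemma number_hermite: "creat (annih (hermite n)) = (\<lambda>x. complex_of_real (real n) * hermite n x)"
proof
  fix x
  show "creat (annih (hermite n)) x = complex_of_real (real n) * hermite n x"
    unfolding annih_hermite creat_cmult[OF hermite_schwartz] 
    by (cases n) (simp_all add: creat_hermite mult.assoc[symmetric] del: hermite.simps of_nat_Suc flip: of_real_mult)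
qed

text \<open>Moving one creation operator to the other side lowers both indices, down to the ground
  state.\<close>

lemma ip_hermite: "ip (hermite m) (hermite n) = (if m = n then 1 else 0)"
proof (induction m arbitrary: n)
  case 0
  show ?case
  proof (cases n)
    case 0
    \<comment> \<open>The square of the ground state is the centred normal density of variance
      1/2.\<close>
    have "normal_density 0 (1 / sqrt 2) x = 1 / sqrt pi * exp (- x\<^sup>2)" for x
      by (simp add: normal_density_def power_divide)
    then have "(LINT x|lborel. 1 / sqrt pi * exp (- x\<^sup>2)) = (LINT x|lborel. normal_density 0 (1 / sqrt 2) x)"
      by simp
    then have one: "(LINT x|lborel. 1 / sqrt pi * exp (- x\<^sup>2)) = 1"
      by (simp only:) (rule integral_normal_density, simp)
    have sq: "cnj (hermite 0 x) * hermite 0 x = complex_of_real (1 / sqrt pi * exp (- x\<^sup>2))" for x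
    proof -
      have "pi powr (- 1/4) * pi powr (- 1/4) = 1 / sqrt pi"
        by (simp add: powr_half_sqrt[symmetric] powr_minus_divide flip: powr_add)
      moreover have "exp (- x\<^sup>2 / 2) * exp (- x\<^sup>2 / 2) = exp (- x\<^sup>2)"
        by (simp flip: exp_add)
      moreover have "cnj (hermite 0 x) * hermite 0 x
          = complex_of_real ((pi powr (- 1/4) * pi powr (- 1/4)) * (exp (- x\<^sup>2 / 2) * exp (- x\<^sup>2 / 2)))"
        unfolding hermite.simps gaussian_def by simp
      ultimately show ?thesis by simp
    qed
    show ?thesis
      unfolding 0 ip_def by (simp only: sq integral_complex_of_real one) simp
  next
    case (Suc k)
    have "ip (hermite 0) (creat (hermite k)) = 0"
      by (simp only: ip_creat hermite_schwartz annih_hermite) (simp add: ip_def)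
    then show ?thesis unfolding Suc hermite.simps(2) ip_cmult_right by simp
  qed
next
  case (Suc m)
  have "ip (hermite (Suc m)) (hermite n) = complex_of_real (1 / sqrt (real (Suc m))) * ip (creat (hermite m)) (hermite n)"
    unfolding hermite.simps(2)[of m] ip_cmult_left by simp
  also have "ip (creat (hermite m)) (hermite n) = complex_of_real (sqrt (real n)) * ip (hermite m) (hermite (n - 1))"
    by (simp only: ip_annih[symmetric] hermite_schwartz annih_hermite ip_cmult_right)
  finally show ?case
    unfolding Suc by (cases n) (auto simp del: hermite.simps of_nat_Suc)
qed

text \<open>Position is the sum of the two ladder operators divided by sqrt 2.\<close>

lemma x_hermite: "complex_of_real x * hermite n x
  = complex_of_real (sqrt (real n / 2)) * hermite (n - 1) x + complex_of_real (sqrt (real (Suc n) / 2)) * hermite (Suc n) x"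
proof -
  define c where "c = complex_of_real (1 / sqrt 2)"
  have c: "c * c = 1/2"
    by (simp add: c_def flip: of_real_mult)
  have s: "complex_of_real (sqrt (r / 2)) = c * complex_of_real (sqrt r)" for r
    by (simp add: c_def real_sqrt_divide)
  have "annih (hermite n) x + creat (hermite n) x = c * (2 * (complex_of_real x * hermite n x))"
    unfolding annih_eq creat_eq c_def[symmetric] by (simp add: algebra_simps)
  then have "c * (annih (hermite n) x + creat (hermite n) x) = (c * c) * (2 * (complex_of_real x * hermite n x))"
    by (simp only: mult.assoc)
  then have "complex_of_real x * hermite n x = c * (annih (hermite n) x + creat (hermite n) x)"
    unfolding c by simp
  then show ?thesis
    unfolding annih_hermite creat_hermite s distrib_left mult.assoc .
qed

text \<open>Multiplication by x maps \<open>hermite n\<close> to a combination of its neighbours, so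
  orthogonality to all \<open>hermite n\<close> extends to x^j times \<open>hermite 0\<close>. Hence
  all Gaussian moments of the real and the imaginary part of f vanish.\<close>

lemma hermite_total:
  assumes [measurable]: "f \<in> borel_measurable borel" and f: "integrable lborel (\<lambda>x. (norm (f x))\<^sup>2)"
    and zero: "\<And>n. ip (hermite n) f = 0"
  shows "AE x in lborel. f x = 0"
proof -
  have int: "integrable lborel (\<lambda>x. cnj (g x) * f x)" if "g \<in> schwartz" for g
    by (intro integrable_cnj_mult schwartz_measurable schwartz_square_integrable f that assms(1))
  have S: "(\<lambda>x. complex_of_real x ^ j * hermite n x) \<in> schwartz" for j n
  proof (induction j)
    case (Suc j)
    from schwartz_xmult[OF this] show ?case by (simp add: mult.assoc)
  qed (simp add: hermite_schwartz)
  have Z: "ip (\<lambda>x. complex_of_real x ^ j * hermite n x) f = 0" for j n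
  proof (induction j arbitrary: n)
    case (Suc j)
    let ?a = "complex_of_real (sqrt (real n / 2))" and ?b = "complex_of_real (sqrt (real (Suc n) / 2))"
    have "complex_of_real x ^ Suc j * hermite n x
        = ?a * (complex_of_real x ^ j * hermite (n - 1) x) + ?b * (complex_of_real x ^ j * hermite (Suc n) x)" for x
    proof -
      have "complex_of_real x ^ Suc j * hermite n x = complex_of_real x ^ j * (complex_of_real x * hermite n x)"
        by (simp add: mult_ac)
      then show ?thesis unfolding x_hermite by (simp add: algebra_simps del: hermite.simps of_nat_Suc)
    qed
    then have "ip (\<lambda>x. complex_of_real x ^ Suc j * hermite n x) f
        = ip (\<lambda>x. ?a * (complex_of_real x ^ j * hermite (n - 1) x) + ?b * (complex_of_real x ^ j * hermite (Suc n) x)) f"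
      by presburger
    also have "\<dots> = ip (\<lambda>x. ?a * (complex_of_real x ^ j * hermite (n - 1) x)) f + ip (\<lambda>x. ?b * (complex_of_real x ^ j * hermite (Suc n) x)) f"
      unfolding ip_def complex_cnj_add distrib_right
      by (intro Bochner_Integration.integral_add int schwartz_cmult S)
    also have "\<dots> = 0"
      by (simp only: ip_cmult_left Suc.IH) simp
    finally show ?case .
  qed (simp add: zero)
  define c where "c = pi powr (- 1/4)"
  have c: "c > 0" by (simp add: c_def)
  have g: "cnj (complex_of_real x ^ j * hermite 0 x) * f x = complex_of_real c * (complex_of_real (x ^ j * exp (- x\<^sup>2 / 2)) * f x)" for x j
    unfolding hermite.simps gaussian_def c_def by (simp add: mult_ac)
  have inv: "complex_of_real (1 / c) * (complex_of_real c * y) = y" for y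
    using c by simp
  have int': "integrable lborel (\<lambda>x. complex_of_real (x ^ j * exp (- x\<^sup>2 / 2)) * f x)" for j
    using integrable_mult_right[of "complex_of_real (1 / c)", OF int[OF S[of j 0]]] unfolding g inv by simp
  have "(CLINT x|lborel. complex_of_real (x ^ j * exp (- x\<^sup>2 / 2)) * f x) = 0" for j
    using Z[of j 0] c unfolding ip_def g by simp
  from arg_cong[OF this, of Re] arg_cong[OF this, of Im]
  have re: "(LINT x|lborel. x ^ j * (exp (- x\<^sup>2 / 2) * Re (f x))) = 0"
    and im: "(LINT x|lborel. x ^ j * (exp (- x\<^sup>2 / 2) * Im (f x))) = 0" for j
    using integral_Re[OF int'[of j]] integral_Im[OF int'[of j]] by (simp_all add: mult.assoc)
  have "AE x in lborel. Re (f x) = 0"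
  proof (rule AE_zero_if_gaussian_moments_zero[OF _ _ re])
    show "integrable lborel (\<lambda>x. (Re (f x))\<^sup>2)"
      by (rule Bochner_Integration.integrable_bound[OF f]) (auto intro!: AE_I2 simp: cmod_power2)
  qed auto
  moreover have "AE x in lborel. Im (f x) = 0"
  proof (rule AE_zero_if_gaussian_moments_zero[OF _ _ im])
    show "integrable lborel (\<lambda>x. (Im (f x))\<^sup>2)"
      by (rule Bochner_Integration.integrable_bound[OF f]) (auto intro!: AE_I2 simp: cmod_power2)
  qed auto
  ultimately show ?thesis by eventually_elim (simp add: complex_eq_iff)
qed

section \<open>The Jaynes--Cummings operators on spinors\<close>

definition spin :: "(real \<Rightarrow> complex) \<Rightarrow> (real \<Rightarrow> complex) \<Rightarrow> real \<Rightarrow> complex ^ 2" where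
  "spin f g x = (\<chi> i. if i = 1 then f x else g x)"

lemma spin_nth [simp]: "spin f g x $ 1 = f x" "spin f g x $ 2 = g x"
  by (simp_all add: spin_def)

lemma spin_eqI: "(\<And>x. \<Psi> x $ 1 = f x) \<Longrightarrow> (\<And>x. \<Psi> x $ 2 = g x) \<Longrightarrow> \<Psi> = spin f g"
  by (rule ext) (simp add: vec_eq_iff forall_2)

lemma spin_components: "spin (\<lambda>x. \<Psi> x $ 1) (\<lambda>x. \<Psi> x $ 2) = \<Psi>"
  by (rule spin_eqI[symmetric]) auto

lemma spin_schwartz2 [simp]: "spin f g \<in> schwartz2 \<longleftrightarrow> f \<in> schwartz \<and> g \<in> schwartz"
  by (simp add: schwartz2_def forall_2)

lemma norm_complex2: "(norm (v :: complex ^ 2))\<^sup>2 = (cmod (v $ 1))\<^sup>2 + (cmod (v $ 2))\<^sup>2"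
  by (simp add: norm_vec_def L2_set_def sum_2)

lemma sq_integrable_iff_components:
  "\<Psi> \<in> sq_integrable \<longleftrightarrow> (\<forall>i. (\<lambda>x. \<Psi> x $ i) \<in> borel_measurable borel \<and> integrable lborel (\<lambda>x. (cmod (\<Psi> x $ i))\<^sup>2))"
proof safe
  assume \<Psi>: "\<Psi> \<in> sq_integrable"
  then have [measurable]: "\<Psi> \<in> borel_measurable borel" and int: "integrable lborel (\<lambda>x. (norm (\<Psi> x))\<^sup>2)"
    by (auto simp: sq_integrable_def)
  fix i
  show [measurable]: "(\<lambda>x. \<Psi> x $ i) \<in> borel_measurable borel"
    by (rule borel_measurable_continuous_on[where f = "\<lambda>v. v $ i"]) (auto intro: continuous_intros)
  show "integrable lborel (\<lambda>x. (cmod (\<Psi> x $ i))\<^sup>2)"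
    by (rule Bochner_Integration.integrable_bound[OF int])
      (auto intro!: AE_I2 power_mono Finite_Cartesian_Product.norm_nth_le)
next
  assume comp: "\<forall>i. (\<lambda>x. \<Psi> x $ i) \<in> borel_measurable borel \<and> integrable lborel (\<lambda>x. (cmod (\<Psi> x $ i))\<^sup>2)"
  have "continuous_on UNIV (\<lambda>p. (\<chi> i. if i = 1 then fst p else snd p) :: complex ^ 2)"
  proof (rule continuous_on_vec_lambda)
    show "continuous_on UNIV (\<lambda>p. if i = 1 then fst p else snd p :: complex)" for i :: 2
      by (cases "i = 1") (auto intro: continuous_intros)
  qed
  then have "(\<lambda>x. (\<chi> i. if i = 1 then \<Psi> x $ 1 else \<Psi> x $ 2) :: complex ^ 2) \<in> borel_measurable borel"
    using borel_measurable_continuous_Pair[of "\<lambda>x. \<Psi> x $ 1" borel "\<lambda>x. \<Psi> x $ 2"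
        "\<lambda>a b. (\<chi> i. if i = 1 then a else b) :: complex ^ 2"] comp by simp
  moreover have "(\<lambda>x. (\<chi> i. if i = 1 then \<Psi> x $ 1 else \<Psi> x $ 2) :: complex ^ 2) = \<Psi>"
    by (rule ext) (simp add: vec_eq_iff forall_2)
  ultimately show "\<Psi> \<in> sq_integrable"
    using comp by (auto simp: sq_integrable_def norm_complex2)
qed

lemma schwartz2_sq_integrable: "\<Psi> \<in> schwartz2 \<Longrightarrow> \<Psi> \<in> sq_integrable"
  unfolding sq_integrable_iff_components schwartz2_def
  using schwartz_measurable schwartz_square_integrable by blast

lemma cinner_schwartz2:
  assumes f: "f \<in> schwartz" and g: "g \<in> schwartz" and \<Psi>: "\<Psi> \<in> sq_integrable"
  shows "cinner (abs_l2 (spin f g)) (abs_l2 \<Psi>) = ip f (\<lambda>x. \<Psi> x $ 1) + ip g (\<lambda>x. \<Psi> x $ 2)"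
proof -
  have "integrable lborel (\<lambda>x. cnj (f x) * \<Psi> x $ 1)" "integrable lborel (\<lambda>x. cnj (g x) * \<Psi> x $ 2)"
    using \<Psi> integrable_cnj_mult[OF schwartz_measurable[OF f] _ schwartz_square_integrable[OF f]]
      integrable_cnj_mult[OF schwartz_measurable[OF g] _ schwartz_square_integrable[OF g]]
    unfolding sq_integrable_iff_components by auto
  then show ?thesis
    by (simp add: cinner_abs_l2 schwartz2_sq_integrable f g \<Psi> cdot_def sum_2 ip_def)
qed

text \<open>All four operators are special cases of the operator with separate coupling constants \<open>l1\<close> of
  the rotating and \<open>l2\<close> of the counter-rotating terms.\<close>

definition jc_op :: "real \<Rightarrow> real \<Rightarrow> real \<Rightarrow> real \<Rightarrow> (real \<Rightarrow> complex ^ 2) \<Rightarrow> real \<Rightarrow> complex ^ 2" where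
  "jc_op Om om l1 l2 \<Psi> = (let f = (\<lambda>x. \<Psi> x $ 1); g = (\<lambda>x. \<Psi> x $ 2) in spin
    (\<lambda>x. complex_of_real (Om / 2) * f x + (complex_of_real om * creat (annih f) x
      + (complex_of_real l1 * annih g x + complex_of_real l2 * creat g x)))
    (\<lambda>x. complex_of_real (- Om / 2) * g x + (complex_of_real om * creat (annih g) x
      + (complex_of_real l1 * creat f x + complex_of_real l2 * annih f x))))"

lemmas sigma_defs = sigma_x_def sigma_z_def sigma_plus_def sigma_minus_def

lemma tensor_op_nth: "((\<sigma> \<otimes>\<^sub>o T) \<Psi> x) $ i = \<sigma> $ i $ 1 * T (\<lambda>y. \<Psi> y $ 1) x + \<sigma> $ i $ 2 * T (\<lambda>y. \<Psi> y $ 2) x"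
  by (simp add: tensor_op_def matrix_vector_mult_def sum_2)

lemma rabi_op_eq: "rabi_op lam Om om = jc_op Om om lam lam"
  unfolding jc_op_def Let_def
  by (rule ext, rule spin_eqI)
    (simp_all add: rabi_op_def tensor_op_nth sigma_defs mat_def scaleR_conv_of_real[where 'a = complex] algebra_simps)

lemma rwa_op_eq: "rwa_op lam Om om = jc_op Om om lam 0"
  unfolding jc_op_def Let_def
  by (rule ext, rule spin_eqI)
    (simp_all add: rwa_op_def tensor_op_nth sigma_defs mat_def scaleR_conv_of_real[where 'a = complex] algebra_simps)

lemma free_op_eq: "free_op om = jc_op om om 0 0"
  unfolding jc_op_def Let_def
  by (rule ext, rule spin_eqI)
    (simp_all add: free_op_def tensor_op_nth sigma_defs mat_def scaleR_conv_of_real[where 'a = complex] algebra_simps)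

lemma number_op_eq: "(mat 1 \<otimes>\<^sub>o (creat \<circ> annih)) = jc_op 0 1 0 0"
  unfolding jc_op_def Let_def
  by (rule ext, rule spin_eqI) (simp_all add: tensor_op_nth mat_def)

lemma jc_op_schwartz2: "\<Psi> \<in> schwartz2 \<Longrightarrow> jc_op Om om l1 l2 \<Psi> \<in> schwartz2"
  unfolding jc_op_def Let_def spin_schwartz2
  by (intro conjI schwartz_add schwartz_cmult schwartz_creat schwartz_annih) (auto simp: schwartz2_def)

text \<open>Each coupling term occurs together with its adjoint in the other spin component, so both
  sides consist of the same summands in a different order.\<close>

lemma jc_op_symmetric:
  assumes "\<Phi> \<in> schwartz2" "\<Psi> \<in> schwartz2"
  shows "cinner (abs_l2 (jc_op Om om l1 l2 \<Phi>)) (abs_l2 \<Psi>) = cinner (abs_l2 \<Phi>) (abs_l2 (jc_op Om om l1 l2 \<Psi>))"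
proof -
  have "spin (\<lambda>x. \<Phi> x $ 1) (\<lambda>x. \<Phi> x $ 2) \<in> schwartz2" "spin (\<lambda>x. \<Psi> x $ 1) (\<lambda>x. \<Psi> x $ 2) \<in> schwartz2"
    using assms by (simp_all only: spin_components)
  then obtain f g f' g' where eq: "\<Phi> = spin f g" "\<Psi> = spin f' g'"
    and S: "f \<in> schwartz" "g \<in> schwartz" "f' \<in> schwartz" "g' \<in> schwartz"
    using spin_components[of \<Phi>] spin_components[of \<Psi>] by (metis spin_schwartz2)
  show ?thesis
    unfolding eq jc_op_def Let_def
    by (simp only: spin_nth cinner_schwartz2 schwartz2_sq_integrable spin_schwartz2 S schwartz_add schwartz_cmult
        schwartz_creat schwartz_annih ip_add_left ip_add_right ip_cmult_left ip_cmult_right ip_creat ip_annih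
        complex_cnj_complex_of_real simp_thms) (simp only: ac_simps)
qed

lemma schwartz2_add: "\<Phi> \<in> schwartz2 \<Longrightarrow> \<Psi> \<in> schwartz2 \<Longrightarrow> (\<lambda>x. \<Phi> x + \<Psi> x) \<in> schwartz2"
  by (simp add: schwartz2_def schwartz_add)

lemma schwartz2_smult: "\<Psi> \<in> schwartz2 \<Longrightarrow> (\<lambda>x. c *s \<Psi> x) \<in> schwartz2"
  by (simp add: schwartz2_def schwartz_cmult)

lemma jc_op_add:
  assumes "\<Phi> \<in> schwartz2" "\<Psi> \<in> schwartz2"
  shows "jc_op Om om l1 l2 (\<lambda>x. \<Phi> x + \<Psi> x) = (\<lambda>x. jc_op Om om l1 l2 \<Phi> x + jc_op Om om l1 l2 \<Psi> x)"
proof -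
  have [simp]: "(\<lambda>x. \<Phi> x $ i) \<in> schwartz" "(\<lambda>x. \<Psi> x $ i) \<in> schwartz" for i
    using assms by (auto simp: schwartz2_def)
  show ?thesis
    unfolding jc_op_def Let_def
    by (rule spin_eqI[symmetric]) (simp_all add: annih_add creat_add schwartz_annih algebra_simps add_divide_distrib)
qed

lemma jc_op_smult:
  assumes "\<Psi> \<in> schwartz2"
  shows "jc_op Om om l1 l2 (\<lambda>x. c *s \<Psi> x) = (\<lambda>x. c *s jc_op Om om l1 l2 \<Psi> x)"
proof -
  have [simp]: "(\<lambda>x. \<Psi> x $ i) \<in> schwartz" for i
    using assms by (auto simp: schwartz2_def)
  show ?thesis
    unfolding jc_op_def Let_def
    by (rule spin_eqI[symmetric]) (simp_all add: annih_cmult creat_cmult schwartz_annih algebra_simps)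
qed

lemma op_closure_memI: "\<Psi> \<in> schwartz2 \<Longrightarrow> (abs_l2 \<Psi>, abs_l2 (T \<Psi>)) \<in> op_closure T"
  unfolding op_closure_def using closure_subset by fastforce

text \<open>Linearity and symmetry hold on Schwartz spinors and pass to the closure by sequences and
  continuity of the inner product.\<close>

lemma closed_symmetric_jc: "closed_symmetric (op_closure (jc_op Om om l1 l2))"
  unfolding closed_symmetric_def
proof (intro conjI allI impI)
  let ?T = "jc_op Om om l1 l2"
  define G where "G = {(abs_l2 \<Psi>, abs_l2 (?T \<Psi>)) | \<Psi>. \<Psi> \<in> schwartz2}"
  have clo: "op_closure ?T = closure G"
    by (simp add: op_closure_def G_def)
  have G_scale: "(c *\<^sub>C x, c *\<^sub>C y) \<in> G" if "(x, y) \<in> G" for c x y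
  proof -
    from that obtain \<Psi> where "\<Psi> \<in> schwartz2" "x = abs_l2 \<Psi>" "y = abs_l2 (?T \<Psi>)"
      by (auto simp: G_def)
    then show ?thesis
      unfolding G_def
      by (intro CollectI exI[of _ "\<lambda>x. c *s \<Psi> x"])
        (simp add: abs_l2_scaleC schwartz2_sq_integrable jc_op_schwartz2 jc_op_smult schwartz2_smult)
  qed
  have G_add: "(x + x', y + y') \<in> G" if xy: "(x, y) \<in> G" "(x', y') \<in> G" for x y x' y'
  proof -
    from xy obtain \<Phi> \<Psi> where "\<Psi> \<in> schwartz2" "x = abs_l2 \<Psi>" "y = abs_l2 (?T \<Psi>)"
      "\<Phi> \<in> schwartz2" "x' = abs_l2 \<Phi>" "y' = abs_l2 (?T \<Phi>)"
      by (auto simp: G_def)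
    then show ?thesis
      unfolding G_def
      by (intro CollectI exI[of _ "\<lambda>x. \<Psi> x + \<Phi> x"])
        (simp add: abs_l2_add schwartz2_sq_integrable jc_op_schwartz2 jc_op_add schwartz2_add)
  qed
  have G_sym: "cinner u y = cinner x v" if "(x, u) \<in> G" "(y, v) \<in> G" for x y u v
    using that jc_op_symmetric by (auto simp: G_def)
  show "closed (op_closure ?T)"
    by (simp add: clo)
  have "(0 *\<^sub>C abs_l2 (spin (hermite 0) (hermite 0)), 0 *\<^sub>C abs_l2 (?T (spin (hermite 0) (hermite 0)))) \<in> G"
    by (rule G_scale) (auto simp: G_def hermite_schwartz simp del: hermite.simps)
  then show "(0, 0) \<in> op_closure ?T"
    using closure_subset[of G] unfolding clo by auto
  fix x u
  show "(c *\<^sub>C x, c *\<^sub>C u) \<in> op_closure ?T" if xu: "(x, u) \<in> op_closure ?T" for c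
  proof -
    obtain p where p: "\<And>n. p n \<in> G" "p \<longlonglongrightarrow> (x, u)"
      using xu unfolding clo closure_sequential by blast
    have "(c *\<^sub>C fst (p n), c *\<^sub>C snd (p n)) \<in> G" for n
      using p(1)[of n] by (intro G_scale) simp
    moreover have "(\<lambda>n. (c *\<^sub>C fst (p n), c *\<^sub>C snd (p n))) \<longlonglongrightarrow> (c *\<^sub>C x, c *\<^sub>C u)"
      using tendsto_fst[OF p(2)] tendsto_snd[OF p(2)] by (intro tendsto_Pair tendsto_scaleC_right) auto
    ultimately show ?thesis
      unfolding clo closure_sequential by (intro exI[of _ "\<lambda>n. (c *\<^sub>C fst (p n), c *\<^sub>C snd (p n))"]) auto
  qed
  fix y v
  assume xu: "(x, u) \<in> op_closure ?T" and yv: "(y, v) \<in> op_closure ?T"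
  obtain p q where p: "\<And>n. p n \<in> G" "p \<longlonglongrightarrow> (x, u)" and q: "\<And>n. q n \<in> G" "q \<longlonglongrightarrow> (y, v)"
    using xu yv unfolding clo closure_sequential by blast
  have "p n + q n \<in> G" for n
    using G_add[of "fst (p n)" "snd (p n)" "fst (q n)" "snd (q n)"] p(1)[of n] q(1)[of n]
    by (simp add: plus_prod_def)
  then show "(x + y, u + v) \<in> op_closure ?T"
    using tendsto_add[OF p(2) q(2)] unfolding clo closure_sequential
    by (intro exI[of _ "\<lambda>n. p n + q n"]) auto
  have "(\<lambda>n. cinner (snd (p n)) (fst (q n))) \<longlonglongrightarrow> cinner u y"
    using tendsto_cinner[OF tendsto_snd[OF p(2)] tendsto_fst[OF q(2)]] by simp
  moreover have "(\<lambda>n. cinner (fst (p n)) (snd (q n))) \<longlonglongrightarrow> cinner x v"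
    using tendsto_cinner[OF tendsto_fst[OF p(2)] tendsto_snd[OF q(2)]] by simp
  moreover have "cinner (snd (p n)) (fst (q n)) = cinner (fst (p n)) (snd (q n))" for n
    using p(1)[of n] q(1)[of n] by (intro G_sym) auto
  ultimately show "cinner u y = cinner x v"
    using LIMSEQ_unique by simp
qed

text \<open>The basis is indexed by the spin and the total excitation number, so that the rotating terms
  preserve the second index; the index \<open>(True, 0)\<close> is void.\<close>

definition bfun :: "bool \<times> nat \<Rightarrow> real \<Rightarrow> complex ^ 2" where
  "bfun k = (if fst k then spin (if snd k = 0 then \<lambda>x. 0 else hermite (snd k - 1)) (\<lambda>x. 0)
    else spin (\<lambda>x. 0) (hermite (snd k)))"

definition bvec :: "bool \<times> nat \<Rightarrow> l2" where
  "bvec k = abs_l2 (bfun k)"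

lemma schwartz_zero: "(\<lambda>x. 0) \<in> schwartz"
  using schwartz_cmult[OF hermite_schwartz[of 0], of 0] by simp

lemma annih_zero [simp]: "annih (\<lambda>x. 0) = (\<lambda>x. 0)"
  using annih_cmult[OF hermite_schwartz[of 0], of 0] by simp

lemma creat_zero [simp]: "creat (\<lambda>x. 0) = (\<lambda>x. 0)"
  using creat_cmult[OF hermite_schwartz[of 0], of 0] by simp

lemma bfun_schwartz2: "bfun k \<in> schwartz2"
  by (simp add: bfun_def schwartz_zero hermite_schwartz)

lemma abs_l2_eqI: "ae_eq f g \<Longrightarrow> abs_l2 f = abs_l2 g"
  by (rule Quotient_rel_abs[OF Quotient_l2])

lemma abs_l2_zero: "abs_l2 (\<lambda>x. 0) = 0"
  by (simp add: zero_l2_def l2_zero_def)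

lemma bvec_void [simp]: "bvec (True, 0) = 0"
proof -
  have "spin (\<lambda>x. 0) (\<lambda>x. 0) = (\<lambda>x. 0)"
    by (rule spin_eqI[symmetric]) auto
  then show ?thesis by (simp add: bvec_def bfun_def abs_l2_zero)
qed

lemma cinner_bvec: "cinner (bvec j) (bvec k) = (if j = k \<and> k \<noteq> (True, 0) then 1 else 0)"
proof -
  have z: "ip f (\<lambda>x. 0) = 0" "ip (\<lambda>x. 0) f = 0" for f by (simp_all add: ip_def)
  obtain s m s' n where jk: "j = (s, m)" "k = (s', n)" by (metis surj_pair)
  show ?thesis
    unfolding jk using schwartz2_sq_integrable[OF bfun_schwartz2]
    by (cases s; cases s'; cases "m = 0"; cases "n = 0")
      (auto simp: bvec_def bfun_def cinner_schwartz2 schwartz_zero hermite_schwartz z ip_hermite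
        schwartz2_sq_integrable simp del: hermite.simps)
qed

lemma norm_bvec: "norm (bvec k) = (if k = (True, 0) then 0 else 1)"
proof -
  have "complex_of_real ((norm (bvec k))\<^sup>2) = complex_of_real (if k = (True, 0) then 0 else 1)"
    unfolding cinner_self[symmetric] cinner_bvec by simp
  then have "(norm (bvec k))\<^sup>2 = (if k = (True, 0) then 0 else 1)"
    unfolding of_real_eq_iff .
  then show ?thesis
    using power2_eq_imp_eq[of "norm (bvec k)" 1] by (auto split: if_splits)
qed

text \<open>Totality is \<open>hermite_total\<close> in each component; the spin-up index is shifted
  by one, so that \<open>(True, Suc n)\<close> tests against \<open>hermite n\<close>.\<close>

lemma hilbert_basis_bvec: "hilbert_basis bvec"
  unfolding hilbert_basis_def
proof (intro conjI allI impI)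
  show "cinner (bvec j) (bvec k) = 0" if "j \<noteq> k" for j k
    using that by (simp add: cinner_bvec)
  show "bvec k = 0 \<or> norm (bvec k) = 1" for k
    by (auto simp: norm_bvec)
  fix x assume x: "\<forall>k. cinner (bvec k) x = 0"
  obtain \<Psi> where \<Psi>: "\<Psi> \<in> sq_integrable" "x = abs_l2 \<Psi>" by (rule l2_representative)
  have z: "ip (\<lambda>x. 0) f = 0" for f by (simp add: ip_def)
  have "ip (hermite n) (\<lambda>x. \<Psi> x $ 1) = 0" for n
    using x[rule_format, of "(True, Suc n)"] \<Psi>
    by (simp add: bvec_def bfun_def cinner_schwartz2 schwartz_zero hermite_schwartz z del: hermite.simps)
  moreover have "ip (hermite n) (\<lambda>x. \<Psi> x $ 2) = 0" for n
    using x[rule_format, of "(False, n)"] \<Psi>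
    by (simp add: bvec_def bfun_def cinner_schwartz2 schwartz_zero hermite_schwartz z del: hermite.simps)
  ultimately have "AE x in lborel. \<Psi> x $ 1 = 0" "AE x in lborel. \<Psi> x $ 2 = 0"
    using \<Psi>(1) unfolding sq_integrable_iff_components by (auto intro!: hermite_total)
  then have "AE x in lborel. \<Psi> x = 0"
    by eventually_elim (simp add: vec_eq_iff forall_2)
  then have "ae_eq \<Psi> (\<lambda>x. 0)"
    using \<Psi>(1) by (simp add: ae_eq_def sq_integrable_zero)
  then show "x = 0"
    using abs_l2_eqI abs_l2_zero \<Psi>(2) by metis
qed

text \<open>Truncated indices are harmless: for m < 2 the coefficient
  \<open>sqrt (real (m - 1))\<close> is 0, and \<open>bvec (True, 0)\<close> is the zero
  vector.\<close>

definition jc_vec :: "real \<Rightarrow> real \<Rightarrow> real \<Rightarrow> real \<Rightarrow> bool \<times> nat \<Rightarrow> l2" where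
  "jc_vec Om om l1 l2 k = (case k of
    (True, m) \<Rightarrow> complex_of_real (Om / 2 + om * (real m - 1)) *\<^sub>C bvec (True, m)
      + (complex_of_real (l1 * sqrt (real m)) *\<^sub>C bvec (False, m)
      + complex_of_real (l2 * sqrt (real (m - 1))) *\<^sub>C bvec (False, m - 2))
  | (False, m) \<Rightarrow> complex_of_real (- Om / 2 + om * real m) *\<^sub>C bvec (False, m)
      + (complex_of_real (l1 * sqrt (real m)) *\<^sub>C bvec (True, m)
      + complex_of_real (l2 * sqrt (real (m + 1))) *\<^sub>C bvec (True, m + 2)))"

lemma jc_vec_mem: "(bvec k, jc_vec Om om l1 l2 k) \<in> op_closure (jc_op Om om l1 l2)"
proof -
  have sq: "bfun k \<in> sq_integrable" "(\<lambda>x. c *s bfun k x) \<in> sq_integrable"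
    "(\<lambda>x. c *s bfun k x + d *s bfun k' x) \<in> sq_integrable" for c d k k'
    by (intro schwartz2_sq_integrable schwartz2_add schwartz2_smult bfun_schwartz2)+
  have comb: "a *\<^sub>C bvec i + (b *\<^sub>C bvec j + c *\<^sub>C bvec k)
      = abs_l2 (\<lambda>x. a *s bfun i x + (b *s bfun j x + c *s bfun k x))" for a b c i j k
    by (simp add: bvec_def abs_l2_scaleC abs_l2_add sq)
  have "jc_vec Om om l1 l2 k = abs_l2 (jc_op Om om l1 l2 (bfun k))"
  proof (cases k)
    case (Pair s m)
    show ?thesis
    proof (cases s)
      case True
      show ?thesis
      proof (cases m)
        case 0
        then have k: "k = (True, 0)" using Pair True by simp
        have "abs_l2 (jc_op Om om l1 l2 (bfun k)) = abs_l2 (\<lambda>x. 0)"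
          unfolding k jc_op_def Let_def
          by (intro arg_cong[where f = abs_l2] spin_eqI[symmetric]) (simp_all add: bfun_def)
        then show ?thesis
          by (simp add: k jc_vec_def abs_l2_zero)
      next
        case (Suc n)
        then have k: "k = (True, Suc n)" using Pair True by simp
        show ?thesis
          unfolding k jc_vec_def prod.case bool.case comb jc_op_def Let_def
          by (intro arg_cong[where f = abs_l2] spin_eqI)
            (simp_all add: bfun_def creat_hermite annih_hermite number_hermite[unfolded annih_hermite One_nat_def] algebra_simps
              del: hermite.simps)
      qed
    next
      case False
      then have k: "k = (False, m)" using Pair by simp
      show ?thesis
        unfolding k jc_vec_def prod.case bool.case comb jc_op_def Let_def
        by (intro arg_cong[where f = abs_l2] spin_eqI)
          (simp_all add: bfun_def creat_hermite annih_hermite number_hermite[unfolded annih_hermite One_nat_def] algebra_simps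
            del: hermite.simps)
    qed
  qed
  then show ?thesis
    using op_closure_memI[OF bfun_schwartz2[of k]] by (simp add: bvec_def)
qed

section \<open>Eigenbases and the rotating-wave dynamics\<close>

text \<open>Unimodular factors preserve square summability, so a vector with these coefficients
  exists for every x, and \<open>fun_calc_eqI\<close> identifies it.\<close>

lemma exp_i_coeff:
  assumes A: "eigenbasis e l A"
  shows "cinner (e k) (exp_i t A x) = exp (\<i> * complex_of_real (t * l k)) * cinner (e k) x"
proof -
  note basis = eigenbasis_hilbert_basis[OF A]
  let ?c = "\<lambda>k. exp (\<i> * complex_of_real (t * l k)) * cinner (e k) x"
  have n: "cmod (exp (\<i> * complex_of_real r)) = 1" for r
    using norm_exp_i_times[of r] by simp
  have "(\<lambda>k. (cmod (?c k))\<^sup>2) summable_on UNIV"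
    using summable_coeff[OF basis, of x] by (simp only: norm_mult n mult_1)
  from has_sum_coeff[OF basis this] obtain y
    where y: "\<And>k. cinner (e k) y = (if e k = 0 then 0 else ?c k)" by blast
  have y': "cinner (e k) y = ?c k" for k
    using y[of k] by auto
  have "exp_i t A x = y"
    unfolding exp_i_def by (rule fun_calc_eqI[OF A _ y']) measurable
  then show ?thesis by (simp only: y')
qed

text \<open>Phrased for differences, this yields both the isometry of the free evolution on the
  difference of U_2 and U_1 and the continuity of the other evolutions.\<close>

lemma norm_exp_i_diff:
  assumes A: "eigenbasis e l A"
  shows "norm (exp_i t A x - exp_i t A y) = norm (x - y)"
proof -
  note basis = eigenbasis_hilbert_basis[OF A]
  have n: "cmod (exp (\<i> * complex_of_real r)) = 1" for r
    using norm_exp_i_times[of r] by simp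
  have "cmod (cinner (e k) (exp_i t A x - exp_i t A y)) = cmod (cinner (e k) (x - y))" for k
    unfolding cinner_diff_right exp_i_coeff[OF A] right_diff_distrib[symmetric] norm_mult n by simp
  then have "(norm (exp_i t A x - exp_i t A y))\<^sup>2 = (norm (x - y))\<^sup>2"
    using Parseval[OF basis, of "exp_i t A x - exp_i t A y"] Parseval[OF basis, of "x - y"]
    by (simp add: has_sum_unique)
  then show ?thesis by (simp add: power2_eq_iff_nonneg)
qed

text \<open>The value -1 at \<open>(True, 0)\<close> belongs to the zero vector.\<close>

definition num_ev :: "bool \<times> nat \<Rightarrow> real" where
  "num_ev k = (if fst k then real (snd k) - 1 else real (snd k))"

lemma number_eigenbasis: "eigenbasis bvec num_ev num_op"
proof -
  have "jc_vec 0 1 0 0 k = complex_of_real (num_ev k) *\<^sub>C bvec k" for k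
    by (cases k) (auto simp: jc_vec_def num_ev_def split: bool.split)
  then show ?thesis
    unfolding num_op_def number_op_eq
    using jc_vec_mem[of _ 0 1 0 0] by (intro eigenbasisI closed_symmetric_jc hilbert_basis_bvec) simp
qed

text \<open>Each part of the perturbation sends basis vectors to multiples of basis vectors.
  Injectivity is asked for only on the support of \<open>a\<close>, because truncated subtraction
  merges indices whose coefficient is 0.\<close>

lemma norm_reindexed_sum_le:
  assumes basis: "hilbert_basis B" and K: "finite K"
    and inj: "inj_on \<pi> {k \<in> K. a k \<noteq> 0}"
    and le: "\<And>k. k \<in> K \<Longrightarrow> cmod (a k) * norm (B (\<pi> k)) \<le> r * (cmod (b k) * norm (B k))" and "r \<ge> 0"
  shows "norm (\<Sum>k\<in>K. a k *\<^sub>C B (\<pi> k)) \<le> r * norm (\<Sum>k\<in>K. b k *\<^sub>C B k)"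
proof -
  let ?K = "{k \<in> K. a k \<noteq> 0}"
  have "(\<Sum>k\<in>K. a k *\<^sub>C B (\<pi> k)) = (\<Sum>k\<in>?K. a k *\<^sub>C B (\<pi> k))"
    using K by (intro sum.mono_neutral_right) auto
  then have "(norm (\<Sum>k\<in>K. a k *\<^sub>C B (\<pi> k)))\<^sup>2 = (norm (\<Sum>k\<in>?K. a k *\<^sub>C B (\<pi> k)))\<^sup>2"
    by simp
  also have "\<dots> = (\<Sum>k\<in>?K. (norm (a k *\<^sub>C B (\<pi> k)))\<^sup>2)"
    by (rule norm_sum_orthogonal) (use inj in \<open>auto simp: basis_cinner[OF basis] inj_on_def\<close>)
  also have "\<dots> \<le> (\<Sum>k\<in>?K. (r * (cmod (b k) * norm (B k)))\<^sup>2)"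
    using le by (intro sum_mono power_mono) auto
  also have "\<dots> \<le> (\<Sum>k\<in>K. (r * (cmod (b k) * norm (B k)))\<^sup>2)"
    using K by (intro sum_mono2) auto
  also have "\<dots> = (r * norm (\<Sum>k\<in>K. b k *\<^sub>C B k))\<^sup>2"
    by (simp add: norm_basis_sum[OF basis] power_mult_distrib sum_distrib_left)
  finally show ?thesis
    by (rule power2_le_imp_le) (simp add: \<open>r \<ge> 0\<close>)
qed

text \<open>Relative to the weight \<open>d\<close>, the bounded diagonal part, the rotating and the
  counter-rotating coupling each cost at most 1/6, which adds up to the 1/2 allowed. The couplings
  grow only like sqrt m, so a large shift \<open>\<mu>\<close> achieves this for every coupling
  strength.\<close>

lemma rabi_eigenbasis:
  assumes lam: "lam \<ge> 0" and Om: "Om \<ge> 0" and om: "om > 0"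
  obtains e :: "l2 \<Rightarrow> l2" and l where "eigenbasis e l (op_closure (jc_op Om om lam lam))"
proof -
  \<comment> \<open>\<open>w\<close> is what completing the square leaves in
    \<open>6 * (lam * sqrt n) \<le> om * n + w\<close>. In \<open>\<mu>\<close>, 3 Om + 6 om covers
    six times the diagonal part \<open>\<alpha>\<close>, and one more om the index n + 1 of the
    raising hop.\<close>
  define w where "w = 9 * lam\<^sup>2 / om"
  define \<mu> where "\<mu> = 1 + 7 * om + w + 3 * Om"
  have w: "w \<ge> 0" using om by (simp add: w_def)
  define d where "d k = om * real (snd k) + \<mu>" for k :: "bool \<times> nat"
  define \<alpha> where "\<alpha> k = (if fst k then Om / 2 - om else - Om / 2)" for k :: "bool \<times> nat"
  define \<gamma> where "\<gamma> k = lam * sqrt (real (snd k))" for k :: "bool \<times> nat"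
  define \<beta> where "\<beta> k = lam * sqrt (real (if fst k then snd k - 1 else snd k + 1))" for k :: "bool \<times> nat"
  define flip :: "bool \<times> nat \<Rightarrow> bool \<times> nat" where "flip k = (\<not> fst k, snd k)" for k
  define hop :: "bool \<times> nat \<Rightarrow> bool \<times> nat" where "hop k = (if fst k then (False, snd k - 2) else (True, snd k + 2))" for k
  have \<mu>: "\<mu> \<ge> 1" using om Om w by (simp add: \<mu>_def)
  have lam_le: "6 * (lam * sqrt (real n)) \<le> om * real n + w" for n
  proof -
    have "0 \<le> om * (sqrt (real n) - 3 * lam / om)\<^sup>2" using om by simp
    also have "\<dots> = om * real n - 6 * (lam * sqrt (real n)) + w"
      using om by (simp add: w_def power2_diff power_divide power_mult_distrib field_simps power2_eq_square)
    finally show ?thesis by simp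
  qed
  have d: "d k > 0" "d k \<ge> 1" for k using \<mu> om by (simp_all add: d_def add_nonneg_pos add_increasing)
  have coeff: "\<bar>\<alpha> k\<bar> \<le> 1/6 * d k" "\<bar>\<gamma> k\<bar> \<le> 1/6 * d k" "\<bar>\<beta> k\<bar> \<le> 1/6 * d k" for k
  proof -
    have nn: "w \<ge> 0" "om * real (snd k) \<ge> 0" using om w by auto
    show "\<bar>\<alpha> k\<bar> \<le> 1/6 * d k"
    proof -
      have "\<bar>\<alpha> k\<bar> \<le> Om / 2 + om" using Om om by (auto simp: \<alpha>_def abs_le_iff)
      then have "6 * \<bar>\<alpha> k\<bar> \<le> d k" unfolding d_def \<mu>_def using nn Om om by linarith
      then show ?thesis by simp
    qed
    show "\<bar>\<gamma> k\<bar> \<le> 1/6 * d k"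
      using nn lam_le[of "snd k"] Om om lam unfolding \<gamma>_def d_def \<mu>_def by (simp add: abs_mult)
    have "om * real (snd k - 1) \<le> om * real (snd k)" using om by simp
    moreover have "om * real (snd k + 1) = om * real (snd k) + om"
      by (simp add: algebra_simps)
    moreover have "\<bar>\<beta> k\<bar> = lam * sqrt (real (snd k - 1)) \<or> \<bar>\<beta> k\<bar> = lam * sqrt (real (snd k + 1))"
      using lam by (simp add: \<beta>_def abs_mult)
    ultimately have "6 * \<bar>\<beta> k\<bar> \<le> d k"
      using nn lam_le[of "snd k + 1"] lam_le[of "snd k - 1"] Om om unfolding d_def \<mu>_def
      by linarith
    then show "\<bar>\<beta> k\<bar> \<le> 1/6 * d k" by simp
  qed
  have W: "jc_vec Om om lam lam k + complex_of_real \<mu> *\<^sub>C bvec k - complex_of_real (d k) *\<^sub>C bvec k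
      = complex_of_real (\<alpha> k) *\<^sub>C bvec k + (complex_of_real (\<gamma> k) *\<^sub>C bvec (flip k) + complex_of_real (\<beta> k) *\<^sub>C bvec (hop k))" for k
  proof (cases k)
    case (Pair s m)
    show ?thesis
      unfolding Pair jc_vec_def \<alpha>_def \<gamma>_def \<beta>_def flip_def hop_def d_def
      by (cases s) (simp_all add: scaleC_add_left scaleC_diff_left scaleC_minus_left algebra_simps del: of_nat_Suc)
  qed
  show thesis
  proof (rule relatively_bounded_eigenbasis[OF closed_symmetric_jc hilbert_basis_bvec jc_vec_mem d(2)])
    fix r
    have "{k. d k \<le> r} \<subseteq> UNIV \<times> {..nat \<lceil>r / om\<rceil>}"
    proof
      fix k assume "k \<in> {k. d k \<le> r}"
      then have "om * real (snd k) \<le> r" using \<mu> by (simp add: d_def)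
      then have "real (snd k) \<le> r / om" using om by (simp add: field_simps)
      then have "snd k \<le> nat \<lceil>r / om\<rceil>" by linarith
      then show "k \<in> UNIV \<times> {..nat \<lceil>r / om\<rceil>}" by (simp add: mem_Times_iff)
    qed
    then show "finite {k. d k \<le> r}" by (rule finite_subset) simp
  next
    fix K :: "(bool \<times> nat) set" and c assume K: "finite K"
    let ?N = "norm (\<Sum>k\<in>K. (c k * complex_of_real (d k)) *\<^sub>C bvec k)"
    \<comment> \<open>At the void index the right side is 0, so the left side has to vanish there as
      well; this is the purpose of the second condition.\<close>
    have le: "cmod (c k * complex_of_real (a k)) * norm (bvec (\<pi> k)) \<le> 1/6 * (cmod (c k * complex_of_real (d k)) * norm (bvec k))"
      if "\<bar>a k\<bar> \<le> 1/6 * d k" "k = (True, 0) \<Longrightarrow> a k = 0 \<or> \<pi> k = (True, 0)" for k a \<pi>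
    proof (cases "k = (True, 0)")
      case False
      have "cmod (c k * complex_of_real (a k)) * norm (bvec (\<pi> k)) \<le> cmod (c k) * \<bar>a k\<bar> * 1"
        unfolding norm_mult norm_of_real by (intro mult_left_mono) (auto simp: norm_bvec)
      also have "\<dots> \<le> cmod (c k) * (1/6 * d k)" 
        unfolding mult_1_right by (intro mult_left_mono that(1)) simp
      finally show ?thesis using False d(1)[of k] by (simp add: norm_bvec norm_mult)
    qed (use that in \<open>auto simp: norm_bvec\<close>)
    have S1: "norm (\<Sum>k\<in>K. (c k * complex_of_real (\<alpha> k)) *\<^sub>C bvec (id k)) \<le> 1/6 * ?N"
    proof (rule norm_reindexed_sum_le[OF hilbert_basis_bvec K])
      show "cmod (c k * complex_of_real (\<alpha> k)) * norm (bvec (id k)) \<le> 1/6 * (cmod (c k * complex_of_real (d k)) * norm (bvec k))" for k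
        by (rule le[OF coeff(1)]) simp
    qed auto
    have S2: "norm (\<Sum>k\<in>K. (c k * complex_of_real (\<gamma> k)) *\<^sub>C bvec (flip k)) \<le> 1/6 * ?N"
    proof (rule norm_reindexed_sum_le[OF hilbert_basis_bvec K])
      show "cmod (c k * complex_of_real (\<gamma> k)) * norm (bvec (flip k)) \<le> 1/6 * (cmod (c k * complex_of_real (d k)) * norm (bvec k))" for k
        by (rule le[OF coeff(2)]) (simp add: \<gamma>_def)
    qed (auto simp: inj_on_def flip_def)
    have S3: "norm (\<Sum>k\<in>K. (c k * complex_of_real (\<beta> k)) *\<^sub>C bvec (hop k)) \<le> 1/6 * ?N"
    proof (rule norm_reindexed_sum_le[OF hilbert_basis_bvec K])
      show "cmod (c k * complex_of_real (\<beta> k)) * norm (bvec (hop k)) \<le> 1/6 * (cmod (c k * complex_of_real (d k)) * norm (bvec k))" for k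
        by (rule le[OF coeff(3)]) (simp add: \<beta>_def)
      show "inj_on hop {k \<in> K. c k * complex_of_real (\<beta> k) \<noteq> 0}"
      proof (rule inj_onI)
        fix j k assume "j \<in> {k \<in> K. c k * complex_of_real (\<beta> k) \<noteq> 0}" "k \<in> {k \<in> K. c k * complex_of_real (\<beta> k) \<noteq> 0}"
          and eq: "hop j = hop k"
        then have "\<beta> j \<noteq> 0" "\<beta> k \<noteq> 0" by auto
        then show "j = k"
          using eq by (cases j; cases k; cases "fst j"; cases "fst k") (auto simp: hop_def \<beta>_def)
      qed
    qed simp
    have "(\<Sum>k\<in>K. c k *\<^sub>C (jc_vec Om om lam lam k + complex_of_real \<mu> *\<^sub>C bvec k - complex_of_real (d k) *\<^sub>C bvec k))
        = (\<Sum>k\<in>K. (c k * complex_of_real (\<alpha> k)) *\<^sub>C bvec (id k))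
        + ((\<Sum>k\<in>K. (c k * complex_of_real (\<gamma> k)) *\<^sub>C bvec (flip k))
        + (\<Sum>k\<in>K. (c k * complex_of_real (\<beta> k)) *\<^sub>C bvec (hop k)))" (is "?L = ?A + (?B + ?C)")
      unfolding W by (simp add: scaleC_add_right sum.distrib)
    then have "norm ?L \<le> norm ?A + (norm ?B + norm ?C)"
      by (metis (no_types, lifting) norm_triangle_le norm_triangle_ineq add_left_mono)
    then show "norm ?L \<le> 1/2 * norm (\<Sum>k\<in>K. c k *\<^sub>C complex_of_real (d k) *\<^sub>C bvec k)"
      using S1 S2 S3 by simp
  qed (rule that)
qed

text \<open>A rotation diagonalises the matrix with rows (p, g) and (g, q): (c, s) is the
  eigenvector for E and (-s, c) the one for F. An uncoupled sector is left alone (c = 1, s = 0),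
  which keeps the void vector void.\<close>

lemma symmetric_2x2_eigen:
  fixes p q g :: real
  obtains c s E F where "c\<^sup>2 + s\<^sup>2 = 1" "p * c + g * s = E * c" "g * c + q * s = E * s"
    "p * s - g * c = F * s" "q * c - g * s = F * c" "g = 0 \<Longrightarrow> c = 1 \<and> s = 0"
proof (cases "g = 0")
  case True
  show thesis by (rule that[of 1 0 p q]) (use True in auto)
next
  case False
  define \<delta> where "\<delta> = (p - q) / 2"
  define r where "r = sqrt (\<delta>\<^sup>2 + g\<^sup>2)"
  \<comment> \<open>This is the characteristic equation, factored after subtracting half the trace;
    it makes (g, r - \<delta>) an eigenvector, up to the length n.\<close>
  have r: "(r + \<delta>) * (r - \<delta>) = g * g"
    by (simp add: r_def algebra_simps power2_eq_square[symmetric])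
  define n where "n = sqrt (g\<^sup>2 + (r - \<delta>)\<^sup>2)"
  have "n\<^sup>2 = g\<^sup>2 + (r - \<delta>)\<^sup>2" by (simp add: n_def)
  moreover have "n > 0" using False by (simp add: n_def sum_power2_gt_zero_iff)
  ultimately have n: "(g / n)\<^sup>2 + ((r - \<delta>) / n)\<^sup>2 = 1"
    using False by (simp add: power_divide add_divide_distrib[symmetric])
  have pq: "p = q + 2 * \<delta>" by (simp add: \<delta>_def field_simps)
  show thesis
  proof (rule that[of "g / n" "(r - \<delta>) / n" "q + \<delta> + r" "q + \<delta> - r"])
    show "(g / n)\<^sup>2 + ((r - \<delta>) / n)\<^sup>2 = 1" by (rule n)
    show "g * (g / n) + q * ((r - \<delta>) / n) = (q + \<delta> + r) * ((r - \<delta>) / n)"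
      using \<open>n > 0\<close> r by (simp add: field_simps)
    show "p * ((r - \<delta>) / n) - g * (g / n) = (q + \<delta> - r) * ((r - \<delta>) / n)"
      using \<open>n > 0\<close> r unfolding pq by (simp add: field_simps)
  qed (use False \<open>n > 0\<close> in \<open>simp_all add: pq field_simps\<close>)
qed

lemma norm_rotation:
  fixes x y :: complex
  assumes "c\<^sup>2 + s\<^sup>2 = (1 :: real)"
  shows "(cmod (of_real c * x - of_real s * y))\<^sup>2 + (cmod (of_real s * x + of_real c * y))\<^sup>2 = (cmod x)\<^sup>2 + (cmod y)\<^sup>2"
proof -
  have "(cmod (of_real c * x - of_real s * y))\<^sup>2 + (cmod (of_real s * x + of_real c * y))\<^sup>2
      = (c\<^sup>2 + s\<^sup>2) * ((cmod x)\<^sup>2 + (cmod y)\<^sup>2)"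
    unfolding cmod_power2 by (simp add: power2_eq_square algebra_simps)
  then show ?thesis using assms by simp
qed

lemma cinner_bvec_sum:
  assumes "m \<le> M"
  shows "cinner (bvec (True, m)) (\<Sum>m\<le>M. u m *\<^sub>C bvec (True, m) + v m *\<^sub>C bvec (False, m)) = (if m = 0 then 0 else u m)"
    and "cinner (bvec (False, m)) (\<Sum>m\<le>M. u m *\<^sub>C bvec (True, m) + v m *\<^sub>C bvec (False, m)) = v m"
proof -
  have "cinner (bvec (True, m)) (\<Sum>m\<le>M. u m *\<^sub>C bvec (True, m) + v m *\<^sub>C bvec (False, m))
      = (\<Sum>n\<le>M. if n = m then (if m = 0 then 0 else u m) else 0)"
    unfolding cinner_sum_right by (intro sum.cong) (auto simp: cinner_add_right cinner_bvec)
  then show "cinner (bvec (True, m)) (\<Sum>m\<le>M. u m *\<^sub>C bvec (True, m) + v m *\<^sub>C bvec (False, m)) = (if m = 0 then 0 else u m)"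
    using assms by (simp add: sum.delta)
  have "cinner (bvec (False, m)) (\<Sum>m\<le>M. u m *\<^sub>C bvec (True, m) + v m *\<^sub>C bvec (False, m))
      = (\<Sum>n\<le>M. if n = m then v m else 0)"
    unfolding cinner_sum_right by (intro sum.cong) (auto simp: cinner_add_right cinner_bvec)
  then show "cinner (bvec (False, m)) (\<Sum>m\<le>M. u m *\<^sub>C bvec (True, m) + v m *\<^sub>C bvec (False, m)) = v m"
    using assms by (simp add: sum.delta)
qed

lemma cinner_bvec_sum_beyond:
  assumes "m > M"
  shows "cinner (bvec (s, m)) (\<Sum>m\<le>M. u m *\<^sub>C bvec (True, m) + v m *\<^sub>C bvec (False, m)) = 0"
  unfolding cinner_sum_right using assms by (intro sum.neutral) (auto simp: cinner_add_right cinner_bvec)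

text \<open>The rotating-wave Hamiltonian preserves each sector of fixed excitation number, where it acts as
  a symmetric matrix of size two.\<close>

definition rwa_up :: "real \<Rightarrow> real \<Rightarrow> nat \<Rightarrow> real" where
  "rwa_up Om om m = Om / 2 + om * (real m - 1)"

definition rwa_down :: "real \<Rightarrow> real \<Rightarrow> nat \<Rightarrow> real" where
  "rwa_down Om om m = - Om / 2 + om * real m"

text \<open>\<open>u 0\<close> is required to vanish because a coefficient at the void index is
  invisible in the vector but would count in the conserved sector weight.\<close>

definition rwa_evolution :: "real \<Rightarrow> real \<Rightarrow> real \<Rightarrow> nat \<Rightarrow> (nat \<Rightarrow> complex) \<Rightarrow> (nat \<Rightarrow> complex) \<Rightarrow>
    (nat \<Rightarrow> real \<Rightarrow> complex) \<Rightarrow> (nat \<Rightarrow> real \<Rightarrow> complex) \<Rightarrow> bool" where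
  "rwa_evolution Om om lam M u0 v0 u v \<longleftrightarrow> (\<forall>m. u m 0 = u0 m \<and> v m 0 = v0 m) \<and> (\<forall>t. u 0 t = 0) \<and>
      (\<forall>m t. (u m has_vector_derivative - \<i> * (of_real (rwa_up Om om m) * u m t + of_real (lam * sqrt (real m)) * v m t)) (at t)) \<and>
      (\<forall>m t. (v m has_vector_derivative - \<i> * (of_real (lam * sqrt (real m)) * u m t + of_real (rwa_down Om om m) * v m t)) (at t)) \<and>
      (\<forall>m t. (cmod (u m t))\<^sup>2 + (cmod (v m t))\<^sup>2 = (cmod (u0 m))\<^sup>2 + (cmod (v0 m))\<^sup>2) \<and>
      (\<forall>t. exp_i (- t) (op_closure (jc_op Om om lam 0)) (\<Sum>m\<le>M. u0 m *\<^sub>C bvec (True, m) + v0 m *\<^sub>C bvec (False, m))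
        = (\<Sum>m\<le>M. u m t *\<^sub>C bvec (True, m) + v m t *\<^sub>C bvec (False, m)))"

text \<open>Rotating each sector into its eigenbasis reduces the flow to two phases, with
  frequencies E and F; rotating back gives \<open>u\<close> and \<open>v\<close>. Rotation and
  phases both preserve the sector weight.\<close>

lemma rwa_dynamics:
  obtains e :: "bool \<times> nat \<Rightarrow> l2" and l where "eigenbasis e l (op_closure (jc_op Om om lam 0))"
    and "\<And>u0 v0 M. u0 0 = 0 \<Longrightarrow> \<exists>u v. rwa_evolution Om om lam M u0 v0 u v"
proof -
  define g where "g m = lam * sqrt (real m)" for m
  define p q where "p = rwa_up Om om" and "q = rwa_down Om om"
  define P where "P m c s E F \<longleftrightarrow> c\<^sup>2 + s\<^sup>2 = 1 \<and> p m * c + g m * s = E * c \<and> g m * c + q m * s = E * s \<and>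
      p m * s - g m * c = F * s \<and> q m * c - g m * s = F * c \<and> (g m = 0 \<longrightarrow> c = 1 \<and> s = 0)" for m c s E F
  have "\<exists>c s E F. P m c s E F" for m
    unfolding P_def by (rule symmetric_2x2_eigen[where p = "p m" and q = "q m" and g = "g m"]) blast
  then obtain c s E F where "\<And>m. P m (c m) (s m) (E m) (F m)"
    by metis
  then have cs: "\<And>m. (c m)\<^sup>2 + (s m)\<^sup>2 = 1"
    and eig: "\<And>m. p m * c m + g m * s m = E m * c m" "\<And>m. g m * c m + q m * s m = E m * s m"
      "\<And>m. p m * s m - g m * c m = F m * s m" "\<And>m. q m * c m - g m * s m = F m * c m"
    and c0: "\<And>m. g m = 0 \<Longrightarrow> c m = 1 \<and> s m = 0"
    unfolding P_def by blast+
  have cs0: "c 0 = 1" "s 0 = 0" using c0[of 0] by (auto simp: g_def)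
  have csC: "complex_of_real (c m) * complex_of_real (c m) + complex_of_real (s m) * complex_of_real (s m) = 1" for m
    using arg_cong[OF cs[of m], of complex_of_real] by (simp add: power2_eq_square)
  have eigC: "of_real (p m) * of_real (c m) + of_real (g m) * of_real (s m) = of_real (E m) * complex_of_real (c m)"
    "of_real (g m) * of_real (c m) + of_real (q m) * of_real (s m) = of_real (E m) * complex_of_real (s m)"
    "of_real (p m) * of_real (s m) - of_real (g m) * of_real (c m) = of_real (F m) * complex_of_real (s m)"
    "of_real (q m) * of_real (c m) - of_real (g m) * of_real (s m) = of_real (F m) * complex_of_real (c m)" for m
    using arg_cong[OF eig(1)[of m], of complex_of_real] arg_cong[OF eig(2)[of m], of complex_of_real]
      arg_cong[OF eig(3)[of m], of complex_of_real] arg_cong[OF eig(4)[of m], of complex_of_real] by simp_all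
  define e where "e k = (if fst k
    then of_real (c (snd k)) *\<^sub>C bvec (True, snd k) + of_real (s (snd k)) *\<^sub>C bvec (False, snd k)
    else (- of_real (s (snd k))) *\<^sub>C bvec (True, snd k) + of_real (c (snd k)) *\<^sub>C bvec (False, snd k))" for k
  define l where "l k = (if fst k then E (snd k) else F (snd k))" for k :: "bool \<times> nat"
  let ?A = "op_closure (jc_op Om om lam 0)"
  have e0: "e (True, 0) = 0" by (simp add: e_def cs0)
  have basis: "hilbert_basis e"
    unfolding hilbert_basis_def
  proof (intro conjI allI impI)
    fix j k :: "bool \<times> nat" assume "j \<noteq> k"
    then show "cinner (e j) (e k) = 0"
      using cs0 by (cases j; cases k) (auto simp: e_def cinner_add_left cinner_add_right cinner_bvec mult.commute)
  next
    fix k :: "bool \<times> nat"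
    show "e k = 0 \<or> norm (e k) = 1"
    proof (cases "k = (True, 0)")
      case False
      then have "cinner (e k) (e k) = 1"
        using cs0 csC[of "snd k"]
        by (cases k) (auto simp: e_def cinner_add_left cinner_add_right cinner_bvec add.commute)
      then have "complex_of_real ((norm (e k))\<^sup>2) = complex_of_real 1"
        unfolding cinner_self by simp
      then have "(norm (e k))\<^sup>2 = 1" unfolding of_real_eq_iff .
      then show ?thesis using power2_eq_imp_eq[of "norm (e k)" 1] by simp
    qed (simp add: e0)
  next
    fix x assume x: "\<forall>k. cinner (e k) x = 0"
    show "x = 0"
    proof (rule basis_eqI[OF hilbert_basis_bvec])
      fix k :: "bool \<times> nat"
      obtain b m where k: "k = (b, m)" by (cases k)
      have 1: "of_real (c m) * cinner (bvec (True, m)) x + of_real (s m) * cinner (bvec (False, m)) x = 0"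
        using x[rule_format, of "(True, m)"] by (simp add: e_def cinner_add_left)
      have 2: "of_real (c m) * cinner (bvec (False, m)) x - of_real (s m) * cinner (bvec (True, m)) x = 0"
        using x[rule_format, of "(False, m)"] by (simp add: e_def cinner_add_left)
      have "(of_real (c m) * of_real (c m) + of_real (s m) * of_real (s m)) * cinner (bvec (True, m)) x
          = of_real (c m) * (of_real (c m) * cinner (bvec (True, m)) x + of_real (s m) * cinner (bvec (False, m)) x)
          - of_real (s m) * (of_real (c m) * cinner (bvec (False, m)) x - of_real (s m) * cinner (bvec (True, m)) x)"
        by (simp add: algebra_simps)
      then have up: "cinner (bvec (True, m)) x = 0" unfolding 1 2 csC by simp
      have "(of_real (c m) * of_real (c m) + of_real (s m) * of_real (s m)) * cinner (bvec (False, m)) x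
          = of_real (s m) * (of_real (c m) * cinner (bvec (True, m)) x + of_real (s m) * cinner (bvec (False, m)) x)
          + of_real (c m) * (of_real (c m) * cinner (bvec (False, m)) x - of_real (s m) * cinner (bvec (True, m)) x)"
        by (simp add: algebra_simps)
      then have "cinner (bvec (False, m)) x = 0" unfolding 1 2 csC by simp
      then show "cinner (bvec k) x = cinner (bvec k) 0" using up k by (cases b) auto
    qed
  qed
  have Tup: "jc_vec Om om lam 0 (True, m) = of_real (p m) *\<^sub>C bvec (True, m) + of_real (g m) *\<^sub>C bvec (False, m)" for m
    by (simp add: jc_vec_def p_def rwa_up_def g_def)
  have Tdown: "jc_vec Om om lam 0 (False, m) = of_real (g m) *\<^sub>C bvec (True, m) + of_real (q m) *\<^sub>C bvec (False, m)" for m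
    by (simp add: jc_vec_def q_def rwa_down_def g_def add.commute)
  have comb: "(a *\<^sub>C bvec (True, m) + b *\<^sub>C bvec (False, m),
      (a * of_real (p m) + b * of_real (g m)) *\<^sub>C bvec (True, m) + (a * of_real (g m) + b * of_real (q m)) *\<^sub>C bvec (False, m)) \<in> ?A" for a b m
  proof -
    have "(a *\<^sub>C bvec (True, m) + b *\<^sub>C bvec (False, m), a *\<^sub>C jc_vec Om om lam 0 (True, m) + b *\<^sub>C jc_vec Om om lam 0 (False, m)) \<in> ?A"
      using closed_symmetric_jc[of Om om lam 0] jc_vec_mem[of "(True, m)" Om om lam 0] jc_vec_mem[of "(False, m)" Om om lam 0]
      unfolding closed_symmetric_def by blast
    then show ?thesis
      by (simp add: Tup Tdown scaleC_add_right scaleC_add_left algebra_simps)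
  qed
  have "(e k, complex_of_real (l k) *\<^sub>C e k) \<in> ?A" for k
  proof (cases k)
    case (Pair b m)
    show ?thesis
    proof (cases b)
      case True
      have "of_real (c m) * of_real (p m) + of_real (s m) * of_real (g m) = of_real (E m) * complex_of_real (c m)"
        "of_real (c m) * of_real (g m) + of_real (s m) * of_real (q m) = of_real (E m) * complex_of_real (s m)"
        using eigC(1,2)[of m] by (simp_all add: mult.commute)
      then show ?thesis
        using comb[of "of_real (c m)" m "of_real (s m)"] True Pair by (simp add: e_def l_def scaleC_add_right)
    next
      case False
      have "- of_real (s m) * of_real (p m) + of_real (c m) * of_real (g m) = of_real (F m) * (- complex_of_real (s m))"
        "- of_real (s m) * of_real (g m) + of_real (c m) * of_real (q m) = of_real (F m) * complex_of_real (c m)"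
        using eigC(3,4)[of m] by (simp_all add: mult.commute algebra_simps)
      then show ?thesis
        using comb[of "- of_real (s m)" m "of_real (c m)"] False Pair by (simp only: e_def l_def scaleC_add_right fst_conv snd_conv if_False scaleC_scaleC)
    qed
  qed
  then have A: "eigenbasis e l ?A"
    by (intro eigenbasisI closed_symmetric_jc basis)
  show thesis
  proof (rule that[OF A])
    fix u0 v0 :: "nat \<Rightarrow> complex" and M :: nat
    assume u00: "u0 0 = 0"
    define a where "a m = of_real (c m) * u0 m + of_real (s m) * v0 m" for m
    define b where "b m = of_real (c m) * v0 m - of_real (s m) * u0 m" for m
    define ea where "ea m t = a m * exp (\<i> * complex_of_real (- t * E m))" for m t
    define eb where "eb m t = b m * exp (\<i> * complex_of_real (- t * F m))" for m t
    define u where "u m t = of_real (c m) * ea m t - of_real (s m) * eb m t" for m t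
    define v where "v m t = of_real (s m) * ea m t + of_real (c m) * eb m t" for m t
    have dexp: "((\<lambda>t. exp (\<i> * complex_of_real (- t * r))) has_vector_derivative
        - \<i> * of_real r * exp (\<i> * complex_of_real (- t * r))) (at t)" for r t
    proof -
      have "((\<lambda>z. exp (\<i> * (- z * of_real r))) has_field_derivative - \<i> * of_real r * exp (\<i> * (- of_real t * of_real r))) (at (of_real t))"
        by (auto intro!: derivative_eq_intros)
      from has_vector_derivative_real_field[OF this] show ?thesis by simp
    qed
    have dea: "(ea m has_vector_derivative - \<i> * of_real (E m) * ea m t) (at t)" for m t
      using has_vector_derivative_mult_right[OF dexp[of "E m" t], of "a m"]
      by (simp add: ea_def[abs_def] mult_ac)
    have deb: "(eb m has_vector_derivative - \<i> * of_real (F m) * eb m t) (at t)" for m t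
      using has_vector_derivative_mult_right[OF dexp[of "F m" t], of "b m"]
      by (simp add: eb_def[abs_def] mult_ac)
    show "\<exists>u v. rwa_evolution Om om lam M u0 v0 u v"
      unfolding rwa_evolution_def
    proof (rule exI[of _ u], rule exI[of _ v], intro conjI allI)
      fix t
      show "u 0 t = 0" by (simp add: u_def cs0 ea_def a_def u00)
    next
      fix m t
      have "of_real (c m) * a m - of_real (s m) * b m = (of_real (c m) * of_real (c m) + of_real (s m) * of_real (s m)) * u0 m"
        by (simp add: a_def b_def algebra_simps)
      then show "u m 0 = u0 m" unfolding csC by (simp add: u_def ea_def eb_def)
      have "of_real (s m) * a m + of_real (c m) * b m = (of_real (c m) * of_real (c m) + of_real (s m) * of_real (s m)) * v0 m"
        by (simp add: a_def b_def algebra_simps)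
      then show "v m 0 = v0 m" unfolding csC by (simp add: v_def ea_def eb_def)
      have "- \<i> * (of_real (rwa_up Om om m) * u m t + of_real (lam * sqrt (real m)) * v m t)
          = - \<i> * ((of_real (p m) * of_real (c m) + of_real (g m) * of_real (s m)) * ea m t
            - (of_real (p m) * of_real (s m) - of_real (g m) * of_real (c m)) * eb m t)"
        unfolding p_def[symmetric] g_def[symmetric] u_def v_def by (simp add: algebra_simps)
      also have "\<dots> = of_real (c m) * (- \<i> * of_real (E m) * ea m t) - of_real (s m) * (- \<i> * of_real (F m) * eb m t)"
        unfolding eigC by (simp add: algebra_simps)
      finally show "(u m has_vector_derivative - \<i> * (of_real (rwa_up Om om m) * u m t + of_real (lam * sqrt (real m)) * v m t)) (at t)"
        unfolding u_def[abs_def] by (simp only:) (intro has_vector_derivative_diff has_vector_derivative_mult_right dea deb)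
      have "- \<i> * (of_real (lam * sqrt (real m)) * u m t + of_real (rwa_down Om om m) * v m t)
          = - \<i> * ((of_real (g m) * of_real (c m) + of_real (q m) * of_real (s m)) * ea m t
            + (of_real (q m) * of_real (c m) - of_real (g m) * of_real (s m)) * eb m t)"
        unfolding q_def[symmetric] g_def[symmetric] u_def v_def by (simp add: algebra_simps)
      also have "\<dots> = of_real (s m) * (- \<i> * of_real (E m) * ea m t) + of_real (c m) * (- \<i> * of_real (F m) * eb m t)"
        unfolding eigC by (simp add: algebra_simps)
      finally show "(v m has_vector_derivative - \<i> * (of_real (lam * sqrt (real m)) * u m t + of_real (rwa_down Om om m) * v m t)) (at t)"
        unfolding v_def[abs_def] by (simp only:) (intro has_vector_derivative_add has_vector_derivative_mult_right dea deb)
      have n: "cmod (exp (\<i> * complex_of_real r)) = 1" for r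
        using norm_exp_i_times[of r] by simp
      have "(cmod (u m t))\<^sup>2 + (cmod (v m t))\<^sup>2 = (cmod (a m))\<^sup>2 + (cmod (b m))\<^sup>2"
        unfolding u_def v_def norm_rotation[OF cs] ea_def eb_def norm_mult n by simp
      also have "\<dots> = (cmod (u0 m))\<^sup>2 + (cmod (v0 m))\<^sup>2"
        using norm_rotation[OF cs, of m "v0 m" "u0 m"] by (simp add: a_def b_def add.commute)
      finally show "(cmod (u m t))\<^sup>2 + (cmod (v m t))\<^sup>2 = (cmod (u0 m))\<^sup>2 + (cmod (v0 m))\<^sup>2" .
    next
      fix t
      let ?x = "\<Sum>m\<le>M. u0 m *\<^sub>C bvec (True, m) + v0 m *\<^sub>C bvec (False, m)"
      let ?y = "\<Sum>m\<le>M. u m t *\<^sub>C bvec (True, m) + v m t *\<^sub>C bvec (False, m)"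
      show "exp_i (- t) ?A ?x = ?y"
      proof (rule basis_eqI[OF basis])
        fix k :: "bool \<times> nat"
        obtain \<sigma> m where k: "k = (\<sigma>, m)" by (cases k)
        have "cinner (e k) ?y = exp (\<i> * complex_of_real (- t * l k)) * cinner (e k) ?x"
        proof (cases "m \<le> M")
          case False
          then show ?thesis
            unfolding k by (simp add: e_def cinner_add_left cinner_bvec_sum_beyond)
        next
          case True
          have "of_real (c m) * u m t + of_real (s m) * v m t = (of_real (c m) * of_real (c m) + of_real (s m) * of_real (s m)) * ea m t"
            "of_real (c m) * v m t - of_real (s m) * u m t = (of_real (c m) * of_real (c m) + of_real (s m) * of_real (s m)) * eb m t"
            by (simp_all add: u_def v_def algebra_simps)
          then have uv: "of_real (c m) * u m t + of_real (s m) * v m t = ea m t"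
            "of_real (c m) * v m t - of_real (s m) * u m t = eb m t"
            unfolding csC by simp_all
          have u0z: "u 0 t = 0" by (simp add: u_def cs0 ea_def a_def u00)
          have "cinner (e k) ?y = (if \<sigma> then ea m t else eb m t)"
            unfolding uv[symmetric] k e_def using True u0z
            by (simp add: cinner_add_left cinner_bvec_sum)
          moreover have "cinner (e k) ?x = (if \<sigma> then a m else b m)"
            unfolding a_def b_def k e_def using True u00
            by (simp add: cinner_add_left cinner_bvec_sum)
          ultimately show ?thesis
            by (simp add: k l_def ea_def eb_def mult.commute)
        qed
        then show "cinner (e k) (exp_i (- t) ?A ?x) = cinner (e k) ?y"
          unfolding exp_i_coeff[OF A] by simp
      qed
    qed
  qed
qed

section \<open>Integration by parts in the interaction picture\<close>

text \<open>Here \<open>x, y, xm, ym, xp, yp\<close> stand for the coefficients of an eigenvector of the full Hamiltonian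
  with eigenvalue \<open>L\<close> in the sectors \<open>m\<close>, \<open>m - 2\<close> and \<open>m + 2\<close>.\<close>

lemma interaction_term_derivative:
  fixes u v :: "real \<Rightarrow> complex" and x y xm ym xp yp p q g gm gp k n L W w :: complex and om :: real
  assumes du: "(u has_vector_derivative - \<i> * (p * u s + g * v s)) (at s)"
    and dv: "(v has_vector_derivative - \<i> * (g * u s + q * v s)) (at s)"
    and x: "L * x = p * x + g * y + 2 * of_real om * k * ym"
    and y: "L * y = q * y + g * x + 2 * of_real om * n * xp"
    and ym: "k * (L * ym) = k * ((p - w - of_real om) * ym + gm * xm + 2 * of_real om * k * x)"
    and xp: "L * xp = (q + w + of_real om) * xp + gp * yp + 2 * of_real om * n * y"
  defines "P \<equiv> \<lambda>s. exp (\<i> * of_real (2 * om * s))" and "Q \<equiv> \<lambda>s. exp (\<i> * of_real (- (2 * om * s)))"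
  shows "((\<lambda>s. exp (\<i> * (of_real s * L)) * (u s * x + v s * y - k * ym * (u s * (P s - 1)) - n * xp * (v s * (1 - Q s))))
    has_vector_derivative exp (\<i> * (of_real s * L)) * (- \<i> *
      ((P s - 1) * k * (u s * (gm * xm + 2 * of_real om * k * x - (w - of_real om) * ym) - g * v s * ym)
      + (1 - Q s) * n * (v s * (gp * yp + 2 * of_real om * n * y + (w - of_real om) * xp) - g * u s * xp)))) (at s)"
proof -
  let ?E = "exp (\<i> * (of_real s * L))"
  define B where "B s = u s * x + v s * y - k * ym * (u s * (P s - 1)) - n * xp * (v s * (1 - Q s))" for s
  define u' v' where "u' = - \<i> * (p * u s + g * v s)" and "v' = - \<i> * (g * u s + q * v s)"
  have dP: "(P has_vector_derivative 2 * \<i> * of_real om * P s) (at s)"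
  proof -
    have "((\<lambda>z. exp (\<i> * (2 * of_real om * z))) has_field_derivative 2 * \<i> * of_real om * exp (\<i> * (2 * of_real om * of_real s))) (at (of_real s))"
      by (auto intro!: derivative_eq_intros)
    from has_vector_derivative_real_field[OF this] show ?thesis by (simp add: P_def)
  qed
  have dQ: "(Q has_vector_derivative - 2 * \<i> * of_real om * Q s) (at s)"
  proof -
    have "((\<lambda>z. exp (\<i> * (- (2 * of_real om * z)))) has_field_derivative - 2 * \<i> * of_real om * exp (\<i> * (- (2 * of_real om * of_real s)))) (at (of_real s))"
      by (auto intro!: derivative_eq_intros)
    from has_vector_derivative_real_field[OF this] show ?thesis by (simp add: Q_def)
  qed
  have dE: "((\<lambda>s. exp (\<i> * (of_real s * L))) has_vector_derivative \<i> * L * ?E) (at s)"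
  proof -
    have "((\<lambda>z. exp (\<i> * (z * L))) has_field_derivative \<i> * L * exp (\<i> * (of_real s * L))) (at (of_real s))"
      by (auto intro!: derivative_eq_intros)
    from has_vector_derivative_real_field[OF this] show ?thesis .
  qed
  \<comment> \<open>The coupling contained in L x supplies 2 \<i> om k ym u, which cancels the
    derivative of the phase P up to a multiple of P - 1. This reduces the energy gap w + om in the
    equation for \<open>ym\<close> to the detuning w - om; the terms with Q behave alike.\<close>
  define B' where "B' = u' * x + v' * y - k * ym * (u s * (2 * \<i> * of_real om * P s) + u' * (P s - 1))
      - n * xp * (v s * (2 * \<i> * of_real om * Q s) + v' * (1 - Q s))"
  have dB: "(B has_vector_derivative B') (at s)"
    unfolding B_def[abs_def] B'_def
    by (auto intro!: derivative_eq_intros du[folded u'_def] dv[folded v'_def] dP dQ simp: algebra_simps)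
  have "((\<lambda>s. exp (\<i> * (of_real s * L)) * B s) has_vector_derivative ?E * B' + \<i> * L * ?E * B s) (at s)"
    by (rule has_vector_derivative_mult[OF dE dB])
  \<comment> \<open>\<open>L\<close> is kept next to each coefficient so that the eigenvalue
    equations apply; the one for \<open>ym\<close> comes multiplied by \<open>k\<close>, which
    vanishes where the index m - 2 is truncated.\<close>
  moreover have "\<i> * L * B s = \<i> * (u s * (L * x) + v s * (L * y) - (k * (L * ym)) * (u s * (P s - 1)) - n * (L * xp) * (v s * (1 - Q s)))"
    unfolding B_def by (simp add: algebra_simps)
  then have "B' + \<i> * L * B s = - \<i> *
      ((P s - 1) * k * (u s * (gm * xm + 2 * of_real om * k * x - (w - of_real om) * ym) - g * v s * ym)
      + (1 - Q s) * n * (v s * (gp * yp + 2 * of_real om * n * y + (w - of_real om) * xp) - g * u s * xp))"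
    unfolding x y ym xp B'_def u'_def v'_def by (simp add: algebra_simps)
  then have "?E * B' + \<i> * L * ?E * B s = ?E * (- \<i> *
      ((P s - 1) * k * (u s * (gm * xm + 2 * of_real om * k * x - (w - of_real om) * ym) - g * v s * ym)
      + (1 - Q s) * n * (v s * (gp * yp + 2 * of_real om * n * y + (w - of_real om) * xp) - g * u s * xp)))"
    by (simp only: distrib_left[symmetric] mult.assoc mult.left_commute[of _ ?E])
  ultimately show ?thesis unfolding B_def by (simp only:)
qed

text \<open>This serves the integrand, whose terms hop between basis vectors. A hop may end in the
  void vector, so each image has norm at most 1.\<close>

lemma norm_bvec_sum_le:
  assumes "finite K" "inj_on \<pi> {k \<in> K. c k \<noteq> 0}" "\<And>k. k \<in> K \<Longrightarrow> cmod (c k) \<le> r * b k" "r \<ge> 0"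
  shows "norm (\<Sum>k\<in>K. c k *\<^sub>C bvec (\<pi> k)) \<le> r * sqrt (\<Sum>k\<in>K. (b k)\<^sup>2)"
proof -
  let ?K = "{k \<in> K. c k \<noteq> 0}"
  have "(\<Sum>k\<in>K. c k *\<^sub>C bvec (\<pi> k)) = (\<Sum>k\<in>?K. c k *\<^sub>C bvec (\<pi> k))"
    using assms(1) by (intro sum.mono_neutral_right) auto
  then have "(norm (\<Sum>k\<in>K. c k *\<^sub>C bvec (\<pi> k)))\<^sup>2 = (norm (\<Sum>k\<in>?K. c k *\<^sub>C bvec (\<pi> k)))\<^sup>2"
    by simp
  also have "\<dots> = (\<Sum>k\<in>?K. (norm (c k *\<^sub>C bvec (\<pi> k)))\<^sup>2)"
    by (rule norm_sum_orthogonal) (use assms(2) in \<open>auto simp: cinner_bvec inj_on_def\<close>)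
  also have "\<dots> \<le> (\<Sum>k\<in>?K. (r * b k)\<^sup>2)"
  proof (intro sum_mono power_mono)
    fix k assume "k \<in> ?K"
    have "norm (c k *\<^sub>C bvec (\<pi> k)) \<le> cmod (c k) * 1"
      unfolding norm_scaleC by (intro mult_left_mono) (auto simp: norm_bvec)
    also have "\<dots> \<le> r * b k"
      using assms(3)[of k] \<open>k \<in> ?K\<close> by simp
    finally show "norm (c k *\<^sub>C bvec (\<pi> k)) \<le> r * b k" .
  qed simp
  also have "\<dots> \<le> (\<Sum>k\<in>K. (r * b k)\<^sup>2)"
    using assms(1) by (intro sum_mono2) auto
  also have "\<dots> = (r * sqrt (\<Sum>k\<in>K. (b k)\<^sup>2))\<^sup>2"
    by (simp add: power_mult_distrib sum_distrib_left sum_nonneg)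
  finally show ?thesis
    by (rule power2_le_imp_le) (simp add: assms(4) sum_nonneg)
qed

lemma norm_bvec_sum_eq:
  assumes "finite K" "inj_on \<pi> {k \<in> K. c k \<noteq> 0}" "\<And>k. k \<in> K \<Longrightarrow> c k \<noteq> 0 \<Longrightarrow> \<pi> k \<noteq> (True, 0)"
  shows "norm (\<Sum>k\<in>K. c k *\<^sub>C bvec (\<pi> k)) = sqrt (\<Sum>k\<in>K. (cmod (c k))\<^sup>2)"
proof -
  let ?K = "{k \<in> K. c k \<noteq> 0}"
  have "(\<Sum>k\<in>K. c k *\<^sub>C bvec (\<pi> k)) = (\<Sum>k\<in>?K. c k *\<^sub>C bvec (\<pi> k))"
    using assms(1) by (intro sum.mono_neutral_right) auto
  then have "(norm (\<Sum>k\<in>K. c k *\<^sub>C bvec (\<pi> k)))\<^sup>2 = (norm (\<Sum>k\<in>?K. c k *\<^sub>C bvec (\<pi> k)))\<^sup>2"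
    by simp
  also have "\<dots> = (\<Sum>k\<in>?K. (norm (c k *\<^sub>C bvec (\<pi> k)))\<^sup>2)"
    by (rule norm_sum_orthogonal) (use assms(2) in \<open>auto simp: cinner_bvec inj_on_def\<close>)
  also have "\<dots> = (\<Sum>k\<in>?K. (cmod (c k))\<^sup>2)"
    using assms(3) by (intro sum.cong) (auto simp: norm_bvec)
  also have "\<dots> = (\<Sum>k\<in>K. (cmod (c k))\<^sup>2)"
    using assms(1) by (intro sum.mono_neutral_left) auto
  finally show ?thesis
    by (metis norm_ge_zero real_sqrt_unique)
qed

lemma sum_bool_times: "(\<Sum>k\<in>UNIV \<times> {..M}. f k) = (\<Sum>m\<le>M. f (True, m) + f (False, m))" for M :: nat
  by (simp add: sum.cartesian_product' UNIV_bool sum.distrib add.commute)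

lemma norm_exp_minus_one: "cmod (exp (\<i> * complex_of_real (2 * a)) - 1) = 2 * \<bar>sin a\<bar>"
proof -
  have "exp (\<i> * complex_of_real (2 * a)) - 1 = exp (\<i> * of_real a) * (exp (\<i> * of_real a) - exp (- (\<i> * of_real a)))"
    by (simp add: algebra_simps flip: exp_add)
  also have "exp (\<i> * of_real a) - exp (- (\<i> * of_real a)) = 2 * \<i> * complex_of_real (sin a)"
    by (simp add: sin_exp_eq flip: sin_of_real)
  finally show ?thesis
    using norm_exp_i_times[of a] by (simp add: norm_mult)
qed

text \<open>Integration by parts in the interaction picture: \<open>\<eta>\<close> is the boundary term, and \<open>R\<close> the remaining
  integrand, evaluated against the eigenvectors of the full Hamiltonian.\<close>

lemma rwa_difference_finite:
  fixes u0 v0 :: "nat \<Rightarrow> complex" and M :: nat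
  assumes lam: "lam > 0" and Om: "Om > 0" and om: "om > 0" and t: "0 \<le> t" "t \<le> pi / om" and u00: "u0 0 = 0"
  defines "\<Psi> \<equiv> \<Sum>m\<le>M. u0 m *\<^sub>C bvec (True, m) + v0 m *\<^sub>C bvec (False, m)"
    and "N \<equiv> \<lambda>m. (cmod (u0 m))\<^sup>2 + (cmod (v0 m))\<^sup>2"
  shows "norm (exp_i (- t) (op_closure (jc_op Om om lam 0)) \<Psi> - exp_i (- t) (op_closure (jc_op Om om lam lam)) \<Psi>)
    \<ge> lam / om * sin (t * om) * sqrt (\<Sum>m\<le>M. real (m - 1) * N m)
      - lam / om\<^sup>2 * (1 - cos (t * om)) * (\<bar>Om - om\<bar> * sqrt (\<Sum>m\<le>M. (real m + 1) * N m)
        + 3 * lam * sqrt (\<Sum>m\<le>M. (real m + 1) * (real m + 2) * N m))"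
proof -
  let ?H = "op_closure (jc_op Om om lam lam)" and ?HR = "op_closure (jc_op Om om lam 0)"
  obtain e :: "l2 \<Rightarrow> l2" and l where A: "eigenbasis e l ?H"
    using rabi_eigenbasis[of lam Om om] lam Om om by auto
  note basis = eigenbasis_hilbert_basis[OF A]
  obtain u v where ev: "rwa_evolution Om om lam M u0 v0 u v"
    using rwa_dynamics[of Om om lam] u00 by metis
  then have uv0: "\<And>m. u m 0 = u0 m" "\<And>m. v m 0 = v0 m" and u_void: "\<And>s. u 0 s = 0"
    and du: "\<And>m s. (u m has_vector_derivative - \<i> * (of_real (rwa_up Om om m) * u m s + of_real (lam * sqrt (real m)) * v m s)) (at s)"
    and dv: "\<And>m s. (v m has_vector_derivative - \<i> * (of_real (lam * sqrt (real m)) * u m s + of_real (rwa_down Om om m) * v m s)) (at s)"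
    and uvN: "\<And>m s. (cmod (u m s))\<^sup>2 + (cmod (v m s))\<^sup>2 = N m"
    and exp_HR: "\<And>s. exp_i (- s) ?HR \<Psi> = (\<Sum>m\<le>M. u m s *\<^sub>C bvec (True, m) + v m s *\<^sub>C bvec (False, m))"
    unfolding rwa_evolution_def \<Psi>_def N_def by simp_all
  define g where "g m = lam * sqrt (real m)" for m :: nat
  \<comment> \<open>\<open>k\<close> and \<open>n\<close> are the counter-rotating matrix elements
    of the lowering and the raising hop, divided by the frequency 2 om as in a primitive of the
    phase.\<close>
  define k where "k m = lam * sqrt (real (m - 1)) / (2 * om)" for m :: nat
  define n where "n m = lam * sqrt (real (m + 1)) / (2 * om)" for m :: nat
  define P where "P s = exp (\<i> * complex_of_real (2 * om * s))" for s
  define Q where "Q s = exp (\<i> * complex_of_real (- (2 * om * s)))" for s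
  define K where "K = (UNIV :: bool set) \<times> {..M}"
  have K: "finite K" by (simp add: K_def)
  define z where "z j s = (if fst j then u (snd j) s else v (snd j) s)" for j s
  have z_void: "z (True, 0) s = 0" for s by (simp add: z_def u_void)
  have sumN: "(\<Sum>j\<in>K. (b (snd j) * cmod (z j s))\<^sup>2) = (\<Sum>m\<le>M. (b m)\<^sup>2 * N m)" for b s
    unfolding K_def sum_bool_times z_def uvN[of _ s, symmetric] by (simp add: power_mult_distrib distrib_left)
  define hop :: "bool \<times> nat \<Rightarrow> bool \<times> nat" where "hop j = (if fst j then (False, snd j - 2) else (True, snd j + 2))" for j
  define hop2 :: "bool \<times> nat \<Rightarrow> bool \<times> nat" where "hop2 j = (fst j, if fst j then snd j - 2 else snd j + 2)" for j
  define hop3 :: "bool \<times> nat \<Rightarrow> bool \<times> nat" where "hop3 j = (fst j, if fst j then snd j + 2 else snd j - 2)" for j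
  \<comment> \<open>This is \<i> S \<phi> without the free phases: removing them turns the primitive
    of exp(-2 \<i> om s) into (P - 1)/(2 \<i> om) on the lowering hop, and that of exp(2 \<i> om s)
    into (1 - Q)/(2 \<i> om) on the raising hop.\<close>
  define \<eta> where "\<eta> s = (\<Sum>j\<in>K. (if fst j then of_real (k (snd j)) * (P s - 1) * z j s
      else of_real (n (snd j)) * (1 - Q s) * z j s) *\<^sub>C bvec (hop j))" for s
  define \<phi> where "\<phi> s = (\<Sum>j\<in>K. z j s *\<^sub>C bvec j)" for s
  \<comment> \<open>The four contributions to H_1 S - S H_2: the detuning (\<open>c1\<close>), a
    rotating coupling after the hop (\<open>c2\<close>), a rotating coupling before it
    (\<open>c3\<close>), and a second counter-rotating hop back to the start
    (\<open>c4\<close>).\<close>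
  define c1 where "c1 s j = (if fst j then - of_real ((Om - om) * k (snd j)) * (P s - 1) * z j s
      else of_real ((Om - om) * n (snd j)) * (1 - Q s) * z j s)" for s j
  define c2 where "c2 s j = (if fst j then of_real (k (snd j) * g (snd j - 2)) * (P s - 1) * z j s
      else of_real (n (snd j) * g (snd j + 2)) * (1 - Q s) * z j s)" for s j
  define c3 where "c3 s j = (if fst j then - of_real (n (snd j) * g (snd j)) * (1 - Q s) * z j s
      else - of_real (k (snd j) * g (snd j)) * (P s - 1) * z j s)" for s j
  define c4 where "c4 s j = (if fst j then of_real (k (snd j) * (2 * om * k (snd j))) * (P s - 1) * z j s
      else of_real (n (snd j) * (2 * om * n (snd j))) * (1 - Q s) * z j s)" for s j
  define R where "R s = (\<Sum>j\<in>K. c1 s j *\<^sub>C bvec (hop j)) + (\<Sum>j\<in>K. c2 s j *\<^sub>C bvec (hop2 j))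
      + (\<Sum>j\<in>K. c3 s j *\<^sub>C bvec (hop3 j)) + (\<Sum>j\<in>K. c4 s j *\<^sub>C bvec j)" for s
  have exp_HR': "exp_i (- s) ?HR \<Psi> = \<phi> s" for s
    unfolding exp_HR \<phi>_def K_def sum_bool_times by (simp add: z_def)
  have \<phi>0: "\<phi> 0 = \<Psi>"
    unfolding \<phi>_def \<Psi>_def K_def sum_bool_times by (simp add: z_def uv0)

  have \<eta>0: "\<eta> 0 = 0"
    by (simp add: \<eta>_def P_def Q_def cong: if_cong)

  \<comment> \<open>The derivative of the conjugated evolution\<close>
  have deriv: "((\<lambda>s. exp (\<i> * (of_real s * of_real (l i))) * cinner (e i) (\<phi> s - \<eta> s)) has_vector_derivative
      exp (\<i> * (of_real s * of_real (l i))) * (- \<i> * cinner (e i) (R s))) (at s)" for i s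
  proof -
    define x where "x m = cinner (e i) (bvec (True, m))" for m
    define y where "y m = cinner (e i) (bvec (False, m))" for m
    define L where "L = complex_of_real (l i)"
    have eig: "L * cinner (e i) (bvec j) = cinner (e i) (jc_vec Om om lam lam j)" for j
      using A jc_vec_mem[of j Om om lam lam] by (auto simp: eigenbasis_def L_def)
    have x: "L * x m = of_real (rwa_up Om om m) * x m + of_real (g m) * y m + 2 * of_real om * of_real (k m) * y (m - 2)" for m
      unfolding x_def eig using om
      by (simp add: jc_vec_def cinner_add_right rwa_up_def g_def k_def y_def add.assoc)
    have y: "L * y m = of_real (rwa_down Om om m) * y m + of_real (g m) * x m + 2 * of_real om * of_real (n m) * x (m + 2)" for m
      unfolding y_def eig using om
      by (simp add: jc_vec_def cinner_add_right rwa_down_def g_def n_def x_def add.assoc)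
    have kn: "k (Suc (Suc m)) = n m" for m by (simp add: k_def n_def)
    \<comment> \<open>The equation at m - 2 is the genuine one only for m \<ge> 2; below that both
      sides vanish with \<open>k m\<close>.\<close>
    have ym: "of_real (k m) * (L * y (m - 2)) = of_real (k m) * ((of_real (rwa_up Om om m) - of_real Om - of_real om) * y (m - 2)
        + of_real (g (m - 2)) * x (m - 2) + 2 * of_real om * of_real (k m) * x m)" for m
    proof (cases "m \<ge> 2")
      case True
      then obtain m' where m: "m = m' + 2" by (metis le_add_diff_inverse2)
      have "rwa_down Om om m' = rwa_up Om om (m' + 2) - Om - om"
        by (simp add: rwa_up_def rwa_down_def algebra_simps)
      then show ?thesis unfolding m using y[of m'] by (simp add: kn)
    next
      case False
      then have "k m = 0" by (simp add: k_def)
      then show ?thesis by simp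
    qed
    have xp: "L * x (m + 2) = (of_real (rwa_down Om om m) + of_real Om + of_real om) * x (m + 2)
        + of_real (g (m + 2)) * y (m + 2) + 2 * of_real om * of_real (n m) * y m" for m
    proof -
      have "rwa_up Om om (m + 2) = rwa_down Om om m + Om + om"
        by (simp add: rwa_up_def rwa_down_def algebra_simps)
      then show ?thesis using x[of "m + 2"] kn[of m] by simp
    qed
    let ?G = "\<lambda>m s. exp (\<i> * (of_real s * L)) * (u m s * x m + v m s * y m
        - of_real (k m) * y (m - 2) * (u m s * (P s - 1)) - of_real (n m) * x (m + 2) * (v m s * (1 - Q s)))"
    let ?G' = "\<lambda>m s. exp (\<i> * (of_real s * L)) * (- \<i> *
      ((P s - 1) * of_real (k m) * (u m s * (of_real (g (m - 2)) * x (m - 2) + 2 * of_real om * of_real (k m) * x m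
          - (of_real Om - of_real om) * y (m - 2)) - of_real (g m) * v m s * y (m - 2))
      + (1 - Q s) * of_real (n m) * (v m s * (of_real (g (m + 2)) * y (m + 2) + 2 * of_real om * of_real (n m) * y m
          + (of_real Om - of_real om) * x (m + 2)) - of_real (g m) * u m s * x (m + 2))))"
    have "(?G m has_vector_derivative ?G' m s) (at s)" for m
      unfolding P_def Q_def
      by (rule interaction_term_derivative[OF du[folded g_def] dv[folded g_def] x y ym xp])
    then have "((\<lambda>s. \<Sum>m\<le>M. ?G m s) has_vector_derivative (\<Sum>m\<le>M. ?G' m s)) (at s)"
      by (intro has_vector_derivative_sum)
    moreover have "(\<Sum>m\<le>M. ?G m s) = exp (\<i> * (of_real s * of_real (l i))) * cinner (e i) (\<phi> s - \<eta> s)" for s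
    proof -
      have "cinner (e i) (\<phi> s - \<eta> s) = (\<Sum>m\<le>M. u m s * x m + v m s * y m
        - of_real (k m) * y (m - 2) * (u m s * (P s - 1)) - of_real (n m) * x (m + 2) * (v m s * (1 - Q s)))"
        unfolding \<phi>_def \<eta>_def sum_subtractf[symmetric] K_def sum_bool_times cinner_sum_right
        by (intro sum.cong) (simp_all add: z_def hop_def cinner_add_right cinner_diff_right x_def y_def algebra_simps)
      then show ?thesis unfolding L_def by (simp only: sum_distrib_left)
    qed
    moreover have "(\<Sum>m\<le>M. ?G' m s) = exp (\<i> * (of_real s * of_real (l i))) * (- \<i> * cinner (e i) (R s))"
    proof -
      have "cinner (e i) (R s) = (\<Sum>m\<le>M. (P s - 1) * of_real (k m) * (u m s * (of_real (g (m - 2)) * x (m - 2) + 2 * of_real om * of_real (k m) * x m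
          - (of_real Om - of_real om) * y (m - 2)) - of_real (g m) * v m s * y (m - 2))
      + (1 - Q s) * of_real (n m) * (v m s * (of_real (g (m + 2)) * y (m + 2) + 2 * of_real om * of_real (n m) * y m
          + (of_real Om - of_real om) * x (m + 2)) - of_real (g m) * u m s * x (m + 2)))"
        unfolding R_def sum.distrib[symmetric] K_def sum_bool_times cinner_sum_right
        by (intro sum.cong) (simp_all add: c1_def c2_def c3_def c4_def z_def hop_def hop2_def hop3_def cinner_add_right
            x_def y_def algebra_simps)
      then show ?thesis unfolding L_def by (simp only: sum_distrib_left)
    qed
    ultimately show ?thesis by simp
  qed

  \<comment> \<open>Estimates for the integrand\<close>
  define a1 a2 where "a1 = (\<Sum>m\<le>M. (real m + 1) * N m)" and "a2 = (\<Sum>m\<le>M. (real m + 1) * (real m + 2) * N m)"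
  define C where "C = lam / om * (\<bar>Om - om\<bar> * sqrt a1 + 3 * lam * sqrt a2)"
  have N0: "N m \<ge> 0" for m by (simp add: N_def)
  have abs_k: "\<bar>k m\<bar> = lam * sqrt (real (m - 1)) / (2 * om)" and abs_n: "\<bar>n m\<bar> = lam * sqrt (real (m + 1)) / (2 * om)"
    and abs_g: "\<bar>g m\<bar> = lam * sqrt (real m)" for m
    using lam om by (simp_all add: k_def n_def g_def)
  have k_small: "k m = 0" if "m < 2" for m using that by (simp add: k_def)
  \<comment> \<open>The restriction t \<le> pi/om keeps the sine non-negative on the whole interval,
    so no absolute values survive.\<close>
  have nP: "cmod (P s - 1) = 2 * sin (om * s)" and nQ: "cmod (1 - Q s) = 2 * sin (om * s)" if "0 \<le> s" "s \<le> t" for s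
  proof -
    have "s * om \<le> pi" using that t om by (meson le_divide_eq order_trans)
    then have "sin (om * s) \<ge> 0" using that om by (intro sin_ge_zero) (auto simp: mult.commute)
    then show "cmod (P s - 1) = 2 * sin (om * s)" "cmod (1 - Q s) = 2 * sin (om * s)"
      using norm_exp_minus_one[of "om * s"] norm_exp_minus_one[of "- (om * s)"]
      by (simp_all add: P_def Q_def mult.assoc norm_minus_commute)
  qed
  have sin0: "sin (om * s) \<ge> 0" if "0 \<le> s" "s \<le> t" for s
    using nP[OF that] norm_ge_zero[of "P s - 1"] by linarith

  \<comment> \<open>Truncation makes \<open>hop\<close> merge the spin-up indices below 2 with the
    index 2, but there \<open>k\<close> vanishes.\<close>
  have inj_hop: "inj_on hop {j \<in> K. (if fst j then of_real (k (snd j)) * a j else b j) \<noteq> (0 :: complex)}" for a b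
  proof (rule inj_onI)
    fix i j assume *: "i \<in> {j \<in> K. (if fst j then of_real (k (snd j)) * a j else b j) \<noteq> 0}"
      "j \<in> {j \<in> K. (if fst j then of_real (k (snd j)) * a j else b j) \<noteq> 0}" "hop i = hop j"
    then have "fst i \<Longrightarrow> snd i \<ge> 2" "fst j \<Longrightarrow> snd j \<ge> 2"
      using k_small[of "snd i"] k_small[of "snd j"] by fastforce+
    then show "i = j" using *(3) by (auto simp: hop_def prod_eq_iff split: if_splits)
  qed
  have R_bound: "norm (R s) \<le> C * sin (om * s)" if s: "0 \<le> s" "s \<le> t" for s
  proof -
    let ?S = "sin (om * s)"
    note S = sin0[OF s] and nPQ = nP[OF s] nQ[OF s]
    \<comment> \<open>The flow may shift the weight of a sector to either spin, so the matrix
      elements are replaced by bounds depending on m alone: sqrt(m + 1) for one hop, sqrt((m + 1)(m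
      + 2)) for the products.\<close>
    have sqrt_le: "sqrt (real (m - 1)) \<le> sqrt (real m + 1)" "sqrt (real (m - 1)) * sqrt (real (m - 2)) \<le> sqrt (real m + 1) * sqrt (real m + 2)"
      "sqrt (real (m + 1)) * sqrt (real m) \<le> sqrt (real m + 1) * sqrt (real m + 2)"
      "sqrt (real (m - 1)) * sqrt (real m) \<le> sqrt (real m + 1) * sqrt (real m + 2)"
      "sqrt (real (m - 1)) * sqrt (real (m - 1)) \<le> sqrt (real m + 1) * sqrt (real m + 2)"
      "sqrt (real (m + 1)) * sqrt (real (m + 1)) \<le> sqrt (real m + 1) * sqrt (real m + 2)"
      "sqrt (real (m + 1)) * sqrt (real (m + 2)) \<le> sqrt (real m + 1) * sqrt (real m + 2)" for m
      by (intro mult_mono real_sqrt_le_mono; simp)+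
    have b1: "norm (\<Sum>j\<in>K. c1 s j *\<^sub>C bvec (hop j)) \<le> lam / om * ?S * \<bar>Om - om\<bar> * sqrt a1"
    proof -
      have "norm (\<Sum>j\<in>K. c1 s j *\<^sub>C bvec (hop j)) \<le> (lam / om * ?S * \<bar>Om - om\<bar>) * sqrt (\<Sum>j\<in>K. (sqrt (real (snd j) + 1) * cmod (z j s))\<^sup>2)"
      proof (rule norm_bvec_sum_le[OF K])
        show "inj_on hop {j \<in> K. c1 s j \<noteq> 0}"
          by (rule inj_on_subset[OF inj_hop[of "\<lambda>_. 1" "\<lambda>_. 1"]]) (auto simp: c1_def split: if_splits)
        fix j :: "bool \<times> nat"
        have "cmod (c1 s j) = lam / om * ?S * \<bar>Om - om\<bar> * (sqrt (real (if fst j then snd j - 1 else snd j + 1)) * cmod (z j s))"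
          using om by (simp add: c1_def norm_mult nPQ abs_mult abs_k abs_n del: of_real_mult of_real_diff)
        also have "\<dots> \<le> lam / om * ?S * \<bar>Om - om\<bar> * (sqrt (real (snd j) + 1) * cmod (z j s))"
          using lam om S sqrt_le(1)[of "snd j"] by (intro mult_left_mono mult_right_mono) (auto simp: add.commute)
        finally show "cmod (c1 s j) \<le> lam / om * ?S * \<bar>Om - om\<bar> * (sqrt (real (snd j) + 1) * cmod (z j s))" .
      qed (use lam om S in auto)
      also have "(\<Sum>j\<in>K. (sqrt (real (snd j) + 1) * cmod (z j s))\<^sup>2) = a1"
        unfolding sumN[of "\<lambda>m. sqrt (real m + 1)"] a1_def by simp
      finally show ?thesis .
    qed
    have b: "norm (\<Sum>j\<in>K. c j *\<^sub>C bvec (\<pi> j)) \<le> lam / om * ?S * lam * sqrt a2"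
      if inj: "inj_on \<pi> {j \<in> K. c j \<noteq> 0}"
        and c: "\<And>j. cmod (c j) = lam / om * ?S * lam * (f j * cmod (z j s))"
        and f: "\<And>j. f j \<le> sqrt (real (snd j) + 1) * sqrt (real (snd j) + 2)" for c \<pi> f
    proof -
      have "norm (\<Sum>j\<in>K. c j *\<^sub>C bvec (\<pi> j)) \<le> (lam / om * ?S * lam) * sqrt (\<Sum>j\<in>K. (sqrt (real (snd j) + 1) * sqrt (real (snd j) + 2) * cmod (z j s))\<^sup>2)"
      proof (rule norm_bvec_sum_le[OF K inj])
        fix j :: "bool \<times> nat"
        show "cmod (c j) \<le> lam / om * ?S * lam * (sqrt (real (snd j) + 1) * sqrt (real (snd j) + 2) * cmod (z j s))"
          unfolding c using lam om S by (intro mult_left_mono mult_right_mono f) auto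
      qed (use lam om S in auto)
      also have "(\<Sum>j\<in>K. (sqrt (real (snd j) + 1) * sqrt (real (snd j) + 2) * cmod (z j s))\<^sup>2) = a2"
        unfolding sumN[of "\<lambda>m. sqrt (real m + 1) * sqrt (real m + 2)"] a2_def by (simp add: power_mult_distrib)
      finally show ?thesis .
    qed
    have b2: "norm (\<Sum>j\<in>K. c2 s j *\<^sub>C bvec (hop2 j)) \<le> lam / om * ?S * lam * sqrt a2"
    proof (rule b[where f = "\<lambda>j. if fst j then sqrt (real (snd j - 1)) * sqrt (real (snd j - 2)) else sqrt (real (snd j + 1)) * sqrt (real (snd j + 2))"])
      show "inj_on hop2 {j \<in> K. c2 s j \<noteq> 0}"
      proof (rule inj_onI)
        fix i j assume *: "i \<in> {j \<in> K. c2 s j \<noteq> 0}" "j \<in> {j \<in> K. c2 s j \<noteq> 0}" "hop2 i = hop2 j"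
        then have "fst i \<Longrightarrow> snd i \<ge> 2" "fst j \<Longrightarrow> snd j \<ge> 2"
          using k_small[of "snd i"] k_small[of "snd j"] by (fastforce simp: c2_def)+
        then show "i = j" using *(3) by (auto simp: hop2_def prod_eq_iff split: if_splits)
      qed
      show "cmod (c2 s j) = lam / om * ?S * lam * ((if fst j then sqrt (real (snd j - 1)) * sqrt (real (snd j - 2))
          else sqrt (real (snd j + 1)) * sqrt (real (snd j + 2))) * cmod (z j s))" for j
        using om by (simp add: c2_def norm_mult nPQ abs_mult abs_k abs_n abs_g del: of_real_mult)
    qed (use sqrt_le in auto)
    have b3: "norm (\<Sum>j\<in>K. c3 s j *\<^sub>C bvec (hop3 j)) \<le> lam / om * ?S * lam * sqrt a2"
    proof (rule b[where f = "\<lambda>j. if fst j then sqrt (real (snd j + 1)) * sqrt (real (snd j)) else sqrt (real (snd j - 1)) * sqrt (real (snd j))"])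
      show "inj_on hop3 {j \<in> K. c3 s j \<noteq> 0}"
      proof (rule inj_onI)
        fix i j assume *: "i \<in> {j \<in> K. c3 s j \<noteq> 0}" "j \<in> {j \<in> K. c3 s j \<noteq> 0}" "hop3 i = hop3 j"
        then have "\<not> fst i \<Longrightarrow> snd i \<ge> 2" "\<not> fst j \<Longrightarrow> snd j \<ge> 2"
          using k_small[of "snd i"] k_small[of "snd j"] by (fastforce simp: c3_def)+
        then show "i = j" using *(3) by (auto simp: hop3_def prod_eq_iff split: if_splits)
      qed
      show "cmod (c3 s j) = lam / om * ?S * lam * ((if fst j then sqrt (real (snd j + 1)) * sqrt (real (snd j))
          else sqrt (real (snd j - 1)) * sqrt (real (snd j))) * cmod (z j s))" for j
        using om by (simp add: c3_def norm_mult nPQ abs_mult abs_k abs_n abs_g del: of_real_mult)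
    qed (use sqrt_le in auto)
    have b4: "norm (\<Sum>j\<in>K. c4 s j *\<^sub>C bvec j) \<le> lam / om * ?S * lam * sqrt a2"
    proof (rule b[where f = "\<lambda>j. if fst j then sqrt (real (snd j - 1)) * sqrt (real (snd j - 1)) else sqrt (real (snd j + 1)) * sqrt (real (snd j + 1))"])
      show "cmod (c4 s j) = lam / om * ?S * lam * ((if fst j then sqrt (real (snd j - 1)) * sqrt (real (snd j - 1))
          else sqrt (real (snd j + 1)) * sqrt (real (snd j + 1))) * cmod (z j s))" for j
        using om by (simp add: c4_def norm_mult nPQ abs_mult abs_k abs_n del: of_real_mult real_sqrt_mult_self)
    qed (use sqrt_le in \<open>auto simp del: real_sqrt_mult_self\<close>)
    have "norm (R s) \<le> lam / om * ?S * \<bar>Om - om\<bar> * sqrt a1 + lam / om * ?S * lam * sqrt a2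
        + lam / om * ?S * lam * sqrt a2 + lam / om * ?S * lam * sqrt a2"
      unfolding R_def by (intro norm_triangle_le[OF add_mono] b1 b2 b3 b4)
    also have "\<dots> = C * ?S" by (simp add: C_def algebra_simps add_divide_distrib)
    finally show ?thesis .
  qed

  \<comment> \<open>Integration of the remainder\<close>
  define w where "w = \<phi> t - \<eta> t - exp_i (- t) ?H \<Psi>"
  have C0: "C \<ge> 0" using lam om N0 by (simp add: C_def a1_def a2_def sum_nonneg)
  have w_bound: "norm w \<le> C / om * (1 - cos (om * t))"
  proof (cases "t = 0")
    case True
    have "exp_i 0 ?H \<Psi> = \<Psi>"
      by (rule basis_eqI[OF basis]) (simp add: exp_i_coeff[OF A])
    then show ?thesis using True by (simp add: w_def \<phi>0 \<eta>0)
  next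
    case False
    then have "0 < t" using t by simp
    have cos_le: "0 \<le> C / om * (1 - cos (om * t))" using C0 om by simp
    have "(norm w)\<^sup>2 \<le> (C / om * (1 - cos (om * t)))\<^sup>2"
    proof (rule has_sum_le_finite_sums[OF Parseval[OF basis]])
      fix J :: "l2 set" assume J: "finite J"
      define T where "T = (\<Sum>i\<in>J. (cmod (cinner (e i) w))\<^sup>2)"
      \<comment> \<open>The norm of \<open>w\<close> is recovered by duality: with these weights F t
        - F 0 equals the partial sum \<open>T\<close> of squared coefficients of \<open>w\<close>,
        while F' pairs R with a vector of norm sqrt T. The result is T \<le> sqrt T times the
        desired bound.\<close>
      define d where "d i = exp (- (\<i> * (of_real t * of_real (l i)))) * cnj (cinner (e i) w)" for i
      define F where "F s = (\<Sum>i\<in>J. d i * (exp (\<i> * (of_real s * of_real (l i))) * cinner (e i) (\<phi> s - \<eta> s)))" for s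
      define F' where "F' s = (\<Sum>i\<in>J. d i * (exp (\<i> * (of_real s * of_real (l i))) * (- \<i> * cinner (e i) (R s))))" for s
      have T0: "T \<ge> 0" by (simp add: T_def sum_nonneg)
      have dF: "(F has_vector_derivative F' s) (at s)" for s
        unfolding F_def[abs_def] F'_def
        by (intro has_vector_derivative_sum has_vector_derivative_mult_right deriv)
      have F'_le: "norm (F' s) \<le> sqrt T * C * sin (om * s)" if "0 < s" "s < t" for s
      proof -
        define \<xi> where "\<xi> = (\<Sum>i\<in>J. cnj (d i * exp (\<i> * (of_real s * of_real (l i))) * (- \<i>)) *\<^sub>C e i)"
        have "F' s = cinner \<xi> (R s)"
          by (simp add: F'_def \<xi>_def cinner_sum_left mult.assoc)
        moreover have n1: "cmod (exp (\<i> * (of_real s * of_real r))) = 1" "cmod (exp (- (\<i> * (of_real s * of_real r)))) = 1" for s r :: real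
          using norm_exp_i_times[of "s * r"] norm_exp_i_times[of "- (s * r)"] by simp_all
        have "(norm \<xi>)\<^sup>2 = T"
          unfolding \<xi>_def norm_basis_sum[OF basis] T_def
          by (intro sum.cong) (simp_all only: d_def complex_mod_cnj norm_mult n1 norm_minus_cancel norm_ii mult_1 mult_1_right basis_coeff[OF basis])
        then have "norm \<xi> = sqrt T" by (metis norm_ge_zero real_sqrt_unique)
        ultimately have "norm (F' s) \<le> sqrt T * norm (R s)"
          using cinner_Cauchy_Schwarz[of \<xi> "R s"] by simp
        also have "\<dots> \<le> sqrt T * (C * sin (om * s))"
          using R_bound[of s] that T0 by (intro mult_left_mono) auto
        finally show ?thesis by (simp add: mult.assoc)
      qed
      \<comment> \<open>The bound on F' is integrated by comparison with the primitive of the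
        sine.\<close>
      have "norm (F t - F 0) \<le> - (sqrt T * C / om * cos (om * t)) - - (sqrt T * C / om * cos (om * 0))"
      proof (rule differentiable_bound_general[OF \<open>0 < t\<close>])
        show "continuous_on {0..t} F"
          by (intro continuous_at_imp_continuous_on ballI has_vector_derivative_continuous[OF dF])
        show "continuous_on {0..t} (\<lambda>s. - (sqrt T * C / om * cos (om * s)))"
          by (intro continuous_intros)
        show "(F has_vector_derivative F' s) (at s)" for s by (rule dF)
        show "((\<lambda>s. - (sqrt T * C / om * cos (om * s))) has_vector_derivative sqrt T * C * sin (om * s)) (at s)" for s
          unfolding has_real_derivative_iff_has_vector_derivative[symmetric]
          using om by (auto intro!: derivative_eq_intros)
        show "norm (F' s) \<le> sqrt T * C * sin (om * s)" if "0 < s" "s < t" for s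
          by (rule F'_le[OF that])
      qed
      also have "\<dots> = sqrt T * (C / om * (1 - cos (om * t)))"
        by (simp add: algebra_simps diff_divide_distrib)
      finally have F_le: "norm (F t - F 0) \<le> sqrt T * (C / om * (1 - cos (om * t)))" .
      have "F t - F 0 = complex_of_real T"
      proof -
        have "d i * (exp (\<i> * (of_real t * of_real (l i))) * cinner (e i) (\<phi> t - \<eta> t)) - d i * cinner (e i) \<Psi>
            = complex_of_real ((cmod (cinner (e i) w))\<^sup>2)" for i
        proof -
          have "cinner (e i) (exp_i (- t) ?H \<Psi>) = exp (- (\<i> * (of_real t * of_real (l i)))) * cinner (e i) \<Psi>"
            by (simp add: exp_i_coeff[OF A])
          then have "exp (\<i> * (of_real t * of_real (l i))) * cinner (e i) w
              = exp (\<i> * (of_real t * of_real (l i))) * cinner (e i) (\<phi> t - \<eta> t) - cinner (e i) \<Psi>"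
            unfolding w_def cinner_diff_right[of _ "_ - _"]
            by (simp add: right_diff_distrib mult.assoc[symmetric] exp_minus)
          then have "d i * (exp (\<i> * (of_real t * of_real (l i))) * cinner (e i) (\<phi> t - \<eta> t)) - d i * cinner (e i) \<Psi>
              = d i * (exp (\<i> * (of_real t * of_real (l i))) * cinner (e i) w)"
            by (simp add: right_diff_distrib)
          also have "\<dots> = cinner (e i) w * cnj (cinner (e i) w)"
            by (simp add: d_def exp_minus mult_ac)
          finally show ?thesis by (simp only: complex_norm_square)
        qed
        moreover have "F 0 = (\<Sum>i\<in>J. d i * cinner (e i) \<Psi>)"
          by (simp add: F_def \<phi>0 \<eta>0)
        ultimately show ?thesis
          unfolding F_def[of t] T_def of_real_sum by (simp only: sum_subtractf[symmetric])
      qed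
      then have "T \<le> sqrt T * (C / om * (1 - cos (om * t)))"
        using F_le T0 by simp
      then have "sqrt T * sqrt T \<le> sqrt T * (C / om * (1 - cos (om * t)))"
        using T0 by simp
      then have "sqrt T \<le> C / om * (1 - cos (om * t))"
      proof (cases "T = 0")
        case True
        then show ?thesis using cos_le by (simp only: real_sqrt_zero)
      next
        case False
        then have "sqrt T > 0" using T0 by simp
        with \<open>sqrt T * sqrt T \<le> _\<close> show ?thesis by (rule mult_left_le_imp_le)
      qed
      then have "(sqrt T)\<^sup>2 \<le> (C / om * (1 - cos (om * t)))\<^sup>2"
        using T0 by (intro power_mono) auto
      then show "(\<Sum>i\<in>J. (cmod (cinner (e i) w))\<^sup>2) \<le> (C / om * (1 - cos (om * t)))\<^sup>2"
        using T0 by (simp add: T_def[symmetric])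
    qed
    then show ?thesis by (rule power2_le_imp_le) (rule cos_le)
  qed

  \<comment> \<open>The boundary term from below\<close>
  have \<eta>_bound: "norm (\<eta> t) \<ge> lam / om * sin (om * t) * sqrt (\<Sum>m\<le>M. real (m - 1) * N m)"
  proof -
    note S = sin0[OF t(1) order_refl] and nPQ = nP[OF t(1) order_refl] nQ[OF t(1) order_refl]
    let ?c = "\<lambda>j. if fst j then of_real (k (snd j)) * (P t - 1) * z j t else of_real (n (snd j)) * (1 - Q t) * z j t"
    have "inj_on hop {j \<in> K. ?c j \<noteq> 0}"
      by (rule inj_on_subset[OF inj_hop[of "\<lambda>_. 1" "\<lambda>_. 1"]]) (auto split: if_splits)
    then have "norm (\<eta> t) = sqrt (\<Sum>j\<in>K. (cmod (?c j))\<^sup>2)"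
      unfolding \<eta>_def by (rule norm_bvec_sum_eq[OF K]) (auto simp: hop_def)
    \<comment> \<open>A hop has the factor sqrt(m - 1) from spin up and sqrt(m + 1) from spin down;
      since only the joint sector weight is known at time t, the smaller factor is used for
      both.\<close>
    moreover have "(\<Sum>j\<in>K. (cmod (?c j))\<^sup>2) \<ge> (\<Sum>j\<in>K. ((lam / om * sin (om * t) * sqrt (real (snd j - 1))) * cmod (z j t))\<^sup>2)"
    proof (intro sum_mono power_mono)
      fix j :: "bool \<times> nat"
      have "cmod (?c j) = lam / om * sin (om * t) * sqrt (real (if fst j then snd j - 1 else snd j + 1)) * cmod (z j t)"
        using om by (simp add: norm_mult nPQ abs_k abs_n)
      also have "\<dots> \<ge> lam / om * sin (om * t) * sqrt (real (snd j - 1)) * cmod (z j t)"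
        using lam om S by (intro mult_right_mono mult_left_mono real_sqrt_le_mono) auto
      finally show "lam / om * sin (om * t) * sqrt (real (snd j - 1)) * cmod (z j t) \<le> cmod (?c j)" .
    qed (use lam om S in auto)
    moreover have "(\<Sum>j\<in>K. ((lam / om * sin (om * t) * sqrt (real (snd j - 1))) * cmod (z j t))\<^sup>2)
        = (lam / om * sin (om * t))\<^sup>2 * (\<Sum>m\<le>M. real (m - 1) * N m)"
      unfolding sumN[of "\<lambda>m. lam / om * sin (om * t) * sqrt (real (m - 1))"] sum_distrib_left
      by (intro sum.cong) (simp_all add: power_mult_distrib power_divide mult_ac)
    ultimately have "norm (\<eta> t) \<ge> sqrt ((lam / om * sin (om * t))\<^sup>2 * (\<Sum>m\<le>M. real (m - 1) * N m))"
      by simp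
    then show ?thesis using lam om S by (simp add: real_sqrt_mult)
  qed
  have "norm (\<eta> t) \<le> norm (\<phi> t - exp_i (- t) ?H \<Psi>) + norm w"
    using norm_triangle_ineq4[of "\<phi> t - exp_i (- t) ?H \<Psi>" w] by (simp add: w_def)
  moreover have "C / om * (1 - cos (om * t)) = lam / om\<^sup>2 * (1 - cos (t * om)) * (\<bar>Om - om\<bar> * sqrt a1 + 3 * lam * sqrt a2)"
    by (simp add: C_def power2_eq_square mult.commute)
  ultimately show ?thesis
    using \<eta>_bound w_bound unfolding exp_HR' a1_def a2_def by (simp add: mult.commute[of t om])
qed

section \<open>The lower bound\<close>

lemma tendsto_exp_i:
  assumes A: "eigenbasis e l A" and f: "(f \<longlongrightarrow> x) F"
  shows "((\<lambda>n. exp_i t A (f n)) \<longlongrightarrow> exp_i t A x) F"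
  using f unfolding tendsto_dist_iff[of "\<lambda>n. exp_i t A (f n)"] tendsto_dist_iff[of f]
  by (simp add: dist_norm norm_exp_i_diff[OF A])

lemma free_eigenbasis: "\<exists>l. eigenbasis bvec l (H_free om)"
proof -
  have "jc_vec om om 0 0 k = complex_of_real (if fst k then om / 2 + om * (real (snd k) - 1) else - om / 2 + om * real (snd k)) *\<^sub>C bvec k" for k
    by (cases k) (auto simp: jc_vec_def split: bool.split)
  then have "eigenbasis bvec (\<lambda>k. if fst k then om / 2 + om * (real (snd k) - 1) else - om / 2 + om * real (snd k)) (H_free om)"
    unfolding H_free_def free_op_eq
    using jc_vec_mem[of _ om om 0 0] by (intro eigenbasisI closed_symmetric_jc hilbert_basis_bvec) simp
  then show ?thesis by blast
qed

lemma fun_calc_number_sum: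
  assumes "finite K" and f: "f \<in> borel_measurable borel"
  shows "fun_calc f num_op (\<Sum>k\<in>K. c k *\<^sub>C bvec k) = (\<Sum>k\<in>K. (f (num_ev k) * c k) *\<^sub>C bvec k)"
  by (rule fun_calc_eqI[OF number_eigenbasis f]) (simp add: cinner_basis_sum[OF hilbert_basis_bvec \<open>finite K\<close>])

text \<open>Quadratic growth of |f|^2 bounds f (num_ev k) times a coefficient of x by the
  coefficients of x and of N x, both of which are square summable.\<close>

lemma has_sum_fun_calc_number:
  assumes f: "f \<in> borel_measurable borel" and growth: "\<And>r. (cmod (f r))\<^sup>2 \<le> 9 * (1 + r\<^sup>2)" and x: "(x, y) \<in> num_op"
  shows "((\<lambda>k. (f (num_ev k) * cinner (bvec k) x) *\<^sub>C bvec k) has_sum fun_calc f num_op x) UNIV"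
proof -
  have y: "cinner (bvec k) y = complex_of_real (num_ev k) * cinner (bvec k) x" for k
    by (rule eigenbasis_coeff[OF number_eigenbasis x])
  have "(\<lambda>k. 9 * ((cmod (cinner (bvec k) x))\<^sup>2 + (cmod (cinner (bvec k) y))\<^sup>2)) summable_on UNIV"
    by (intro summable_on_cmult_right summable_on_add summable_coeff[OF hilbert_basis_bvec])
  then have "(\<lambda>k. (cmod (f (num_ev k) * cinner (bvec k) x))\<^sup>2) summable_on UNIV"
  proof (rule summable_on_comparison_test)
    fix k
    have "(cmod (f (num_ev k)))\<^sup>2 * (cmod (cinner (bvec k) x))\<^sup>2 \<le> (9 * (1 + (num_ev k)\<^sup>2)) * (cmod (cinner (bvec k) x))\<^sup>2"
      by (intro mult_right_mono growth) simp
    then show "(cmod (f (num_ev k) * cinner (bvec k) x))\<^sup>2 \<le> 9 * ((cmod (cinner (bvec k) x))\<^sup>2 + (cmod (cinner (bvec k) y))\<^sup>2)"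
      by (simp add: y norm_mult power_mult_distrib algebra_simps)
  qed simp
  from has_sum_coeff[OF hilbert_basis_bvec this] obtain w where
    w: "((\<lambda>k. (f (num_ev k) * cinner (bvec k) x) *\<^sub>C bvec k) has_sum w) UNIV"
    "\<And>k. cinner (bvec k) w = (if bvec k = 0 then 0 else f (num_ev k) * cinner (bvec k) x)" by blast
  have "fun_calc f num_op x = w"
    by (rule fun_calc_eqI[OF number_eigenbasis f]) (auto simp: w(2))
  then show ?thesis using w(1) by simp
qed

text \<open>The real \<open>sqrt\<close> is odd, so negative arguments contribute their absolute
  value; the functions of N are estimated on the whole real axis, not only on the spectrum.\<close>

lemma cmod_sqrt_square: "(cmod (complex_of_real (sqrt r)))\<^sup>2 = \<bar>r\<bar>"
proof (cases "r \<ge> 0")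
  case False
  then have "sqrt r = - sqrt (- r)" by (simp add: real_sqrt_minus)
  then show ?thesis using False by simp
qed simp

theorem theorem2p2:
  fixes lam Om om Delta t :: real and \<Psi> :: "real \<Rightarrow> complex ^ 2"
  assumes "lam > 0" and "Om > 0" and "om > 0"
    and "Delta = Om - om"
    and "\<Psi> \<in> schwartz2"
    and "0 \<le> t" and "t \<le> pi / om"
  shows "norm (U2 lam Om om t (abs_l2 \<Psi>) - U1 lam Om om t (abs_l2 \<Psi>)) \<ge>
    lam / om * sin (t * om)
      * norm (fun_calc (\<lambda>n. complex_of_real (sqrt (max 0 (n - 1)))) num_op (abs_l2 \<Psi>))
    - lam / om\<^sup>2 * (1 - cos (t * om))
      * (\<bar>Delta\<bar> * norm (fun_calc (\<lambda>n. complex_of_real (sqrt (n + 2))) num_op (abs_l2 \<Psi>))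
        + 3 * lam * norm (fun_calc (\<lambda>n. complex_of_real (sqrt ((n + 2) * (n + 3)))) num_op (abs_l2 \<Psi>)))"
proof -
  define x where "x = abs_l2 \<Psi>"
  define c where "c k = cinner (bvec k) x" for k
  define S where "S K = (\<Sum>k\<in>K. c k *\<^sub>C bvec k)" for K
  define f1 f2 f3 :: "real \<Rightarrow> complex" where "f1 n = of_real (sqrt (max 0 (n - 1)))"
    and "f2 n = of_real (sqrt (n + 2))" and "f3 n = of_real (sqrt ((n + 2) * (n + 3)))" for n
  have f_meas: "f1 \<in> borel_measurable borel" "f2 \<in> borel_measurable borel" "f3 \<in> borel_measurable borel"
    unfolding f1_def f2_def f3_def by measurable
  have f_sq: "(cmod (f1 n))\<^sup>2 = max 0 (n - 1)" "(cmod (f2 n))\<^sup>2 = \<bar>n + 2\<bar>" "(cmod (f3 n))\<^sup>2 = \<bar>(n + 2) * (n + 3)\<bar>" for n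
    unfolding f1_def f2_def f3_def cmod_sqrt_square by simp_all
  \<comment> \<open>All three follow from 2 |n| \<le> n^2 + 1; for \<open>f3\<close>, this gives n^2
    + 5 n + 6 \<le> 9 (1 + n^2).\<close>
  have f_growth: "(cmod (f1 n))\<^sup>2 \<le> 9 * (1 + n\<^sup>2)" "(cmod (f2 n))\<^sup>2 \<le> 9 * (1 + n\<^sup>2)" "(cmod (f3 n))\<^sup>2 \<le> 9 * (1 + n\<^sup>2)" for n
  proof -
    have n: "2 * n \<le> n\<^sup>2 + 1" "- 2 * n \<le> n\<^sup>2 + 1"
      using zero_le_power2[of "n - 1"] zero_le_power2[of "n + 1"] by (simp_all add: power2_diff power2_sum)
    have p: "(n + 2) * (n + 3) = n\<^sup>2 + 5 * n + 6" by (simp add: power2_eq_square algebra_simps)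
    note n = n zero_le_power2[of n]
    show "(cmod (f1 n))\<^sup>2 \<le> 9 * (1 + n\<^sup>2)"
      unfolding f_sq distrib_left mult_1_right by (rule max.boundedI) (use n in linarith)+
    show "(cmod (f2 n))\<^sup>2 \<le> 9 * (1 + n\<^sup>2)"
      unfolding f_sq distrib_left mult_1_right by (rule abs_leI) (use n in linarith)+
    show "(cmod (f3 n))\<^sup>2 \<le> 9 * (1 + n\<^sup>2)"
      unfolding f_sq unfolding p unfolding distrib_left mult_1_right by (rule abs_leI) (use n in linarith)+
  qed
  let ?H = "H_rabi lam Om om" and ?HR = "H_RWA lam Om om"
  have H: "?H = op_closure (jc_op Om om lam lam)" and HR: "?HR = op_closure (jc_op Om om lam 0)"
    by (simp_all add: H_rabi_def H_RWA_def rabi_op_eq rwa_op_eq)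
  obtain e :: "l2 \<Rightarrow> l2" and l where eH: "eigenbasis e l ?H"
    using rabi_eigenbasis[of lam Om om] assms unfolding H by auto
  obtain e' :: "bool \<times> nat \<Rightarrow> l2" and l' where eHR: "eigenbasis e' l' ?HR"
    using rwa_dynamics[of Om om lam] unfolding HR by metis
  let ?a = "lam / om * sin (t * om)" and ?b = "lam / om\<^sup>2 * (1 - cos (t * om))"
  have t_om: "0 \<le> t * om" "t * om \<le> pi"
    using assms by (simp_all add: field_simps)
  have a: "?a \<ge> 0" and b: "?b \<ge> 0"
    using assms sin_ge_zero[OF t_om] by simp_all

  \<comment> \<open>The estimate for finite combinations of the basis\<close>
  have finite_bound: "?a * norm (fun_calc f1 num_op (S K)) - ?b * (\<bar>Delta\<bar> * norm (fun_calc f2 num_op (S K))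
      + 3 * lam * norm (fun_calc f3 num_op (S K))) \<le> norm (exp_i (- t) ?HR (S K) - exp_i (- t) ?H (S K))"
    if K: "finite K" for K
  proof -
    obtain M where M: "K \<subseteq> UNIV \<times> {..M}"
    proof -
      from K have "finite (snd ` K)" by simp
      then obtain M where "\<forall>m\<in>snd ` K. m \<le> M" unfolding finite_nat_set_iff_bounded_le by blast
      then have "K \<subseteq> UNIV \<times> {..M}" by (auto simp: mem_Times_iff)
      then show ?thesis by (rule that)
    qed
    define u0 where "u0 m = (if (True, m) \<in> K then c (True, m) else 0)" for m
    define v0 where "v0 m = (if (False, m) \<in> K then c (False, m) else 0)" for m
    define N where "N m = (cmod (u0 m))\<^sup>2 + (cmod (v0 m))\<^sup>2" for m
    \<comment> \<open>\<open>bvec (True, 0)\<close> is the zero vector, so x has coefficient 0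
      there.\<close>
    have u00: "u0 0 = 0" by (simp add: u0_def c_def)
    have S_eq: "S K = (\<Sum>m\<le>M. u0 m *\<^sub>C bvec (True, m) + v0 m *\<^sub>C bvec (False, m))"
    proof -
      have "S K = (\<Sum>k\<in>UNIV \<times> {..M}. (if k \<in> K then c k else 0) *\<^sub>C bvec k)"
        unfolding S_def using M by (intro sum.mono_neutral_cong_left) auto
      then show ?thesis unfolding sum_bool_times u0_def v0_def by simp
    qed
    have norm_f: "(norm (fun_calc f num_op (S K)))\<^sup>2
        = (\<Sum>m\<le>M. (cmod (f (real m - 1)))\<^sup>2 * (cmod (u0 m))\<^sup>2 + (cmod (f (real m)))\<^sup>2 * (cmod (v0 m))\<^sup>2)"
      if f: "f \<in> borel_measurable borel" for f
    proof -
      have "(norm (fun_calc f num_op (S K)))\<^sup>2 = (\<Sum>k\<in>K. (cmod (f (num_ev k) * c k) * norm (bvec k))\<^sup>2)"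
        unfolding S_def fun_calc_number_sum[OF K f] by (rule norm_basis_sum[OF hilbert_basis_bvec])
      also have "\<dots> = (\<Sum>k\<in>K. (cmod (f (num_ev k) * c k))\<^sup>2)"
        by (intro sum.cong) (auto simp: norm_bvec c_def)
      also have "\<dots> = (\<Sum>k\<in>UNIV \<times> {..M}. (cmod (f (num_ev k) * (if k \<in> K then c k else 0)))\<^sup>2)"
        using M by (intro sum.mono_neutral_cong_left) auto
      also have "\<dots> = (\<Sum>m\<le>M. (cmod (f (real m - 1)))\<^sup>2 * (cmod (u0 m))\<^sup>2 + (cmod (f (real m)))\<^sup>2 * (cmod (v0 m))\<^sup>2)"
        unfolding sum_bool_times u0_def v0_def num_ev_def by (simp add: norm_mult power_mult_distrib)
      finally show ?thesis .
    qed
    \<comment> \<open>In sector m, N - 1 takes the values m - 2 (spin up) and m - 1 (spin down), so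
      the sector weight m - 1 dominates; natural subtraction agrees with the positive part.\<close>
    have "norm (fun_calc f1 num_op (S K)) \<le> sqrt (\<Sum>m\<le>M. real (m - 1) * N m)"
    proof (rule real_le_rsqrt)
      show "(norm (fun_calc f1 num_op (S K)))\<^sup>2 \<le> (\<Sum>m\<le>M. real (m - 1) * N m)"
        unfolding norm_f[OF f_meas(1)] f_sq N_def distrib_left
        by (intro sum_mono add_mono mult_right_mono) auto
    qed
    then have 1: "?a * norm (fun_calc f1 num_op (S K)) \<le> ?a * sqrt (\<Sum>m\<le>M. real (m - 1) * N m)"
      using a by (rule mult_left_mono)
    \<comment> \<open>Now spin up is the tight case: N + 2 equals m + 1 there and m + 2 for spin
      down. The comparison for (N + 2)(N + 3) below is of the same kind.\<close>
    have 2: "sqrt (\<Sum>m\<le>M. (real m + 1) * N m) \<le> norm (fun_calc f2 num_op (S K))"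
    proof (rule real_le_lsqrt)
      show "(\<Sum>m\<le>M. (real m + 1) * N m) \<le> (norm (fun_calc f2 num_op (S K)))\<^sup>2"
        unfolding norm_f[OF f_meas(2)] f_sq N_def distrib_left[of _ "(cmod _)\<^sup>2"]
        by (intro sum_mono add_mono mult_right_mono) auto
    qed simp
    have 3: "sqrt (\<Sum>m\<le>M. (real m + 1) * (real m + 2) * N m) \<le> norm (fun_calc f3 num_op (S K))"
    proof (rule real_le_lsqrt)
      have "(real m + 1) * (real m + 2) \<le> \<bar>(real m - 1 + 2) * (real m - 1 + 3)\<bar>"
        "(real m + 1) * (real m + 2) \<le> \<bar>(real m + 2) * (real m + 3)\<bar>" for m
        by (simp_all add: abs_mult) (intro mult_mono; simp)
      then show "(\<Sum>m\<le>M. (real m + 1) * (real m + 2) * N m) \<le> (norm (fun_calc f3 num_op (S K)))\<^sup>2"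
        unfolding norm_f[OF f_meas(3)] f_sq N_def distrib_left[of _ "(cmod _)\<^sup>2"]
        by (intro sum_mono add_mono mult_right_mono) simp_all
    qed simp
    have 4: "?b * (\<bar>Delta\<bar> * sqrt (\<Sum>m\<le>M. (real m + 1) * N m) + 3 * lam * sqrt (\<Sum>m\<le>M. (real m + 1) * (real m + 2) * N m))
        \<le> ?b * (\<bar>Delta\<bar> * norm (fun_calc f2 num_op (S K)) + 3 * lam * norm (fun_calc f3 num_op (S K)))"
      using 2 3 b assms(1) by (intro mult_left_mono add_mono) auto
    have "?a * sqrt (\<Sum>m\<le>M. real (m - 1) * N m)
        - ?b * (\<bar>Delta\<bar> * sqrt (\<Sum>m\<le>M. (real m + 1) * N m) + 3 * lam * sqrt (\<Sum>m\<le>M. (real m + 1) * (real m + 2) * N m))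
        \<le> norm (exp_i (- t) ?HR (S K) - exp_i (- t) ?H (S K))"
      unfolding H HR S_eq N_def assms(4)
      by (rule rwa_difference_finite[OF assms(1-3,6,7), where ?u0.0 = u0 and ?v0.0 = v0 and M = M, OF u00])
    then show ?thesis
      by (rule order_trans[OF diff_mono[OF 1 4]])
  qed

  \<comment> \<open>Passage to the limit\<close>
  have "(x, abs_l2 (jc_op 0 1 0 0 \<Psi>)) \<in> num_op"
    unfolding num_op_def number_op_eq x_def by (rule op_closure_memI[OF assms(5)])
  note fc = has_sum_fun_calc_number[OF _ _ this, folded c_def]
  let ?F = "finite_subsets_at_top (UNIV :: (bool \<times> nat) set)"
  have lim_S: "(S \<longlongrightarrow> x) ?F"
    using basis_expansion[OF hilbert_basis_bvec, of x] unfolding has_sum_def S_def[abs_def] c_def[abs_def] by simp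
  \<comment> \<open>A Schwartz spinor lies in the domain of N, which controls each of the three
    moments, so all of them converge along the finite partial sums.\<close>
  have lim_f: "((\<lambda>K. fun_calc f num_op (S K)) \<longlongrightarrow> fun_calc f num_op x) ?F"
    if f: "f \<in> borel_measurable borel" "\<And>r. (cmod (f r))\<^sup>2 \<le> 9 * (1 + r\<^sup>2)" for f
  proof (rule Lim_transform_eventually)
    show "((\<lambda>K. \<Sum>k\<in>K. (f (num_ev k) * c k) *\<^sub>C bvec k) \<longlongrightarrow> fun_calc f num_op x) ?F"
      using fc[OF f] unfolding has_sum_def .
    show "\<forall>\<^sub>F K in ?F. (\<Sum>k\<in>K. (f (num_ev k) * c k) *\<^sub>C bvec k) = fun_calc f num_op (S K)"
      by (rule eventually_finite_subsets_at_top_weakI) (simp add: S_def fun_calc_number_sum f(1))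
  qed
  have "?a * norm (fun_calc f1 num_op x) - ?b * (\<bar>Delta\<bar> * norm (fun_calc f2 num_op x)
      + 3 * lam * norm (fun_calc f3 num_op x)) \<le> norm (exp_i (- t) ?HR x - exp_i (- t) ?H x)"
  proof (rule tendsto_le[OF finite_subsets_at_top_neq_bot])
    show "((\<lambda>K. norm (exp_i (- t) ?HR (S K) - exp_i (- t) ?H (S K))) \<longlongrightarrow> norm (exp_i (- t) ?HR x - exp_i (- t) ?H x)) ?F"
      by (intro tendsto_norm tendsto_diff tendsto_exp_i[OF eHR] tendsto_exp_i[OF eH] lim_S)
    show "((\<lambda>K. ?a * norm (fun_calc f1 num_op (S K)) - ?b * (\<bar>Delta\<bar> * norm (fun_calc f2 num_op (S K))
        + 3 * lam * norm (fun_calc f3 num_op (S K)))) \<longlongrightarrow> ?a * norm (fun_calc f1 num_op x)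
        - ?b * (\<bar>Delta\<bar> * norm (fun_calc f2 num_op x) + 3 * lam * norm (fun_calc f3 num_op x))) ?F"
      by (intro tendsto_norm tendsto_diff tendsto_add tendsto_mult tendsto_const lim_f f_meas f_growth)
    show "\<forall>\<^sub>F K in ?F. ?a * norm (fun_calc f1 num_op (S K)) - ?b * (\<bar>Delta\<bar> * norm (fun_calc f2 num_op (S K))
        + 3 * lam * norm (fun_calc f3 num_op (S K))) \<le> norm (exp_i (- t) ?HR (S K) - exp_i (- t) ?H (S K))"
      by (rule eventually_finite_subsets_at_top_weakI) (rule finite_bound)
  qed
  \<comment> \<open>The common factor e^(itH_0) is an isometry and drops out of the norm.\<close>
  also have "\<dots> = norm (U2 lam Om om t x - U1 lam Om om t x)"
    using free_eigenbasis[of om] by (auto simp: U1_def U2_def norm_exp_i_diff)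
  finally show ?thesis
    unfolding f1_def f2_def f3_def x_def .
qed

end
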